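(* Among the integer parameters $p,q\ge 3$, there exist in $\mathbf{Nil}$ exactly $3$ types of regular $p$-gonal non-face-to-face prism tilings $\mathcal{T}_p(q)$ with $\mathbf{Nil}$ isometry group $\Gamma_p(q)=\mathbf{pq2_1}$, namely: the regular triangular prism tiling with $(p,q)=(3,6)$; the regular square prism tiling with $(p,q)=(4,4)$; and the regular hexagonal prism tiling with $(p,q)=(6,3)$. Moreover, each group $\Gamma_p(q)$ has a free parameter $x_p(q)\in\mathbb{R}^+$, i.e. for each of these three pairs the tiling exists for every value $x_p(q)>0$ of the distance parameter of the vertex $A_1=(x_p(q),0,0)$ of the prism.
   Context: **The space.** $\mathbf{Nil}$ is $\mathbb{R}^3$ with the Heisenberg translations (acting on points on the right) $(a,b,c)\mapsto (x+a,\,y+b,\,z+bx+c)$, for $(x,y,z)\in\mathbb{R}^3$, and the invariant Riemannian metric $ds^2=dx^2+dy^2+(dz-x\,dy)^2$. The fibre lines are the lines parallel to the $z$-axis; the fibre translations are $(a,b,c)\mapsto(a,b,c+z)$. The rotation by angle $\omega$ about the $z$-axis is the isometry $(x,y,z)\mapsto(\bar x,\bar y,\bar z)$ with $$\bar x=x\cos\omega-y\sin\omega,\quad \bar y=x\sin\omega+y\cos\omega,\quad \bar z=z-\tfrac12xy+\tfrac14(x^2-y^2)\sin2\omega+\tfrac12xy\cos2\omega .$$ Rotations about other fibre lines are obtained by conjugating with translations. Isometries act on the right: $P^{gh}=(P^g)^h$. The quadratic map $\mathcal{M}:(x,y,z)\mapsto(x,y,z-\tfrac12xy)$ conjugates the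 rotations about the $z$-axis to Euclidean linear rotations. **Prisms.** The base plane is the plane $z=0$. An infinite $p$-sided prism $\mathcal{P}^i$ is the image under a $\mathbf{Nil}$ isometry of an infinite solid bounded by the planes determined by the fibre lines through the points of a $p$-gon ($p\ge3$) lying in the base plane; this $p$-gon is its base figure. Let $\mathcal{F}=\mathcal{M}^{-1}(\{z=0\})=\{z=\tfrac12xy\}$ and let $\tau$ be a nontrivial fibre translation. A bounded $p$-sided prism is the part of an infinite prism between $\mathcal{F}$ and $\mathcal{F}^\tau$; the parts of $\mathcal{F}$ and $\mathcal{F}^\tau$ inside the infinite prism are its cover faces. A prism is regular if its side surfaces are congruent to each other under $\mathbf{Nil}$ rotations by angle $2\pi/p$ about the central fibre line of the prism. **Tilings.** A regular prism tiling $\mathcal{T}_p(q)$ is a tiling of $\mathbf{Nil}$ by congruent regular bounded $p$-sided prisms (images of one tile under $\mathbf{Nil}$ isometries) such that around each side edge line (a fibre line through a vertex of the base figure) $q$ prisms meet regularly, by $\mathbf{Nil}$ rotations with angle $2\pi/q$. "Non-face-to-face" means that adjacent tiles are not required to meet along entire common faces. The tile $\mathcal{P}_p(q)$ is centred on the $z$-axis, with bottom vertices $A_1=(x_p(q),0,0)$, where $x_p(q)>0$, and $A_{k+1}=A_k^{\mathbf a}$, where $\mathbf a$ is the rotation by $2\pi/p$ about the $z$-axis; its top vertices are the images of the $A_k$ under $\tau$. **The group.** $\Gamma_p(q)=\mathbf{pq2_1}$ is the group $$\mathbf{pq2_1}=\{\mathbf a,\mathbf b:\ \mathbf a^p=\mathbf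 b^q=\mathbf a\mathbf b\mathbf a\mathbf b\,\mathbf a^{-1}\mathbf b^{-1}\mathbf a^{-1}\mathbf b^{-1}=1\},$$ realized as a group of $\mathbf{Nil}$ isometries with $\mathbf a$ the rotation by $2\pi/p$ about the $z$-axis, $\mathbf b$ the rotation by $2\pi/q$ about a side fibre line of $\mathcal{P}_p(q)$ (through a vertex of its base figure), and $\tau=\mathbf a\mathbf b\mathbf a\mathbf b=\mathbf b\mathbf a\mathbf b\mathbf a$ the fibre translation connecting the two cover faces. The tiles of $\mathcal{T}_p(q)$ are the images of $\mathcal{P}_p(q)$ under $\Gamma_p(q)$. *)

theory Defs
  imports "HOL-Analysis.Analysis" "HOL-Algebra.Generated_Groups"
begin

section \<open>Nil geometry\<close>

type_synonym nil_point = "real \<times> real \<times> real"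

text \<open>The Riemannian metric \<open>dx\<^sup>2 + dy\<^sup>2 + (dz - x dy)\<^sup>2\<close> at a point, as a bilinear form on tangent vectors.\<close>

fun nil_metric :: "nil_point \<Rightarrow> nil_point \<Rightarrow> nil_point \<Rightarrow> real" where
  "nil_metric (x, y, z) (u1, u2, u3) (v1, v2, v3) =
     u1 * v1 + u2 * v2 + (u3 - x * u2) * (v3 - x * v2)"

text \<open>A differentiable bijection preserving the metric tensor; smoothness of the map and of its
  inverse follows (invariance of domain and the Myers-Steenrod theorem).\<close>

definition nil_isometry :: "(nil_point \<Rightarrow> nil_point) \<Rightarrow> bool" where
  "nil_isometry f \<longleftrightarrow> bij f \<and>
     (\<forall>P. \<exists>D. (f has_derivative D) (at P) \<and>
        (\<forall>u v. nil_metric (f P) (D u) (D v) = nil_metric P u v))"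

text \<open>Isometries act on the right, so the product \<open>g \<otimes> h\<close> applies \<open>g\<close> first.\<close>

definition Nil_Isom :: "(nil_point \<Rightarrow> nil_point) monoid" where
  "Nil_Isom = \<lparr>carrier = {f. nil_isometry f}, monoid.mult = (\<lambda>g h. h \<circ> g), one = id\<rparr>"

fun nil_translation :: "nil_point \<Rightarrow> nil_point \<Rightarrow> nil_point" where
  "nil_translation (x, y, z) (a, b, c) = (x + a, y + b, z + b * x + c)"

definition fibre_translation :: "real \<Rightarrow> nil_point \<Rightarrow> nil_point" where
  "fibre_translation t = nil_translation (0, 0, t)"

fun nil_rotation :: "real \<Rightarrow> nil_point \<Rightarrow> nil_point" where
  "nil_rotation \<omega> (x, y, z) =
     (x * cos \<omega> - y * sin \<omega>,
      x * sin \<omega> + y * cos \<omega>,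
      z - x * y / 2 + (x\<^sup>2 - y\<^sup>2) / 4 * sin (2 * \<omega>) + x * y / 2 * cos (2 * \<omega>))"

text \<open>Rotation about the fibre line through \<open>P\<close>. It depends only on that fibre line, because
  fibre translations commute with \<open>nil_rotation\<close> and with all translations.\<close>

definition nil_rotation_about :: "nil_point \<Rightarrow> real \<Rightarrow> nil_point \<Rightarrow> nil_point" where
  "nil_rotation_about P \<omega> =
     nil_translation P \<circ> nil_rotation \<omega> \<circ> inv_into UNIV (nil_translation P)"

fun nil_M :: "nil_point \<Rightarrow> nil_point" where
  "nil_M (x, y, z) = (x, y, z - x * y / 2)"

fun base_proj :: "nil_point \<Rightarrow> real \<times> real" where
  "base_proj (x, y, z) = (x, y)"

text \<open>The union of all fibre lines through points \<open>(x, y, 0)\<close> with \<open>(x, y) \<in> S\<close>.\<close>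

definition fibres_over :: "(real \<times> real) set \<Rightarrow> nil_point set" where
  "fibres_over S = base_proj -` S"

section \<open>Prisms\<close>

text \<open>A \<open>p\<close>-gon in the base plane is given by its vertices \<open>v 0, \<dots>, v (p - 1)\<close> in cyclic order.\<close>

definition polygon_edge :: "nat \<Rightarrow> (nat \<Rightarrow> real \<times> real) \<Rightarrow> nat \<Rightarrow> (real \<times> real) set" where
  "polygon_edge p v k = closed_segment (v k) (v (Suc k mod p))"

definition is_polygon :: "nat \<Rightarrow> (nat \<Rightarrow> real \<times> real) \<Rightarrow> bool" where
  "is_polygon p v \<longleftrightarrow> p \<ge> 3 \<and> inj_on v {..<p} \<and>
     (\<forall>i<p. \<forall>j<p. i \<noteq> j \<longrightarrow>
        polygon_edge p v i \<inter> polygon_edge p v j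
          \<subseteq> {v i, v (Suc i mod p)} \<inter> {v j, v (Suc j mod p)})"

definition polygon_outline :: "nat \<Rightarrow> (nat \<Rightarrow> real \<times> real) \<Rightarrow> (real \<times> real) set" where
  "polygon_outline p v = (\<Union>k<p. polygon_edge p v k)"

definition polygon_region :: "nat \<Rightarrow> (nat \<Rightarrow> real \<times> real) \<Rightarrow> (real \<times> real) set" where
  "polygon_region p v = polygon_outline p v \<union> inside (polygon_outline p v)"

text \<open>The infinite prism with base figure \<open>v\<close>, moved by the isometry \<open>f\<close>.\<close>

definition infinite_prism ::
  "(nil_point \<Rightarrow> nil_point) \<Rightarrow> nat \<Rightarrow> (nat \<Rightarrow> real \<times> real) \<Rightarrow> nil_point set" where
  "infinite_prism f p v = f ` fibres_over (polygon_region p v)"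

definition cover_surface :: "nil_point set" where
  "cover_surface = nil_M -` {(x, y, z). z = 0}"

text \<open>The closed layer between the cover surface and its image under \<open>fibre_translation t\<close>;
  both signs of \<open>t\<close> are allowed.\<close>

definition layer :: "real \<Rightarrow> nil_point set" where
  "layer t = (\<Union>s\<in>closed_segment 0 t. fibre_translation s ` cover_surface)"

definition bounded_prism ::
  "(nil_point \<Rightarrow> nil_point) \<Rightarrow> nat \<Rightarrow> (nat \<Rightarrow> real \<times> real) \<Rightarrow> real \<Rightarrow> nil_point set" where
  "bounded_prism f p v t = infinite_prism f p v \<inter> layer t"

definition side_surface ::
  "(nil_point \<Rightarrow> nil_point) \<Rightarrow> nat \<Rightarrow> (nat \<Rightarrow> real \<times> real) \<Rightarrow> real \<Rightarrow> nat \<Rightarrow> nil_point set" where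
  "side_surface f p v t k = f ` fibres_over (polygon_edge p v k) \<inter> layer t"

text \<open>The point \<open>C\<close> below lies on the central fibre line of the prism.\<close>

definition regular_bounded_prism ::
  "(nil_point \<Rightarrow> nil_point) \<Rightarrow> nat \<Rightarrow> (nat \<Rightarrow> real \<times> real) \<Rightarrow> real \<Rightarrow> bool" where
  "regular_bounded_prism f p v t \<longleftrightarrow>
     nil_isometry f \<and> is_polygon p v \<and> t \<noteq> 0 \<and>
     (\<exists>C. \<forall>k<p. \<forall>l<p. \<exists>j.
        ((nil_rotation_about C (2 * pi / real p)) ^^ j) ` side_surface f p v t k
          = side_surface f p v t l)"

section \<open>Tilings\<close>

definition is_tiling :: "nil_point set set \<Rightarrow> bool" where
  "is_tiling \<T> \<longleftrightarrow> \<Union>\<T> = UNIV \<and>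
     (\<forall>T\<in>\<T>. \<forall>T'\<in>\<T>. T \<noteq> T' \<longrightarrow> interior T \<inter> interior T' = {})"

text \<open>Along the fibre line through \<open>V\<close>, which contains a side edge of the tile \<open>T\<close>: the tiles
  meeting the relative interior of that edge are exactly the \<open>q\<close> different images of \<open>T\<close> under the
  rotations by multiples of \<open>2\<pi>/q\<close>. (The end points of the edge also belong to the tiles stacked
  above and below.)\<close>

definition meet_regularly ::
  "nat \<Rightarrow> nil_point set set \<Rightarrow> nil_point set \<Rightarrow> nil_point \<Rightarrow> bool" where
  "meet_regularly q \<T> T V \<longleftrightarrow>
     (let L = fibres_over {base_proj V};
          M = {T'\<in>\<T>. T' \<inter> rel_interior (T \<inter> L) \<noteq> {}}
      in M = {((nil_rotation_about V (2 * pi / real q)) ^^ j) ` T |j. j < q} \<and> card M = q)"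

text \<open>All tiles are isometric images of one regular bounded prism, whose \<open>k\<close>-th side edge line passes
  through \<open>f (v k, 0)\<close>. Tiles need not meet along entire faces.\<close>

definition regular_prism_tiling ::
  "nat \<Rightarrow> nat \<Rightarrow> (nil_point \<Rightarrow> nil_point) \<Rightarrow> (nat \<Rightarrow> real \<times> real) \<Rightarrow> real \<Rightarrow> nil_point set set \<Rightarrow> bool" where
  "regular_prism_tiling p q f v t \<T> \<longleftrightarrow>
     regular_bounded_prism f p v t \<and> is_tiling \<T> \<and>
     (\<forall>T\<in>\<T>. \<exists>g. nil_isometry g \<and> T = g ` bounded_prism f p v t \<and>
        (\<forall>k<p. meet_regularly q \<T> T (g (f (fst (v k), snd (v k), 0)))))"

section \<open>The presented group\<close>

datatype pq_gen = GenA | GenB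

text \<open>Words in the generators; the flag \<open>False\<close> marks an inverse letter.\<close>

type_synonym pq_word = "(pq_gen \<times> bool) list"

definition pq21_relators :: "nat \<Rightarrow> nat \<Rightarrow> pq_word set" where
  "pq21_relators p q =
     {replicate p (GenA, True),
      replicate q (GenB, True),
      [(GenA, True), (GenB, True), (GenA, True), (GenB, True),
       (GenA, False), (GenB, False), (GenA, False), (GenB, False)]}"

inductive pq21_equiv :: "nat \<Rightarrow> nat \<Rightarrow> pq_word \<Rightarrow> pq_word \<Rightarrow> bool" for p q :: nat where
  refl: "pq21_equiv p q u u"
| sym: "pq21_equiv p q u w \<Longrightarrow> pq21_equiv p q w u"
| trans: "pq21_equiv p q u w \<Longrightarrow> pq21_equiv p q w w' \<Longrightarrow> pq21_equiv p q u w'"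
| cancel: "pq21_equiv p q (u @ [(s, e), (s, \<not> e)] @ w) (u @ w)"
| relator: "r \<in> pq21_relators p q \<Longrightarrow> pq21_equiv p q (u @ r @ w) (u @ w)"

definition pq21_class :: "nat \<Rightarrow> nat \<Rightarrow> pq_word \<Rightarrow> pq_word set" where
  "pq21_class p q u = {w. pq21_equiv p q u w}"

definition pq21 :: "nat \<Rightarrow> nat \<Rightarrow> pq_word set monoid" where
  "pq21 p q =
     \<lparr>carrier = range (pq21_class p q),
      monoid.mult = (\<lambda>U W. \<Union>u\<in>U. \<Union>w\<in>W. pq21_class p q (u @ w)),
      one = pq21_class p q []\<rparr>"

section \<open>The tile, its group and the tiling\<close>

definition rot_a :: "nat \<Rightarrow> nil_point \<Rightarrow> nil_point" where
  "rot_a p = nil_rotation (2 * pi / real p)"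

text \<open>Bottom vertices, indexed from \<open>0\<close>: \<open>bottom_vertex p x k\<close> is the vertex \<open>A\<^sub>k\<^sub>+\<^sub>1\<close>.\<close>

definition bottom_vertex :: "nat \<Rightarrow> real \<Rightarrow> nat \<Rightarrow> nil_point" where
  "bottom_vertex p x k = (rot_a p ^^ k) (x, 0, 0)"

definition base_figure :: "nat \<Rightarrow> real \<Rightarrow> nat \<Rightarrow> real \<times> real" where
  "base_figure p x k = base_proj (bottom_vertex p x k)"

text \<open>The side fibre line chosen for the second generator is the one through the first vertex; any
  other side line replaces it by a conjugate under a power of \<open>rot_a p\<close>.\<close>

definition rot_b :: "nat \<Rightarrow> nat \<Rightarrow> real \<Rightarrow> nil_point \<Rightarrow> nil_point" where
  "rot_b p q x = nil_rotation_about (bottom_vertex p x 0) (2 * pi / real q)"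

definition tiling_group :: "nat \<Rightarrow> nat \<Rightarrow> real \<Rightarrow> (nil_point \<Rightarrow> nil_point) set" where
  "tiling_group p q x = generate Nil_Isom {rot_a p, rot_b p q x}"

text \<open>The presented group is realized faithfully by the two rotations.\<close>

definition realizes_pq21 :: "nat \<Rightarrow> nat \<Rightarrow> real \<Rightarrow> bool" where
  "realizes_pq21 p q x \<longleftrightarrow>
     (\<exists>\<phi> \<in> iso (pq21 p q) (Nil_Isom\<lparr>carrier := tiling_group p q x\<rparr>).
        \<phi> (pq21_class p q [(GenA, True)]) = rot_a p \<and>
        \<phi> (pq21_class p q [(GenB, True)]) = rot_b p q x)"

text \<open>\<open>\<T>\<close> is the tiling for the parameters \<open>p\<close>, \<open>q\<close> and the distance parameter \<open>x\<close>; \<open>t\<close> is the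
  (signed) length of the fibre translation \<open>\<tau> = abab = baba\<close>.\<close>

definition pq21_prism_tiling :: "nat \<Rightarrow> nat \<Rightarrow> real \<Rightarrow> nil_point set set \<Rightarrow> bool" where
  "pq21_prism_tiling p q x \<T> \<longleftrightarrow>
     realizes_pq21 p q x \<and>
     (\<exists>t. let a = rot_a p; b = rot_b p q x in
        a \<otimes>\<^bsub>Nil_Isom\<^esub> b \<otimes>\<^bsub>Nil_Isom\<^esub> a \<otimes>\<^bsub>Nil_Isom\<^esub> b = fibre_translation t \<and>
        b \<otimes>\<^bsub>Nil_Isom\<^esub> a \<otimes>\<^bsub>Nil_Isom\<^esub> b \<otimes>\<^bsub>Nil_Isom\<^esub> a = fibre_translation t \<and>
        regular_prism_tiling p q id (base_figure p x) t \<T> \<and>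
        \<T> = {g ` bounded_prism id p (base_figure p x) t |g. g \<in> tiling_group p q x})"

end

theory Submission
  imports Defs
begin

text \<open>In the coordinates \<open>c = x + i y\<close> and \<open>w = z - x y / 2\<close> every motion generated by translations and
  rotations has the form \<open>(c, w) \<mapsto> (\<rho> c + v, w + Im (cnj v \<rho> c) / 2 + s)\<close> with \<open>|\<rho>| = 1\<close>. The
  rotation part of the fibre translation \<open>abab\<close> is \<open>1\<close>, so \<open>2 / p + 2 / q\<close> is an integer, hence \<open>1\<close>, which
  leaves three pairs.

  Conversely, for these pairs the centres (images of the origin) and the vertices of the base figures
  lie in different classes of a square or triangular lattice with minimal distance \<open>x\<close>. Therefore no
  centre lies inside a circle of radius \<open>x\<close> about a vertex, and the base polygon is the Voronoi cell of
  the origin among the centres. So every point lies over the cell of a nearest centre, and the tiles over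
  one cell are stacked by the powers of \<open>\<tau> = abab\<close>.

  The realization is faithful since \<open>\<tau>\<close> is central in the presented group and, with \<open>r\<close> the generator of
  larger order and \<open>X\<close> a product of the generators that acts as a translation, the elements \<open>X\<close>,
  \<open>Y = r X r\<^sup>-\<^sup>1\<close> and \<open>\<tau>\<close> span a Heisenberg group normalized by \<open>r\<close>. Every element thus equals some
  \<open>X\<^sup>i Y\<^sup>j \<tau>\<^sup>k r\<^sup>n\<close>, and such a product acts trivially only if it is trivial.\<close>

text \<open>Two obstacles lie outside the planar picture. First, tiles over one cell are stacked
  without overlap only if every motion of the group that fixes a centre fibre shifts heights by a
  multiple of \<open>t\<close>. Rotation and translation parts alone cannot show this, so the
  explicit families \<open>eis_map\<close> and \<open>gauss_map\<close> also carry the height: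
  \<open>t\<close> times an integer plus a fixed fraction of the norm of the translation part.
  Second, faithfulness does not follow from the tiling. The commutator relations of the translations
  must be derived inside the presented group, from its three relators. The exponents 2 and 3 found
  there are the areas of the cells of the translation lattice in units of |t| = x^2 sin (2 pi / q),
  as the vertical part of a commutator of two translations is the area that they span.

  All metric facts about the group are gathered in the assumption of the locale
  \<open>prism_tiling\<close>; the two lattices enter the tiling argument only when that assumption
  is verified.\<close>

fun base_pt :: "nil_point \<Rightarrow> complex" where
  "base_pt (x, y, z) = Complex x y"

fun height :: "nil_point \<Rightarrow> real" where
  "height (x, y, z) = z - x * y / 2"

definition mk_pt :: "complex \<Rightarrow> real \<Rightarrow> nil_point" where
  "mk_pt c w = (Re c, Im c, w + Re c * Im c / 2)"

lemma base_pt_mk_pt [simp]: "base_pt (mk_pt c w) = c"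
  by (simp add: mk_pt_def)

lemma height_mk_pt [simp]: "height (mk_pt c w) = w"
  by (simp add: mk_pt_def)

lemma mk_pt_base_pt_height [simp]: "mk_pt (base_pt P) (height P) = P"
  by (cases P) (simp add: mk_pt_def)

lemma nil_point_eqI: "base_pt P = base_pt Q \<Longrightarrow> height P = height Q \<Longrightarrow> P = Q"
  by (metis mk_pt_base_pt_height)

lemma base_proj_conv: "base_proj P = (Re (base_pt P), Im (base_pt P))"
  by (cases P) simp

text \<open>\<open>Im (cnj v * w) / 2\<close> is the signed area of the triangle with corners 0,
  \<open>v\<close>, \<open>w\<close>. It is the Heisenberg cocycle in the coordinates
  \<open>base_pt\<close>, \<open>height\<close>.\<close>

definition nil_map :: "complex \<Rightarrow> complex \<Rightarrow> real \<Rightarrow> nil_point \<Rightarrow> nil_point" where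
  "nil_map \<rho> v s P = mk_pt (\<rho> * base_pt P + v) (height P + Im (cnj v * (\<rho> * base_pt P)) / 2 + s)"

lemma base_pt_nil_map [simp]: "base_pt (nil_map \<rho> v s P) = \<rho> * base_pt P + v"
  by (simp add: nil_map_def)

lemma height_nil_map [simp]:
  "height (nil_map \<rho> v s P) = height P + Im (cnj v * (\<rho> * base_pt P)) / 2 + s"
  by (simp add: nil_map_def)

lemma nil_map_comp:
  assumes "cmod \<rho>' = 1"
  shows "nil_map \<rho>' v' s' \<circ> nil_map \<rho> v s =
         nil_map (\<rho>' * \<rho>) (\<rho>' * v + v') (s + s' + Im (cnj v' * (\<rho>' * v)) / 2)"
proof
  fix P
  define c where "c = \<rho> * base_pt P"
  have "\<rho>' * cnj \<rho>' = 1"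
    using assms complex_norm_square[of \<rho>'] by simp
  \<comment> \<open>A unit factor preserves the area form, which makes the family closed under
    composition.\<close>
  then have "cnj (\<rho>' * v) * (\<rho>' * c) = cnj v * c"
    by (simp add: mult.assoc mult.left_commute mult.commute)
  then have "Im (cnj (\<rho>' * v + v') * (\<rho>' * c)) = Im (cnj v * c) + Im (cnj v' * (\<rho>' * c))"
    by (metis complex_cnj_add distrib_right plus_complex.simps(2))
  moreover have "Im (cnj v' * (\<rho>' * (c + v))) = Im (cnj v' * (\<rho>' * c)) + Im (cnj v' * (\<rho>' * v))"
    by (simp only: distrib_left plus_complex.simps)
  ultimately show "(nil_map \<rho>' v' s' \<circ> nil_map \<rho> v s) P =
         nil_map (\<rho>' * \<rho>) (\<rho>' * v + v') (s + s' + Im (cnj v' * (\<rho>' * v)) / 2) P"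
    apply (intro nil_point_eqI)
     apply (simp add: algebra_simps)
    apply (simp only: comp_apply base_pt_nil_map height_nil_map c_def[symmetric] mult.assoc)
    apply argo
    done
qed

lemma nil_map_id: "nil_map 1 0 0 = id"
  by (rule ext, rule nil_point_eqI) auto

text \<open>The images of two points recover all three parameters. Identities between motions thus
  become identities between parameters.\<close>

lemma nil_map_eq_iff: "nil_map \<rho> v s = nil_map \<rho>' v' s' \<longleftrightarrow> \<rho> = \<rho>' \<and> v = v' \<and> s = s'"
proof
  assume eq: "nil_map \<rho> v s = nil_map \<rho>' v' s'"
  have "v = v'" "s = s'"
    using arg_cong[OF fun_cong[OF eq, of "mk_pt 0 0"], of base_pt]
      arg_cong[OF fun_cong[OF eq, of "mk_pt 0 0"], of height] by simp_all
  then show "\<rho> = \<rho>' \<and> v = v' \<and> s = s'"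
    using arg_cong[OF fun_cong[OF eq, of "mk_pt 1 0"], of base_pt] by simp
qed auto

lemma nil_rotation_eq_nil_map: "nil_rotation \<omega> = nil_map (cis \<omega>) 0 0"
proof
  fix P :: nil_point
  obtain x y z where P: "P = (x, y, z)" by (cases P)
  define c s where "c = cos \<omega>" and "s = sin \<omega>"
  have "c * c + s * s = 1" by (simp add: c_def s_def)
  moreover have "cos (2 * \<omega>) = c * c - s * s" "sin (2 * \<omega>) = 2 * s * c"
    by (simp_all add: c_def s_def cos_double sin_double power2_eq_square)
  \<comment> \<open>The quadratic terms of the rotation formula are exactly the change of x y /
    2.\<close>
  ultimately have "height (nil_rotation \<omega> P) = height P"
    by (simp add: P c_def[symmetric] s_def[symmetric] power2_eq_square field_simps) algebra
  then show "nil_rotation \<omega> P = nil_map (cis \<omega>) 0 0 P"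
    by (intro nil_point_eqI) (auto simp: P complex_eq_iff algebra_simps)
qed

lemma nil_translation_eq_nil_map: "nil_translation P = nil_map 1 (base_pt P) (height P)"
proof
  fix Q
  show "nil_translation P Q = nil_map 1 (base_pt P) (height P) Q"
    by (cases P; cases Q; rule nil_point_eqI) (auto simp: complex_eq_iff field_simps)
qed

lemma fibre_translation_eq_nil_map: "fibre_translation t = nil_map 1 0 t"
  by (simp add: fibre_translation_def nil_translation_eq_nil_map nil_map_eq_iff complex_eq_iff)

lemma nil_map_inverse:
  assumes "cmod \<rho> = 1"
  shows "nil_map (cnj \<rho>) (- cnj \<rho> * v) (- s) \<circ> nil_map \<rho> v s = id"
    and "nil_map \<rho> v s \<circ> nil_map (cnj \<rho>) (- cnj \<rho> * v) (- s) = id"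
proof -
  have 1: "\<rho> * cnj \<rho> = 1" "cnj \<rho> * \<rho> = 1"
    using assms complex_norm_square[of \<rho>] by (simp_all add: mult.commute)
  have 2: "\<rho> * (- cnj \<rho> * v) = - v"
    using 1 by (simp add: mult.assoc[symmetric])
  have 3: "Im (cnj v * - v) = 0" by simp
  show "nil_map (cnj \<rho>) (- cnj \<rho> * v) (- s) \<circ> nil_map \<rho> v s = id"
    using assms 1 by (simp add: nil_map_comp nil_map_id[symmetric] nil_map_eq_iff)
      (simp add: algebra_simps)
  show "nil_map \<rho> v s \<circ> nil_map (cnj \<rho>) (- cnj \<rho> * v) (- s) = id"
    by (simp only: nil_map_comp[OF assms] 1 2 3 nil_map_id[symmetric]) simp
qed

lemma inv_nil_map:
  assumes "cmod \<rho> = 1"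
  shows "inv_into UNIV (nil_map \<rho> v s) = nil_map (cnj \<rho>) (- cnj \<rho> * v) (- s)"
  by (rule inv_unique_comp) (use nil_map_inverse[OF assms] in auto)

lemma bij_nil_map: "cmod \<rho> = 1 \<Longrightarrow> bij (nil_map \<rho> v s)"
  using nil_map_inverse o_bij by blast

text \<open>The height shift compensates the area term on the fibre through \<open>P\<close>, so
  that this fibre is fixed pointwise. All vertical motion in the tiling group originates from this
  term.\<close>

lemma nil_rotation_about_eq_nil_map:
  "nil_rotation_about P \<omega> =
     nil_map (cis \<omega>) ((1 - cis \<omega>) * base_pt P) (- Im (cis \<omega>) * (cmod (base_pt P))\<^sup>2 / 2)"
proof -
  define c where "c = base_pt P"
  have "cmod c ^ 2 = Re c ^ 2 + Im c ^ 2" by (simp add: cmod_power2)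
  then show ?thesis
    unfolding nil_rotation_about_def nil_translation_eq_nil_map nil_rotation_eq_nil_map c_def[symmetric]
    by (simp add: inv_nil_map nil_map_comp nil_map_eq_iff algebra_simps power2_eq_square)
qed

section \<open>Isometries of the Nil metric\<close>

lemma nil_isometry_comp:
  assumes "nil_isometry f" "nil_isometry g"
  shows "nil_isometry (g \<circ> f)"
  unfolding nil_isometry_def
proof (intro conjI allI)
  show "bij (g \<circ> f)" using assms by (simp add: nil_isometry_def bij_comp)
  fix P
  obtain D where D: "(f has_derivative D) (at P)"
    "\<And>u v. nil_metric (f P) (D u) (D v) = nil_metric P u v"
    using assms(1) unfolding nil_isometry_def by blast
  obtain E where E: "(g has_derivative E) (at (f P))"
    "\<And>u v. nil_metric (g (f P)) (E u) (E v) = nil_metric (f P) u v"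
    using assms(2) unfolding nil_isometry_def by blast
  have "(g \<circ> f has_derivative E \<circ> D) (at P)"
    using D(1) E(1) by (rule diff_chain_at)
  then show "\<exists>D. (g \<circ> f has_derivative D) (at P) \<and>
      (\<forall>u v. nil_metric ((g \<circ> f) P) (D u) (D v) = nil_metric P u v)"
    using D(2) E(2) by (intro exI[of _ "E \<circ> D"]) simp
qed

lemma nil_isometry_id: "nil_isometry id"
  unfolding nil_isometry_def
  by (intro conjI allI exI[of _ "\<lambda>u. u"]) (auto simp: id_def bij_id[unfolded id_def])

lemma nil_metric_conv:
  "nil_metric P u v = fst u * fst v + fst (snd u) * fst (snd v)
     + (snd (snd u) - fst P * fst (snd u)) * (snd (snd v) - fst P * fst (snd v))"
  by (cases P; cases u; cases v) simp

lemma nil_metric_definite: "nil_metric P u u = 0 \<longleftrightarrow> u = 0"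
proof (cases P, cases u)
  fix x y z u1 u2 u3 assume P: "P = (x, y, z)" "u = (u1, u2, u3)"
  have "u1 * u1 + u2 * u2 + (u3 - x * u2) * (u3 - x * u2) = 0 \<longleftrightarrow> u1 = 0 \<and> u2 = 0 \<and> u3 - x * u2 = 0"
    by (metis add_nonneg_eq_0_iff add_cancel_right_left mult_eq_0_iff sum_squares_ge_zero sum_squares_eq_zero_iff zero_le_square)
  then show ?thesis by (auto simp: P zero_prod_def)
qed

text \<open>Differentiability of the inverse has to be earned: invariance of domain makes the
  inverse continuous, definiteness of the metric makes the derivative injective and hence
  invertible, and the inverse function rule combines the two.\<close>

lemma nil_isometry_inv:
  assumes "nil_isometry f"
  shows "nil_isometry (inv_into UNIV f)"
  unfolding nil_isometry_def
proof (intro conjI allI)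
  have bij: "bij f" using assms by (simp add: nil_isometry_def)
  then show "bij (inv_into UNIV f)" by (rule bij_imp_bij_inv)
  fix Q :: nil_point
  define P where "P = inv_into UNIV f Q"
  have Q: "Q = f P" using bij by (simp add: P_def bij_is_surj surj_f_inv_f)
  have "continuous_on UNIV f"
    using assms by (meson continuous_at_imp_continuous_on has_derivative_continuous nil_isometry_def)
  then obtain g where g: "homeomorphism UNIV (f ` UNIV) f g"
    using invariance_of_domain_homeomorphism[of UNIV f] bij by (auto simp: bij_is_inj)
  then have "g = inv_into UNIV f"
    using bij by (intro inv_unique_comp[symmetric]) (auto simp: homeomorphism_def bij_is_surj o_def)
  then have cont: "isCont (inv_into UNIV f) Q"
    using g bij unfolding homeomorphism_def
    by (metis UNIV_I bij_is_surj continuous_on_eq_continuous_at open_UNIV)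
  obtain D where D: "(f has_derivative D) (at P)"
    "\<And>u v. nil_metric (f P) (D u) (D v) = nil_metric P u v"
    using assms unfolding nil_isometry_def by blast
  have lin: "linear D" using D(1) has_derivative_linear by blast
  have "inj D"
    using D(2) nil_metric_definite[of P] nil_metric_definite[of "f P"]
    by (intro linear_injective_0[OF lin, THEN iffD2] allI impI) metis
  then obtain E where E: "linear E" "\<And>u. E (D u) = u" "\<And>u. D (E u) = u"
    using linear_injective_isomorphism[OF lin] by blast
  have "(inv_into UNIV f has_derivative E) (at Q)"
  proof (rule has_derivative_inverse_basic[where f = f and f' = D and T = UNIV])
    show "(f has_derivative D) (at (inv_into UNIV f Q))" using D(1) by (simp add: P_def)
  qed (use E cont bij in \<open>auto simp: linear_conv_bounded_linear o_def bij_is_surj surj_f_inv_f id_def\<close>)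
  moreover have "nil_metric P (E u) (E v) = nil_metric Q u v" for u v
    using D(2)[of "E u" "E v"] by (simp add: E Q)
  ultimately show "\<exists>D. (inv_into UNIV f has_derivative D) (at Q) \<and>
      (\<forall>u v. nil_metric (inv_into UNIV f Q) (D u) (D v) = nil_metric Q u v)"
    unfolding P_def by blast
qed

lemma group_Nil_Isom: "group Nil_Isom"
proof (rule groupI)
  fix f assume "f \<in> carrier Nil_Isom"
  then have "nil_isometry f" by (simp add: Nil_Isom_def)
  then show "\<exists>g\<in>carrier Nil_Isom. g \<otimes>\<^bsub>Nil_Isom\<^esub> f = \<one>\<^bsub>Nil_Isom\<^esub>"
    using nil_isometry_inv[of f] nil_isometry_def[of f]
    by (intro bexI[of _ "inv_into UNIV f"])
      (simp_all add: Nil_Isom_def bij_is_surj surj_iff[symmetric])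
qed (auto simp: Nil_Isom_def nil_isometry_comp nil_isometry_id[unfolded id_def] nil_isometry_id comp_assoc)

lemma nil_isometry_rotation: "nil_isometry (nil_rotation \<omega>)"
  unfolding nil_isometry_def
proof (intro conjI allI)
  show "bij (nil_rotation \<omega>)" by (simp add: nil_rotation_eq_nil_map bij_nil_map)
  fix P :: nil_point
  obtain x y z where P: "P = (x, y, z)" by (cases P)
  define c s where "c = cos \<omega>" and "s = sin \<omega>"
  define C S where "C = cos (2 * \<omega>)" and "S = sin (2 * \<omega>)"
  define D :: "nil_point \<Rightarrow> nil_point" where
    "D = (\<lambda>u. (fst u * c - fst (snd u) * s, fst u * s + fst (snd u) * c,
       snd (snd u) - (fst u * y + x * fst (snd u)) / 2
       + (2 * x * fst u - 2 * y * fst (snd u)) / 4 * S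
       + (fst u * y + x * fst (snd u)) / 2 * C))"
  have rot: "nil_rotation \<omega> = (\<lambda>u. (fst u * c - fst (snd u) * s, fst u * s + fst (snd u) * c,
       snd (snd u) - fst u * fst (snd u) / 2 + ((fst u)\<^sup>2 - (fst (snd u))\<^sup>2) / 4 * S
       + fst u * fst (snd u) / 2 * C))"
    by (auto simp: fun_eq_iff c_def s_def C_def S_def)
  have "(nil_rotation \<omega> has_derivative D) (at P)"
    unfolding rot D_def P
    by (auto intro!: derivative_eq_intros simp: fun_eq_iff field_simps)
  moreover have "nil_metric (nil_rotation \<omega> P) (D u) (D v) = nil_metric P u v" for u v
  proof -
    obtain u1 u2 u3 v1 v2 v3 where uv: "u = (u1, u2, u3)" "v = (v1, v2, v3)"
      by (cases u, cases v) auto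
    have cs: "c * c + s * s = 1" by (simp add: c_def s_def)
    have CS: "C = c * c - s * s" "S = 2 * s * c"
      by (simp_all add: C_def S_def c_def s_def cos_double sin_double power2_eq_square)
    \<comment> \<open>The form dz - x dy is invariant under the rotation, while dx and dy are
      rotated; the metric is the sum of the three squares.\<close>
    have "snd (snd (D w)) - (x * c - y * s) * fst (snd (D w)) = snd (snd w) - x * fst (snd w)" for w
      using cs unfolding D_def CS by (simp add: field_simps) algebra
    moreover have "fst (D u) * fst (D v) + fst (snd (D u)) * fst (snd (D v)) = u1 * v1 + u2 * v2"
      using cs unfolding D_def uv fst_conv snd_conv by algebra
    ultimately show ?thesis
      by (simp add: nil_metric_conv P rot) (simp add: uv)
  qed
  ultimately show "\<exists>D. (nil_rotation \<omega> has_derivative D) (at P) \<and>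
      (\<forall>u v. nil_metric (nil_rotation \<omega> P) (D u) (D v) = nil_metric P u v)" by blast
qed

lemma nil_isometry_translation: "nil_isometry (nil_translation A)"
  unfolding nil_isometry_def
proof (intro conjI allI)
  show "bij (nil_translation A)" by (simp add: nil_translation_eq_nil_map bij_nil_map)
  fix P
  obtain a b c where A: "A = (a, b, c)" by (cases A)
  define D :: "nil_point \<Rightarrow> nil_point" where
    "D = (\<lambda>u. (fst u, fst (snd u), fst (snd u) * a + snd (snd u)))"
  have tr: "nil_translation A = (\<lambda>u. (a + fst u, b + fst (snd u), c + fst (snd u) * a + snd (snd u)))"
    by (auto simp: fun_eq_iff A)
  have "(nil_translation A has_derivative D) (at P)"
    unfolding tr D_def by (auto intro!: derivative_eq_intros)
  moreover have "nil_metric (nil_translation A P) (D u) (D v) = nil_metric P u v" for u v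
    by (cases P; cases u; cases v) (simp add: A D_def algebra_simps)
  ultimately show "\<exists>D. (nil_translation A has_derivative D) (at P) \<and>
      (\<forall>u v. nil_metric (nil_translation A P) (D u) (D v) = nil_metric P u v)" by blast
qed

lemma nil_isometry_rotation_about: "nil_isometry (nil_rotation_about P \<omega>)"
  unfolding nil_rotation_about_def
  by (intro nil_isometry_comp nil_isometry_inv nil_isometry_rotation nil_isometry_translation)

lemma funpow_nil_rotation: "nil_rotation \<omega> ^^ n = nil_rotation (real n * \<omega>)"
  by (induction n) (simp_all add: nil_rotation_eq_nil_map nil_map_id nil_map_comp cis_mult distrib_right)

lemma funpow_nil_rotation_about: "nil_rotation_about P \<omega> ^^ n = nil_rotation_about P (real n * \<omega>)"
proof (induction n)
  case 0
  then show ?case by (simp add: nil_rotation_about_eq_nil_map nil_map_id)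
next
  case (Suc n)
  have "bij (nil_translation P)" by (simp add: nil_translation_eq_nil_map bij_nil_map)
  then have "nil_rotation_about P \<omega> \<circ> nil_rotation_about P \<phi>
      = nil_translation P \<circ> (nil_rotation \<omega> \<circ> nil_rotation \<phi>) \<circ> inv_into UNIV (nil_translation P)" for \<phi>
    by (simp add: nil_rotation_about_def fun_eq_iff bij_is_inj)
  then show ?case
    unfolding funpow.simps Suc
    by (simp add: nil_rotation_about_def nil_rotation_eq_nil_map nil_map_comp cis_mult distrib_right)
qed

section \<open>Normal forms in the presented group\<close>

lemma (in group) conj_int_pow:
  assumes "g \<in> carrier G" "x \<in> carrier G"
  shows "g \<otimes> x [^] (n::int) \<otimes> inv g = (g \<otimes> x \<otimes> inv g) [^] n"
proof -
  have "(\<lambda>x. g \<otimes> x \<otimes> inv g) \<in> hom G G"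
    using assms by (auto simp: hom_def m_assoc) (simp add: m_assoc[symmetric])
  from hom_int_pow[OF this assms(2) is_group is_group] show ?thesis .
qed

lemma (in group) inv_cancel_left [simp]:
  assumes "x \<in> carrier G" "y \<in> carrier G"
  shows "x \<otimes> (inv x \<otimes> y) = y" "inv x \<otimes> (x \<otimes> y) = y"
  using assms by (simp_all add: m_assoc[symmetric])

lemma (in group) int_pow_commute:
  assumes "x \<in> carrier G" "y \<in> carrier G" "x \<otimes> y = y \<otimes> x"
  shows "x [^] (n::int) \<otimes> y = y \<otimes> x [^] n"
proof -
  have "y \<otimes> x \<otimes> inv y = x"
    using assms by (simp add: m_assoc flip: assms(3))
  with conj_int_pow[of y x n] assms have "y \<otimes> x [^] n \<otimes> inv y = x [^] n" by simp
  then have "y \<otimes> x [^] n \<otimes> inv y \<otimes> y = x [^] n \<otimes> y" by simp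
  then show ?thesis using assms by (simp add: m_assoc)
qed

lemma (in group) commute_inv:
  assumes "x \<in> carrier G" "y \<in> carrier G" "x \<otimes> y = y \<otimes> x"
  shows "x \<otimes> inv y = inv y \<otimes> x"
  using int_pow_commute[of y x "-1"] assms by (simp add: int_pow_neg)

lemma (in group) commute_left:
  assumes "x \<otimes> y = y \<otimes> x" "x \<in> carrier G" "y \<in> carrier G" "w \<in> carrier G"
  shows "x \<otimes> (y \<otimes> w) = y \<otimes> (x \<otimes> w)"
  using assms by (simp flip: m_assoc)

text \<open>Two conjugations replace a double induction: conjugation by \<open>y\<close> is a
  homomorphism and gives the power \<open>m\<close> of \<open>x\<close>, then conjugation by the
  inverse of \<open>x [^] m\<close> gives the power \<open>n\<close> of \<open>y\<close>.\<close>

lemma (in group) central_commutator_int_pow: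
  assumes [simp]: "x \<in> carrier G" "y \<in> carrier G" "z \<in> carrier G"
    and zx: "z \<otimes> x = x \<otimes> z" and zy: "z \<otimes> y = y \<otimes> z"
    and yx: "y \<otimes> x = x \<otimes> y \<otimes> z [^] (c::int)"
  shows "y [^] (n::int) \<otimes> x [^] (m::int) = x [^] m \<otimes> y [^] n \<otimes> z [^] (c * m * n)"
proof -
  have zpx: "z [^] k \<otimes> x = x \<otimes> z [^] k" and zpy: "z [^] k \<otimes> y = y \<otimes> z [^] k" for k :: int
    by (simp_all add: int_pow_commute zx zy)
  have "y \<otimes> x \<otimes> inv y = x \<otimes> z [^] c"
    by (simp add: yx m_assoc flip: zpy)
  then have "y \<otimes> x [^] m \<otimes> inv y = (x \<otimes> z [^] c) [^] m"
    by (simp add: conj_int_pow)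
  also have "\<dots> = x [^] m \<otimes> z [^] (c * m)"
    by (simp add: int_pow_mult_distrib zpx int_pow_pow)
  finally have "y \<otimes> x [^] m \<otimes> inv y \<otimes> y = x [^] m \<otimes> z [^] (c * m) \<otimes> y" by simp
  then have "y \<otimes> x [^] m = x [^] m \<otimes> (y \<otimes> z [^] (c * m))"
    by (simp add: m_assoc zpy)
  then have "inv (x [^] m) \<otimes> y \<otimes> inv (inv (x [^] m)) = y \<otimes> z [^] (c * m)"
    by (simp add: m_assoc)
  then have "inv (x [^] m) \<otimes> y [^] n \<otimes> x [^] m = (y \<otimes> z [^] (c * m)) [^] n"
    using conj_int_pow[of "inv (x [^] m)" y n] by simp
  also have "\<dots> = y [^] n \<otimes> z [^] (c * m * n)"
    by (simp add: int_pow_mult_distrib zpy int_pow_pow)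
  finally have "x [^] m \<otimes> (inv (x [^] m) \<otimes> y [^] n \<otimes> x [^] m) = x [^] m \<otimes> (y [^] n \<otimes> z [^] (c * m * n))" by simp
  then show ?thesis by (simp add: m_assoc)
qed

text \<open>Two translations \<open>x\<close>, \<open>y\<close>, a central vertical translation
  \<open>z\<close> and a rotation \<open>r\<close> that takes \<open>x\<close> to \<open>y\<close>.
  The exponent \<open>c\<close> is the area spanned by \<open>x\<close> and \<open>y\<close> in
  units of \<open>z\<close>: 2 for the square lattice, 3 for the triangular one. In
  \<open>ry\<close> membership in the lattice suffices to make it normalized by
  \<open>r\<close>.\<close>

locale heisenberg_cyclic = group +
  fixes x y z r and c :: int
  assumes closed [simp]: "x \<in> carrier G" "y \<in> carrier G" "z \<in> carrier G" "r \<in> carrier G"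
    and zx: "z \<otimes> x = x \<otimes> z" and zy: "z \<otimes> y = y \<otimes> z" and zr: "z \<otimes> r = r \<otimes> z"
    and yx: "y \<otimes> x = x \<otimes> y \<otimes> z [^] c"
    and rx: "r \<otimes> x \<otimes> inv r = y"
    and ry: "\<exists>(i::int) (j::int) (k::int). r \<otimes> y \<otimes> inv r = x [^] i \<otimes> y [^] j \<otimes> z [^] k"
begin

definition lattice :: "'a set" where
  "lattice = {x [^] i \<otimes> y [^] j \<otimes> z [^] k |(i::int) (j::int) (k::int). True}"

lemma lattice_mult:
  assumes "g \<in> lattice" "h \<in> lattice"
  shows "g \<otimes> h \<in> lattice"
proof -
  obtain i j k i' j' k' :: int where
    g: "g = x [^] i \<otimes> y [^] j \<otimes> z [^] k" and h: "h = x [^] i' \<otimes> y [^] j' \<otimes> z [^] k'"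
    using assms by (auto simp: lattice_def)
  have zpx: "z [^] k \<otimes> x [^] i = x [^] i \<otimes> z [^] k" and zpy: "z [^] k \<otimes> y [^] i = y [^] i \<otimes> z [^] k" for k i :: int
    using int_pow_commute[of z "x [^] i" k] int_pow_commute[of x z i] zx
      int_pow_commute[of z "y [^] i" k] int_pow_commute[of y z i] zy by simp_all
  note z_right = zpx zpy commute_left[OF zpx] commute_left[OF zpy]
  have "g \<otimes> h = x [^] i \<otimes> (y [^] j \<otimes> x [^] i') \<otimes> y [^] j' \<otimes> (z [^] k \<otimes> z [^] k')"
    unfolding g h by (simp add: m_assoc z_right)
  also have "\<dots> = x [^] i \<otimes> x [^] i' \<otimes> (y [^] j \<otimes> y [^] j') \<otimes> (z [^] (c * i' * j) \<otimes> z [^] k \<otimes> z [^] k')"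
    unfolding central_commutator_int_pow[OF closed(1-3) zx zy yx, of j i']
    by (simp add: m_assoc z_right)
  also have "\<dots> = x [^] (i + i') \<otimes> y [^] (j + j') \<otimes> z [^] (c * i' * j + k + k')"
    by (simp add: int_pow_mult)
  finally show ?thesis by (auto simp: lattice_def)
qed

lemma lattice_pow:
  "x [^] (i::int) \<in> lattice" "y [^] (i::int) \<in> lattice" "z [^] (i::int) \<in> lattice"
proof -
  have "x [^] i \<otimes> y [^] (0::int) \<otimes> z [^] (0::int) \<in> lattice"
    "x [^] (0::int) \<otimes> y [^] i \<otimes> z [^] (0::int) \<in> lattice"
    "x [^] (0::int) \<otimes> y [^] (0::int) \<otimes> z [^] i \<in> lattice"
    unfolding lattice_def by blast+
  then show "x [^] i \<in> lattice" "y [^] i \<in> lattice" "z [^] i \<in> lattice"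
    by simp_all
qed

lemma subgroup_lattice: "subgroup lattice G"
proof
  show "lattice \<subseteq> carrier G" by (auto simp: lattice_def)
  show "\<one> \<in> lattice" using lattice_pow(1)[of 0] by simp
  fix g assume "g \<in> lattice"
  then obtain i j k :: int where "g = x [^] i \<otimes> y [^] j \<otimes> z [^] k" by (auto simp: lattice_def)
  then have "inv g = z [^] (- k) \<otimes> (y [^] (- j) \<otimes> x [^] (- i))"
    by (simp add: inv_mult_group int_pow_neg)
  then show "inv g \<in> lattice" by (simp add: lattice_mult lattice_pow)
qed (rule lattice_mult)

lemma lattice_closed: "g \<in> lattice \<Longrightarrow> g \<in> carrier G"
  using subgroup.mem_carrier[OF subgroup_lattice] .

lemma lattice_conj: "g \<in> lattice \<Longrightarrow> r \<otimes> g \<otimes> inv r \<in> lattice"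
proof -
  assume "g \<in> lattice"
  then obtain i j k :: int where g: "g = x [^] i \<otimes> y [^] j \<otimes> z [^] k" by (auto simp: lattice_def)
  have z: "r \<otimes> z [^] k \<otimes> inv r = z [^] k"
    by (simp add: conj_int_pow flip: zr) (simp add: m_assoc)
  have "r \<otimes> g \<otimes> inv r = (r \<otimes> x [^] i \<otimes> inv r) \<otimes> (r \<otimes> y [^] j \<otimes> inv r) \<otimes> (r \<otimes> z [^] k \<otimes> inv r)"
    by (simp add: g m_assoc)
  also have "\<dots> = (r \<otimes> x \<otimes> inv r) [^] i \<otimes> (r \<otimes> y \<otimes> inv r) [^] j \<otimes> z [^] k"
    by (simp add: z conj_int_pow)
  also have "\<dots> \<in> lattice"
  proof -
    have "r \<otimes> y \<otimes> inv r \<in> lattice" using ry by (auto simp: lattice_def)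
    then show ?thesis
      using subgroup_int_pow_closed[OF subgroup_lattice] by (simp add: rx lattice_mult lattice_pow)
  qed
  finally show ?thesis .
qed

text \<open>Natural exponents of \<open>r\<close> are enough, because \<open>r\<close> has finite
  order in the applications.\<close>

definition normal_forms :: "'a set" where
  "normal_forms = {x [^] i \<otimes> y [^] j \<otimes> z [^] k \<otimes> r [^] n |(i::int) (j::int) (k::int) (n::nat). True}"

lemma normal_forms_conv: "normal_forms = {g \<otimes> r [^] n |g (n::nat). g \<in> lattice}"
  by (auto simp: normal_forms_def lattice_def)

lemma normal_forms_one: "\<one> \<in> normal_forms"
  unfolding normal_forms_conv using subgroup.one_closed[OF subgroup_lattice]
  by (auto intro!: exI[of _ "\<one>"] exI[of _ "0::nat"])

lemma normal_forms_r: "g \<in> normal_forms \<Longrightarrow> g \<otimes> r \<in> normal_forms"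
proof -
  assume "g \<in> normal_forms"
  then obtain h n where "g = h \<otimes> r [^] (n::nat)" "h \<in> lattice" by (auto simp: normal_forms_conv)
  then have "g \<otimes> r = h \<otimes> r [^] Suc n" by (simp add: m_assoc lattice_closed)
  with \<open>h \<in> lattice\<close> show ?thesis by (auto simp only: normal_forms_conv)
qed

text \<open>Moving \<open>x\<close> to the left past \<open>r [^] n\<close> conjugates it
  \<open>n\<close> times by \<open>r\<close>, which never leaves the lattice.\<close>

lemma normal_forms_x: "g \<in> normal_forms \<Longrightarrow> g \<otimes> x \<in> normal_forms"
proof -
  assume "g \<in> normal_forms"
  then obtain h n where g: "g = h \<otimes> r [^] (n::nat)" "h \<in> lattice" by (auto simp: normal_forms_conv)
  have "\<exists>h'\<in>lattice. r [^] n \<otimes> x = h' \<otimes> r [^] n"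
  proof (induction n)
    case 0
    then show ?case using lattice_pow(1)[of 1] by (auto intro!: bexI[of _ x])
  next
    case (Suc n)
    then obtain h' where h': "h' \<in> lattice" "r [^] n \<otimes> x = h' \<otimes> r [^] n" by blast
    have "r [^] Suc n \<otimes> x = r \<otimes> (r [^] n \<otimes> x)"
      by (simp only: nat_pow_Suc2[OF closed(4)]) (simp add: m_assoc)
    also have "\<dots> = (r \<otimes> h' \<otimes> inv r) \<otimes> (r \<otimes> r [^] n)"
      using h' by (simp add: m_assoc lattice_closed)
    finally show ?case
      using lattice_conj[OF h'(1)] by (simp only: nat_pow_Suc2[OF closed(4), symmetric]) blast
  qed
  then obtain h' where h': "h' \<in> lattice" "r [^] n \<otimes> x = h' \<otimes> r [^] n" by blast
  then have "g \<otimes> x = (h \<otimes> h') \<otimes> r [^] n"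
    using g by (simp add: m_assoc lattice_closed)
  then show ?thesis
    unfolding normal_forms_conv using lattice_mult[OF g(2) h'(1)] by blast
qed

lemma normal_forms_r_pow: "g \<in> normal_forms \<Longrightarrow> g \<otimes> r [^] (n::nat) \<in> normal_forms"
proof (induction n)
  case 0
  then have "g \<in> carrier G" by (auto simp: normal_forms_def)
  with 0 show ?case by simp
next
  case (Suc n)
  then have "g \<in> carrier G" by (auto simp: normal_forms_def)
  then show ?case using normal_forms_r[OF Suc.IH[OF Suc.prems]] by (simp add: m_assoc)
qed

end

text \<open>Both generators are quarter turns, so \<open>a \<otimes> inv b\<close> acts as a
  translation; conjugation by \<open>b\<close> turns it by a right angle.\<close>

lemma (in group) heisenberg_cyclic_4:
  assumes [simp]: "a \<in> carrier G" "b \<in> carrier G"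
    and a4: "a [^] (4::nat) = \<one>" and b4: "b [^] (4::nat) = \<one>"
    and ab: "a \<otimes> b \<otimes> a \<otimes> b = b \<otimes> a \<otimes> b \<otimes> a"
  defines "z \<equiv> a \<otimes> b \<otimes> a \<otimes> b" and "x \<equiv> a \<otimes> inv b"
  shows "heisenberg_cyclic G x (b \<otimes> x \<otimes> inv b) z b 2"
proof -
  have [simp]: "z \<in> carrier G" "x \<in> carrier G" by (simp_all add: z_def x_def)
  have "z \<otimes> a = a \<otimes> (b \<otimes> a \<otimes> b \<otimes> a)" "b \<otimes> z = b \<otimes> a \<otimes> b \<otimes> a \<otimes> b"
    by (simp_all add: z_def m_assoc)
  then have za: "z \<otimes> a = a \<otimes> z" and zb: "z \<otimes> b = b \<otimes> z"
    by (simp_all only: ab[symmetric] z_def)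
  have zia: "z \<otimes> inv a = inv a \<otimes> z" and zib: "z \<otimes> inv b = inv b \<otimes> z"
    by (simp_all add: commute_inv za zb)
  note z_right = za zb zia zib commute_left[OF za] commute_left[OF zb] commute_left[OF zia] commute_left[OF zib]
  \<comment> \<open>The only way in which the long relator is used below: it shortens a product of
    three generators to one, at the price of a central factor.\<close>
  have bab: "b \<otimes> (a \<otimes> b) = z \<otimes> inv a"
    unfolding z_def ab by (simp add: m_assoc)
  have a4': "a \<otimes> (a \<otimes> (a \<otimes> a)) = \<one>" and b4': "b \<otimes> (b \<otimes> (b \<otimes> b)) = \<one>"
    using a4 b4 by (simp_all add: numeral_eq_Suc m_assoc)
  have a2: "inv a \<otimes> inv a = a \<otimes> a" and b2: "inv b \<otimes> inv b = b \<otimes> b"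
    using a4' b4' by (simp_all add: m_assoc inv_equality flip: inv_mult_group)
  show ?thesis
  proof unfold_locales
    show "z \<otimes> x = x \<otimes> z"
      by (simp add: x_def m_assoc z_right)
    then show "z \<otimes> (b \<otimes> x \<otimes> inv b) = b \<otimes> x \<otimes> inv b \<otimes> z"
      by (simp add: m_assoc z_right commute_left)
    have "b \<otimes> x \<otimes> inv b \<otimes> x = b \<otimes> a \<otimes> (inv b \<otimes> inv b) \<otimes> a \<otimes> inv b"
      by (simp add: x_def m_assoc)
    also have "\<dots> = (b \<otimes> (a \<otimes> b)) \<otimes> (b \<otimes> (a \<otimes> b)) \<otimes> inv b \<otimes> inv b"
      unfolding b2 by (simp add: m_assoc)
    also have "\<dots> = z \<otimes> (inv a \<otimes> z) \<otimes> inv a \<otimes> inv b \<otimes> inv b"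
      unfolding bab by (simp add: m_assoc)
    also have "\<dots> = z \<otimes> z \<otimes> (inv a \<otimes> inv a \<otimes> inv b \<otimes> inv b)"
      unfolding zia[symmetric] by (simp add: m_assoc)
    also have "inv a \<otimes> inv a \<otimes> inv b \<otimes> inv b = x \<otimes> (b \<otimes> x \<otimes> inv b)"
      unfolding a2 by (simp add: x_def m_assoc)
    also have "z \<otimes> z \<otimes> (x \<otimes> (b \<otimes> x \<otimes> inv b)) = x \<otimes> (b \<otimes> x \<otimes> inv b) \<otimes> (z \<otimes> z)"
      by (simp add: x_def m_assoc z_right)
    finally show "b \<otimes> x \<otimes> inv b \<otimes> x = x \<otimes> (b \<otimes> x \<otimes> inv b) \<otimes> z [^] (2::int)"
      using int_pow_mult[of z 1 1] by simp
    \<comment> \<open>The half turn \<open>b \<otimes> b\<close> inverts the translation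
      \<open>x\<close> up to \<open>z\<close>.\<close>
    have "b \<otimes> (b \<otimes> x \<otimes> inv b) \<otimes> inv b = b \<otimes> b \<otimes> a \<otimes> (inv b \<otimes> inv b) \<otimes> inv b"
      by (simp add: x_def m_assoc)
    also have "\<dots> = b \<otimes> (b \<otimes> (a \<otimes> b))"
      unfolding b2 by (simp add: m_assoc)
    also have "\<dots> = z \<otimes> inv x"
      unfolding bab by (simp add: x_def inv_mult_group m_assoc z_right)
    also have "\<dots> = inv x \<otimes> z"
      by (simp add: commute_inv \<open>z \<otimes> x = x \<otimes> z\<close>)
    finally have "b \<otimes> (b \<otimes> x \<otimes> inv b) \<otimes> inv b
        = x [^] (-1::int) \<otimes> (b \<otimes> x \<otimes> inv b) [^] (0::int) \<otimes> z [^] (1::int)"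
      by (simp add: int_pow_neg)
    then show "\<exists>(i::int) (j::int) (k::int). b \<otimes> (b \<otimes> x \<otimes> inv b) \<otimes> inv b = x [^] i \<otimes> (b \<otimes> x \<otimes> inv b) [^] j \<otimes> z [^] k"
      by blast
  qed (auto simp: zb)
qed

text \<open>The angle of \<open>a\<close> is twice that of \<open>b\<close>, so
  \<open>a \<otimes> inv (b \<otimes> b)\<close> acts as a translation. Its conjugates
  \<open>x\<close>, \<open>y\<close>, \<open>w\<close> by successive powers of \<open>b\<close>
  point in directions 60 degrees apart, and the relations say that \<open>w\<close> is
  redundant.\<close>

lemma (in group) heisenberg_cyclic_6:
  assumes [simp]: "a \<in> carrier G" "b \<in> carrier G"
    and a3: "a [^] (3::nat) = \<one>" and b6: "b [^] (6::nat) = \<one>"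
    and ab: "a \<otimes> b \<otimes> a \<otimes> b = b \<otimes> a \<otimes> b \<otimes> a"
  defines "z \<equiv> a \<otimes> b \<otimes> a \<otimes> b" and "x \<equiv> a \<otimes> inv (b \<otimes> b)"
  shows "heisenberg_cyclic G x (b \<otimes> x \<otimes> inv b) z b 3"
proof -
  have [simp]: "z \<in> carrier G" "x \<in> carrier G" by (simp_all add: z_def x_def)
  have "z \<otimes> a = a \<otimes> (b \<otimes> a \<otimes> b \<otimes> a)" "b \<otimes> z = b \<otimes> a \<otimes> b \<otimes> a \<otimes> b"
    by (simp_all add: z_def m_assoc)
  then have za: "z \<otimes> a = a \<otimes> z" and zb: "z \<otimes> b = b \<otimes> z"
    by (simp_all only: ab[symmetric] z_def)
  have zia: "z \<otimes> inv a = inv a \<otimes> z" and zib: "z \<otimes> inv b = inv b \<otimes> z"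
    by (simp_all add: commute_inv za zb)
  note z_right = za zb zia zib commute_left[OF za] commute_left[OF zb] commute_left[OF zia] commute_left[OF zib]
  have aba: "a \<otimes> (b \<otimes> a) = z \<otimes> inv b"
    unfolding z_def by (simp add: m_assoc)
  have a3': "a \<otimes> (a \<otimes> a) = \<one>" and b6': "b \<otimes> (b \<otimes> (b \<otimes> (b \<otimes> (b \<otimes> b)))) = \<one>"
    using a3 b6 by (simp_all add: numeral_eq_Suc m_assoc)
  have b3: "inv b \<otimes> (inv b \<otimes> inv b) = b \<otimes> (b \<otimes> b)"
    using b6' by (simp add: m_assoc inv_equality flip: inv_mult_group)
  define y where "y = b \<otimes> x \<otimes> inv b"
  have [simp]: "y \<in> carrier G" by (simp add: y_def)
  have zx: "z \<otimes> x = x \<otimes> z"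
    by (simp add: x_def inv_mult_group m_assoc z_right)
  then have zy: "z \<otimes> y = y \<otimes> z"
    by (simp add: y_def m_assoc z_right commute_left)
  define w where "w = b \<otimes> y \<otimes> inv b"
  have [simp]: "w \<in> carrier G" by (simp add: w_def)
  have zw: "z \<otimes> w = w \<otimes> z"
    using zy by (simp add: w_def m_assoc z_right commute_left)
  \<comment> \<open>The half turn, here the third power of \<open>b\<close>, inverts
    \<open>x\<close> up to \<open>z\<close>.\<close>
  have bw: "b \<otimes> w \<otimes> inv b \<otimes> x = z"
  proof -
    have "b \<otimes> w \<otimes> inv b \<otimes> x = b \<otimes> b \<otimes> b \<otimes> a \<otimes> (inv b \<otimes> (inv b \<otimes> inv b)) \<otimes> inv b \<otimes> inv b \<otimes> a \<otimes> inv b \<otimes> inv b"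
      by (simp add: w_def y_def x_def m_assoc inv_mult_group)
    also have "\<dots> = b \<otimes> b \<otimes> b \<otimes> (a \<otimes> (b \<otimes> a)) \<otimes> inv b \<otimes> inv b"
      unfolding b3 by (simp add: m_assoc)
    also have "\<dots> = z"
      unfolding aba by (simp add: m_assoc z_right)
    finally show ?thesis .
  qed
  then have bw': "b \<otimes> w \<otimes> inv b = z \<otimes> inv x"
    by (simp add: inv_solve_right)
  have xw: "z \<otimes> x \<otimes> w = y"
  proof -
    \<comment> \<open>\<open>x\<close> and its conjugates by \<open>b\<^sup>2\<close> and \<open>b\<^sup>4\<close> multiply to \<open>a\<^sup>3\<close>.\<close>
    have "a \<otimes> (inv b \<otimes> inv b) \<otimes> (b \<otimes> b \<otimes> a \<otimes> inv b \<otimes> inv b \<otimes> inv b \<otimes> inv b) \<otimes> (b \<otimes> b \<otimes> b \<otimes> b \<otimes> a) = \<one>"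
      by (simp add: m_assoc a3')
    then have "x \<otimes> w \<otimes> (b \<otimes> b \<otimes> b \<otimes> b \<otimes> a) = \<one>"
      by (simp add: w_def y_def x_def m_assoc inv_mult_group)
    moreover have "b \<otimes> b \<otimes> b \<otimes> b \<otimes> a = z \<otimes> inv y"
    proof -
      have "b \<otimes> (b \<otimes> w \<otimes> inv b) \<otimes> inv b
          = b \<otimes> b \<otimes> b \<otimes> b \<otimes> a \<otimes> (inv b \<otimes> (inv b \<otimes> inv b)) \<otimes> inv b \<otimes> inv b \<otimes> inv b"
        by (simp add: w_def y_def x_def m_assoc inv_mult_group)
      also have "\<dots> = b \<otimes> b \<otimes> b \<otimes> b \<otimes> a"
        unfolding b3 by (simp add: m_assoc)
      finally show ?thesis
        unfolding bw' by (simp add: y_def inv_mult_group m_assoc z_right)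
    qed
    ultimately have "x \<otimes> w \<otimes> (z \<otimes> inv y) = \<one>" by simp
    then have "x \<otimes> w \<otimes> (z \<otimes> inv y) \<otimes> y = y" by simp
    then show ?thesis by (simp add: m_assoc zw zx commute_left)
  qed
  have yx: "y \<otimes> x = x \<otimes> y \<otimes> (z \<otimes> z \<otimes> z)"
  proof -
    \<comment> \<open>Conjugating \<open>xw\<close> by \<open>b\<close> turns that relation by 60
      degrees. The three factors \<open>z\<close> of the commutator come from \<open>xw\<close>,
      from its conjugate and from \<open>bw'\<close>.\<close>
    have "w = b \<otimes> (z \<otimes> x \<otimes> w) \<otimes> inv b" by (simp only: xw) (rule w_def)
    also have "\<dots> = z \<otimes> y \<otimes> (b \<otimes> w \<otimes> inv b)"
      by (simp add: y_def m_assoc z_right)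
    also have "\<dots> = z \<otimes> y \<otimes> z \<otimes> inv x"
      unfolding bw' by (simp add: m_assoc)
    finally have wx: "w \<otimes> x = z \<otimes> y \<otimes> z" by (simp add: m_assoc)
    have "y \<otimes> x = z \<otimes> x \<otimes> (w \<otimes> x)"
      by (simp add: m_assoc flip: xw)
    also have "\<dots> = x \<otimes> y \<otimes> (z \<otimes> z \<otimes> z)"
      unfolding wx by (simp add: m_assoc zx zy commute_left[OF zx] commute_left[OF zy])
    finally show ?thesis .
  qed
  show ?thesis
    unfolding y_def[symmetric]
  proof unfold_locales
    show "y \<otimes> x = x \<otimes> y \<otimes> z [^] (3::int)"
      using yx int_pow_mult[of z 1 1] int_pow_mult[of z 2 1] by (simp add: m_assoc)
    have "w = inv x \<otimes> y \<otimes> inv z"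
      by (simp add: m_assoc zx zw flip: xw)
    then have "b \<otimes> y \<otimes> inv b = x [^] (-1::int) \<otimes> y [^] (1::int) \<otimes> z [^] (-1::int)"
      by (simp add: int_pow_neg w_def)
    then show "\<exists>(i::int) (j::int) (k::int). b \<otimes> y \<otimes> inv b = x [^] i \<otimes> y [^] j \<otimes> z [^] k"
      by blast
  qed (simp_all add: zb zx zy flip: y_def)
qed

section \<open>The presented group as a group of word classes\<close>

lemma pq21_equiv_append:
  assumes "pq21_equiv p q u w"
  shows "pq21_equiv p q (x @ u @ y) (x @ w @ y)"
  using assms
proof induction
  case (cancel u s e w)
  then show ?case using pq21_equiv.cancel[of p q "x @ u" s e "w @ y"] by simp
next
  case (relator r u w)
  then show ?case using pq21_equiv.relator[of r p q "x @ u" "w @ y"] by simp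
next
  case (trans u w w')
  show ?case using trans.IH by (rule pq21_equiv.trans)
qed (simp_all add: pq21_equiv.refl pq21_equiv.sym)

lemma pq21_equiv_append_both:
  assumes "pq21_equiv p q u u'" "pq21_equiv p q w w'"
  shows "pq21_equiv p q (u @ w) (u' @ w')"
proof (rule pq21_equiv.trans)
  show "pq21_equiv p q (u @ w) (u' @ w)"
    using pq21_equiv_append[OF assms(1), of "[]" w] by simp
  show "pq21_equiv p q (u' @ w) (u' @ w')"
    using pq21_equiv_append[OF assms(2), of u' "[]"] by simp
qed

lemma pq21_class_eq_iff: "pq21_class p q u = pq21_class p q w \<longleftrightarrow> pq21_equiv p q u w"
  unfolding pq21_class_def set_eq_iff mem_Collect_eq
  by (metis pq21_equiv.refl pq21_equiv.sym pq21_equiv.trans)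

lemma pq21_class_self: "u \<in> pq21_class p q u"
  by (simp add: pq21_class_def pq21_equiv.refl)

text \<open>The product is a union over all pairs of representatives. Every pair contributes the
  same class, and the classes are nonempty, so the union is that class.\<close>

lemma pq21_mult:
  "pq21_class p q u \<otimes>\<^bsub>pq21 p q\<^esub> pq21_class p q w = pq21_class p q (u @ w)"
proof -
  have "pq21_class p q (u' @ w') = pq21_class p q (u @ w)"
    if "u' \<in> pq21_class p q u" "w' \<in> pq21_class p q w" for u' w'
    using that unfolding pq21_class_eq_iff
    by (simp add: pq21_class_def pq21_equiv_append_both pq21_equiv.sym)
  then have "(\<Union>u'\<in>pq21_class p q u. \<Union>w'\<in>pq21_class p q w. pq21_class p q (u' @ w'))
      = (\<Union>u'\<in>pq21_class p q u. \<Union>w'\<in>pq21_class p q w. pq21_class p q (u @ w))"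
    by (intro SUP_cong HOL.refl)
  also have "\<dots> = pq21_class p q (u @ w)"
    using pq21_class_self[of u p q] pq21_class_self[of w p q] by (simp add: SUP_constant) blast
  finally have "(\<Union>u'\<in>pq21_class p q u. \<Union>w'\<in>pq21_class p q w. pq21_class p q (u' @ w'))
      = pq21_class p q (u @ w)" .
  then show ?thesis by (simp add: pq21_def)
qed

lemma pq21_one: "\<one>\<^bsub>pq21 p q\<^esub> = pq21_class p q []"
  by (simp add: pq21_def)

lemma pq21_carrier: "carrier (pq21 p q) = range (pq21_class p q)"
  by (simp add: pq21_def)

lemma pq21_class_carrier [simp]: "pq21_class p q u \<in> carrier (pq21 p q)"
  by (simp add: pq21_carrier)

lemma pq21_equiv_inverse_word: "pq21_equiv p q (rev (map (\<lambda>(s, e). (s, \<not> e)) u) @ u) []"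
proof (induction u)
  case (Cons l u)
  obtain s e where l: "l = (s, e)" by (cases l)
  have "pq21_equiv p q (rev (map (\<lambda>(s, e). (s, \<not> e)) u) @ [(s, \<not> e), (s, \<not> \<not> e)] @ u)
      (rev (map (\<lambda>(s, e). (s, \<not> e)) u) @ u)"
    by (rule pq21_equiv.cancel)
  from pq21_equiv.trans[OF this Cons] show ?case by (simp add: l)
qed (simp add: pq21_equiv.refl)

lemma group_pq21: "group (pq21 p q)"
proof (rule groupI)
  fix g assume "g \<in> carrier (pq21 p q)"
  then obtain u where g: "g = pq21_class p q u" by (auto simp: pq21_carrier)
  show "\<exists>h\<in>carrier (pq21 p q). h \<otimes>\<^bsub>pq21 p q\<^esub> g = \<one>\<^bsub>pq21 p q\<^esub>"
    by (rule bexI[of _ "pq21_class p q (rev (map (\<lambda>(s, e). (s, \<not> e)) u))"])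
      (simp_all add: g pq21_mult pq21_one pq21_class_eq_iff pq21_equiv_inverse_word)
qed (auto simp: pq21_carrier pq21_one pq21_mult)

lemma pq21_generator_relations:
  fixes p q :: nat
  defines "a \<equiv> pq21_class p q [(GenA, True)]" and "b \<equiv> pq21_class p q [(GenB, True)]"
  shows "inv\<^bsub>pq21 p q\<^esub> a = pq21_class p q [(GenA, False)]"
    and "inv\<^bsub>pq21 p q\<^esub> b = pq21_class p q [(GenB, False)]"
    and "a [^]\<^bsub>pq21 p q\<^esub> p = \<one>\<^bsub>pq21 p q\<^esub>"
    and "b [^]\<^bsub>pq21 p q\<^esub> q = \<one>\<^bsub>pq21 p q\<^esub>"
    and "a \<otimes>\<^bsub>pq21 p q\<^esub> b \<otimes>\<^bsub>pq21 p q\<^esub> a \<otimes>\<^bsub>pq21 p q\<^esub> b = b \<otimes>\<^bsub>pq21 p q\<^esub> a \<otimes>\<^bsub>pq21 p q\<^esub> b \<otimes>\<^bsub>pq21 p q\<^esub> a"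
proof -
  interpret G: group "pq21 p q" by (rule group_pq21)
  have cancel: "pq21_class p q [(s, e), (s, \<not> e)] = pq21_class p q []" for s e
    using pq21_equiv.cancel[of p q "[]" s e "[]"] by (simp add: pq21_class_eq_iff)
  show ia: "inv\<^bsub>pq21 p q\<^esub> a = pq21_class p q [(GenA, False)]"
    and ib: "inv\<^bsub>pq21 p q\<^esub> b = pq21_class p q [(GenB, False)]"
    using cancel[of _ False] by (intro G.inv_equality; simp add: a_def b_def pq21_mult pq21_one)+
  have pow: "pq21_class p q [l] [^]\<^bsub>pq21 p q\<^esub> n = pq21_class p q (replicate n l)" for l and n :: nat
    by (induction n) (simp_all add: pq21_one pq21_mult replicate_append_same)
  have rel: "pq21_class p q r = \<one>\<^bsub>pq21 p q\<^esub>" if "r \<in> pq21_relators p q" for r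
    using pq21_equiv.relator[OF that, of "[]" "[]"] by (simp add: pq21_class_eq_iff pq21_one)
  show "a [^]\<^bsub>pq21 p q\<^esub> p = \<one>\<^bsub>pq21 p q\<^esub>" "b [^]\<^bsub>pq21 p q\<^esub> q = \<one>\<^bsub>pq21 p q\<^esub>"
    unfolding a_def b_def pow by (rule rel, simp add: pq21_relators_def)+
  have "pq21_class p q [(GenA, True), (GenB, True), (GenA, True), (GenB, True),
       (GenA, False), (GenB, False), (GenA, False), (GenB, False)] = \<one>\<^bsub>pq21 p q\<^esub>"
    by (rule rel) (simp add: pq21_relators_def)
  moreover have "inv\<^bsub>pq21 p q\<^esub> (b \<otimes>\<^bsub>pq21 p q\<^esub> a \<otimes>\<^bsub>pq21 p q\<^esub> b \<otimes>\<^bsub>pq21 p q\<^esub> a)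
      = pq21_class p q [(GenA, False), (GenB, False), (GenA, False), (GenB, False)]"
  proof -
    have [simp]: "a \<in> carrier (pq21 p q)" "b \<in> carrier (pq21 p q)" by (simp_all add: a_def b_def)
    show ?thesis by (simp add: G.inv_mult_group ia ib pq21_mult)
  qed
  ultimately have "\<one>\<^bsub>pq21 p q\<^esub> = a \<otimes>\<^bsub>pq21 p q\<^esub> b \<otimes>\<^bsub>pq21 p q\<^esub> a \<otimes>\<^bsub>pq21 p q\<^esub> b
      \<otimes>\<^bsub>pq21 p q\<^esub> inv\<^bsub>pq21 p q\<^esub> (b \<otimes>\<^bsub>pq21 p q\<^esub> a \<otimes>\<^bsub>pq21 p q\<^esub> b \<otimes>\<^bsub>pq21 p q\<^esub> a)"
    by (simp add: a_def b_def pq21_mult)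
  then show "a \<otimes>\<^bsub>pq21 p q\<^esub> b \<otimes>\<^bsub>pq21 p q\<^esub> a \<otimes>\<^bsub>pq21 p q\<^esub> b = b \<otimes>\<^bsub>pq21 p q\<^esub> a \<otimes>\<^bsub>pq21 p q\<^esub> b \<otimes>\<^bsub>pq21 p q\<^esub> a"
  proof (subst (asm) G.inv_solve_right)
    have [simp]: "a \<in> carrier (pq21 p q)" "b \<in> carrier (pq21 p q)" by (simp_all add: a_def b_def)
    show "b \<otimes>\<^bsub>pq21 p q\<^esub> a \<otimes>\<^bsub>pq21 p q\<^esub> b \<otimes>\<^bsub>pq21 p q\<^esub> a \<in> carrier (pq21 p q)"
      "a \<otimes>\<^bsub>pq21 p q\<^esub> b \<otimes>\<^bsub>pq21 p q\<^esub> a \<otimes>\<^bsub>pq21 p q\<^esub> b \<in> carrier (pq21 p q)" by simp_all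
  qed (simp_all add: a_def b_def pq21_mult)
qed

section \<open>Evaluation of words in a group that satisfies the relators\<close>

primrec letter_val :: "('a, 'c) monoid_scheme \<Rightarrow> 'a \<Rightarrow> 'a \<Rightarrow> pq_gen \<Rightarrow> 'a" where
  "letter_val G a b GenA = a"
| "letter_val G a b GenB = b"

primrec word_val :: "('a, 'c) monoid_scheme \<Rightarrow> 'a \<Rightarrow> 'a \<Rightarrow> pq_word \<Rightarrow> 'a" where
  "word_val G a b [] = \<one>\<^bsub>G\<^esub>"
| "word_val G a b (l # w) =
     (if snd l then letter_val G a b (fst l) else inv\<^bsub>G\<^esub> letter_val G a b (fst l)) \<otimes>\<^bsub>G\<^esub> word_val G a b w"

context group
begin

lemma letter_val_closed: "a \<in> carrier G \<Longrightarrow> b \<in> carrier G \<Longrightarrow> letter_val G a b s \<in> carrier G"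
  by (cases s) auto

lemma word_val_closed:
  "a \<in> carrier G \<Longrightarrow> b \<in> carrier G \<Longrightarrow> word_val G a b w \<in> carrier G"
  by (induction w) (auto simp: letter_val_closed)

lemma word_val_append:
  assumes "a \<in> carrier G" "b \<in> carrier G"
  shows "word_val G a b (u @ w) = word_val G a b u \<otimes> word_val G a b w"
  using assms by (induction u) (auto simp: letter_val_closed word_val_closed m_assoc)

text \<open>Von Dyck's argument: neither a cancelling pair nor a relator changes the value of a
  word.\<close>

lemma word_val_equiv:
  assumes [simp]: "a \<in> carrier G" "b \<in> carrier G"
    and "a [^] p = \<one>" "b [^] q = \<one>" "a \<otimes> b \<otimes> a \<otimes> b = b \<otimes> a \<otimes> b \<otimes> a"
    and "pq21_equiv p q u w"
  shows "word_val G a b u = word_val G a b w"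
  using assms(6)
proof induction
  case (cancel u s e w)
  have "letter_val G a b s \<in> carrier G" by (simp add: letter_val_closed)
  then show ?case
    by (simp add: word_val_append word_val_closed)
next
  case (relator r u w)
  have pow: "word_val G a b (replicate n (s, True)) = letter_val G a b s [^] n" for n :: nat and s
  proof (induction n)
    case (Suc n)
    have "letter_val G a b s \<in> carrier G" by (simp add: letter_val_closed)
    with Suc show ?case by (simp only: nat_pow_Suc2) simp
  qed simp
  have "a \<otimes> b \<otimes> a \<otimes> b \<otimes> inv (b \<otimes> a \<otimes> b \<otimes> a) = \<one>"
    using assms(5) by simp
  then have "a \<otimes> (b \<otimes> (a \<otimes> (b \<otimes> (inv a \<otimes> (inv b \<otimes> (inv a \<otimes> inv b)))))) = \<one>"
    by (simp add: inv_mult_group m_assoc)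
  with relator have "word_val G a b r = \<one>"
    by (auto simp: pq21_relators_def pow assms(3,4))
  then show ?case
    by (simp add: word_val_append word_val_closed)
qed auto

lemma word_val_generate:
  assumes "a \<in> carrier G" "b \<in> carrier G"
  shows "word_val G a b w \<in> generate G {a, b}"
proof (induction w)
  case (Cons l w)
  have "letter_val G a b s \<in> {a, b}" for s by (cases s) auto
  with Cons show ?case by (auto intro: generate.intros)
qed (auto intro: generate.one)

lemma generate_word_val:
  assumes "a \<in> carrier G" "b \<in> carrier G" "g \<in> generate G {a, b}"
  shows "\<exists>w. g = word_val G a b w"
  using assms(3)
proof induction
  case one
  show ?case by (rule exI[of _ "[]"]) simp
next
  case (incl h)
  have "h = word_val G a b [(GenA, True)] \<or> h = word_val G a b [(GenB, True)]"
    using incl assms by auto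
  then show ?case by blast
next
  case (inv h)
  have "inv h = word_val G a b [(GenA, False)] \<or> inv h = word_val G a b [(GenB, False)]"
    using inv assms by auto
  then show ?case by blast
next
  case (eng h1 h2)
  then show ?case using word_val_append[OF assms(1,2)] by metis
qed

end

text \<open>Evaluation maps onto the generated subgroup, so faithfulness is a question about the
  kernel. The premise \<open>ker\<close> speaks of every homomorphism with the given values on the
  generators, because the one used is constructed only inside the proof.\<close>

lemma pq21_iso_generate:
  assumes "group G" "a \<in> carrier G" "b \<in> carrier G"
    and "a [^]\<^bsub>G\<^esub> p = \<one>\<^bsub>G\<^esub>" "b [^]\<^bsub>G\<^esub> q = \<one>\<^bsub>G\<^esub>"
    and "a \<otimes>\<^bsub>G\<^esub> b \<otimes>\<^bsub>G\<^esub> a \<otimes>\<^bsub>G\<^esub> b = b \<otimes>\<^bsub>G\<^esub> a \<otimes>\<^bsub>G\<^esub> b \<otimes>\<^bsub>G\<^esub> a"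
    and ker: "\<And>\<phi> g. \<lbrakk>\<phi> \<in> hom (pq21 p q) G; \<phi> (pq21_class p q [(GenA, True)]) = a;
       \<phi> (pq21_class p q [(GenB, True)]) = b; g \<in> carrier (pq21 p q); \<phi> g = \<one>\<^bsub>G\<^esub>\<rbrakk>
       \<Longrightarrow> g = \<one>\<^bsub>pq21 p q\<^esub>"
  shows "\<exists>\<phi> \<in> iso (pq21 p q) (G\<lparr>carrier := generate G {a, b}\<rparr>).
     \<phi> (pq21_class p q [(GenA, True)]) = a \<and> \<phi> (pq21_class p q [(GenB, True)]) = b"
proof -
  interpret G: group G by fact
  \<comment> \<open>An arbitrary representative will do, by \<open>word_val_equiv\<close>.\<close>
  define \<phi> where "\<phi> g = word_val G a b (SOME u. u \<in> g)" for g
  have \<phi>: "\<phi> (pq21_class p q u) = word_val G a b u" for u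
  proof -
    have "(SOME w. w \<in> pq21_class p q u) \<in> pq21_class p q u"
      using pq21_class_self by (rule someI)
    then show ?thesis
      using G.word_val_equiv[OF assms(2-6)] by (simp add: \<phi>_def pq21_class_def)
  qed
  have hom: "\<phi> \<in> hom (pq21 p q) G"
    by (rule homI) (auto simp: pq21_carrier \<phi> pq21_mult G.word_val_closed G.word_val_append assms(2,3))
  have gens: "\<phi> (pq21_class p q [(GenA, True)]) = a" "\<phi> (pq21_class p q [(GenB, True)]) = b"
    using assms(2,3) by (simp_all add: \<phi>)
  interpret \<phi>: group_hom "pq21 p q" G \<phi>
    using hom by (simp add: group_hom_def group_hom_axioms_def group_pq21 assms(1))
  have "inj_on \<phi> (carrier (pq21 p q))"
  proof (rule \<phi>.inj_iff_trivial_ker[THEN iffD2])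
    show "kernel (pq21 p q) G \<phi> = {\<one>\<^bsub>pq21 p q\<^esub>}"
      unfolding kernel_def using ker[OF hom gens] by (intro equalityI subsetI) simp_all
  qed
  moreover have "\<phi> ` carrier (pq21 p q) = generate G {a, b}"
    using G.word_val_generate[OF assms(2,3)] G.generate_word_val[OF assms(2,3)]
    unfolding pq21_carrier image_image \<phi> by blast
  ultimately have "\<phi> \<in> iso (pq21 p q) (G\<lparr>carrier := generate G {a, b}\<rparr>)"
    using hom by (auto simp: iso_def bij_betw_def hom_def)
  then show ?thesis using gens by blast
qed

text \<open>Inverse letters are the powers \<open>p - 1\<close> and \<open>q - 1\<close> of the
  generators, so right multiplication by the two generators reaches every element.\<close>

lemma pq21_word_induct [consumes 3, case_names one a b]:
  assumes "g \<in> carrier (pq21 p q)" "p > 0" "q > 0"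
    and "P \<one>\<^bsub>pq21 p q\<^esub>"
    and a: "\<And>g. g \<in> carrier (pq21 p q) \<Longrightarrow> P g \<Longrightarrow> P (g \<otimes>\<^bsub>pq21 p q\<^esub> pq21_class p q [(GenA, True)])"
    and b: "\<And>g. g \<in> carrier (pq21 p q) \<Longrightarrow> P g \<Longrightarrow> P (g \<otimes>\<^bsub>pq21 p q\<^esub> pq21_class p q [(GenB, True)])"
  shows "P g"
proof -
  interpret G: group "pq21 p q" by (rule group_pq21)
  have pow: "P (g \<otimes>\<^bsub>pq21 p q\<^esub> h [^]\<^bsub>pq21 p q\<^esub> n)"
    if "g \<in> carrier (pq21 p q)" "P g" "h \<in> carrier (pq21 p q)"
      "\<And>g. g \<in> carrier (pq21 p q) \<Longrightarrow> P g \<Longrightarrow> P (g \<otimes>\<^bsub>pq21 p q\<^esub> h)" for g h and n :: nat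
    using that by (induction n) (simp_all flip: G.m_assoc)
  have inv_pow: "inv\<^bsub>pq21 p q\<^esub> h = h [^]\<^bsub>pq21 p q\<^esub> (n - 1)"
    if "h \<in> carrier (pq21 p q)" "h [^]\<^bsub>pq21 p q\<^esub> n = \<one>\<^bsub>pq21 p q\<^esub>" "n > 0" for h and n :: nat
    using that by (cases n) (simp_all add: G.inv_equality)
  have letter: "P (g \<otimes>\<^bsub>pq21 p q\<^esub> pq21_class p q [l])" if "g \<in> carrier (pq21 p q)" "P g" for g l
  proof -
    have "pq21_class p q [(GenA, False)] = pq21_class p q [(GenA, True)] [^]\<^bsub>pq21 p q\<^esub> (p - 1)"
      "pq21_class p q [(GenB, False)] = pq21_class p q [(GenB, True)] [^]\<^bsub>pq21 p q\<^esub> (q - 1)"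
      using inv_pow[OF pq21_class_carrier pq21_generator_relations(3) assms(2)]
        inv_pow[OF pq21_class_carrier pq21_generator_relations(4) assms(3)]
      by (simp_all only: pq21_generator_relations(1,2))
    then have "P (g \<otimes>\<^bsub>pq21 p q\<^esub> pq21_class p q [(GenA, False)])"
      "P (g \<otimes>\<^bsub>pq21 p q\<^esub> pq21_class p q [(GenB, False)])"
      using pow[OF that pq21_class_carrier a] pow[OF that pq21_class_carrier b] by simp_all
    then show ?thesis
      using a[OF that] b[OF that] by (cases l; cases "fst l"; cases "snd l") simp_all
  qed
  have "P (pq21_class p q w)" for w
  proof (induction w rule: rev_induct)
    case (snoc l w)
    then show ?case using letter[of "pq21_class p q w" l] by (simp add: pq21_mult)
  qed (use assms(4) in \<open>simp add: pq21_one\<close>)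
  with assms(1) show ?thesis by (auto simp: pq21_carrier)
qed

section \<open>Regular polygons\<close>

text \<open>A vertex and an outer edge normal of a regular \<open>p\<close>-gon enclose an odd
  multiple of pi / p. The bound puts every vertex into every half plane, and its equality case says
  that an edge line contains only its own two vertices.\<close>

lemma cos_odd_multiple_le:
  fixes p :: nat and m :: int
  assumes "p \<ge> 2"
  shows "cos ((2 * m - 1) * pi / p) \<le> cos (pi / p)"
    and "cos ((2 * m - 1) * pi / p) = cos (pi / p) \<Longrightarrow> int p dvd m \<or> int p dvd (m - 1)"
proof -
  define r k where "r = m mod int p" and "k = m div int p"
  have r: "0 \<le> r" "r < p" using assms by (simp_all add: r_def)
  have m: "m = r + int p * k" by (simp add: r_def k_def)
  have "cos ((2 * m - 1) * pi / p) = cos ((2 * r - 1) * pi / p + 2 * pi * real_of_int k)"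
    using assms by (simp add: m field_simps)
  also have "\<dots> = cos ((2 * r - 1) * pi / p)"
    by (simp add: cos_add)
  finally have eq: "cos ((2 * m - 1) * pi / p) = cos ((2 * r - 1) * pi / p)" .
  \<comment> \<open>After reduction modulo \<open>p\<close> the angle keeps a distance of at least 3
    pi / p from both 0 and 2 pi.\<close>
  have less: "cos ((2 * r - 1) * pi / p) < cos (pi / p)" if "r \<ge> 2"
  proof -
    define u where "u = (2 * r - 1) * pi / p"
    have "3 * pi / p \<le> u" "u \<le> (2 * real p - 3) * pi / p"
      using that r assms unfolding u_def by (intro divide_right_mono mult_right_mono; simp; linarith)+
    moreover have "pi / p < 3 * pi / p" using assms by (simp add: field_simps)
    moreover have "(2 * real p - 3) * pi / p = 2 * pi - 3 * pi / p"
      using assms by (simp add: field_simps)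
    ultimately have "pi / p < u" "u < 2 * pi - pi / p" by linarith+
    then show ?thesis
      unfolding u_def[symmetric]
      using cos_monotone_0_pi[of "pi / p" u] cos_monotone_0_pi[of "pi / p" "2 * pi - u"]
      by (cases "u \<le> pi") auto
  qed
  have "r = 0 \<or> r = 1 \<or> r \<ge> 2" using r by linarith
  then show "cos ((2 * m - 1) * pi / p) \<le> cos (pi / p)" using less unfolding eq by auto
  assume "cos ((2 * m - 1) * pi / p) = cos (pi / p)"
  with less have "\<not> r \<ge> 2" unfolding eq by auto
  with r have "r = 0 \<or> r = 1" by linarith
  then show "int p dvd m \<or> int p dvd (m - 1)" by (auto simp: m)
qed

lemma base_figure_conv:
  "base_figure p x k = (x * cos (2 * k * pi / p), x * sin (2 * k * pi / p))"
  by (simp add: base_figure_def bottom_vertex_def rot_a_def funpow_nil_rotation algebra_simps)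

lemma base_figure_mod: "p > 0 \<Longrightarrow> base_figure p x (k mod p) = base_figure p x k"
proof -
  assume "p > 0"
  define r j where "r = k mod p" and "j = k div p"
  have "k = r + p * j" by (simp add: r_def j_def)
  then have "2 * real k * pi / p = 2 * real r * pi / p + 2 * pi * real_of_int (int j)"
    using \<open>p > 0\<close> by (simp add: field_simps)
  then show ?thesis
    unfolding base_figure_conv r_def[symmetric] by (simp only: cos_add sin_add cos_int_2pin sin_int_2pin) simp
qed

definition edge_normal :: "nat \<Rightarrow> nat \<Rightarrow> real \<times> real" where
  "edge_normal p j = (cos ((2 * j + 1) * pi / p), sin ((2 * j + 1) * pi / p))"

text \<open>The polygon as an intersection of half planes; \<open>x * cos (pi / p)\<close> is the
  apothem. This form is easily compared with a Voronoi cell, unlike the topological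
  \<open>polygon_region\<close>.\<close>

definition polygon_body :: "nat \<Rightarrow> real \<Rightarrow> (real \<times> real) set" where
  "polygon_body p x = {w. \<forall>j<p. edge_normal p j \<bullet> w \<le> x * cos (pi / p)}"

locale regular_polygon =
  fixes p :: nat and x :: real
  assumes p: "p \<ge> 3" and x: "x > 0"
begin

lemma cos_pos: "cos (pi / p) > 0"
  using p by (intro cos_gt_zero_pi) (auto simp: field_simps intro: less_le_trans[of _ 0])

lemma sin_pos: "sin (pi / p) > 0"
  using p by (intro sin_gt_zero) (auto simp: field_simps)

lemma normal_vertex:
  "edge_normal p j \<bullet> base_figure p x k = x * cos ((2 * (int k - int j) - 1) * pi / p)"
proof -
  have "edge_normal p j \<bullet> base_figure p x k = x * cos (2 * k * pi / p - (2 * j + 1) * pi / p)"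
    by (simp add: edge_normal_def base_figure_conv cos_diff algebra_simps)
  also have "2 * k * pi / p - (2 * j + 1) * pi / p = (2 * (int k - int j) - 1) * pi / p"
    using p by (simp add: field_simps)
  finally show ?thesis .
qed

lemma normal_vertex_le: "edge_normal p j \<bullet> base_figure p x k \<le> x * cos (pi / p)"
  unfolding normal_vertex using cos_odd_multiple_le(1)[of p "int k - int j"] p x by simp

lemma normal_vertex_eq:
  assumes "edge_normal p j \<bullet> base_figure p x k = x * cos (pi / p)"
  shows "k mod p = j mod p \<or> k mod p = Suc j mod p"
proof -
  have "int p dvd (int k - int j) \<or> int p dvd (int k - int (Suc j))"
    using cos_odd_multiple_le(2)[of p "int k - int j"] p x assms unfolding normal_vertex
    by (simp add: algebra_simps)
  then show ?thesis
    unfolding mod_eq_dvd_iff[symmetric] by (metis of_nat_eq_iff of_nat_mod)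
qed

lemma normal_edge:
  "edge_normal p j \<bullet> base_figure p x j = x * cos (pi / p)"
  "edge_normal p j \<bullet> base_figure p x (Suc j) = x * cos (pi / p)"
  unfolding normal_vertex by simp_all

lemma vertex_eq_iff: "base_figure p x k = base_figure p x l \<longleftrightarrow> k mod p = l mod p"
proof
  assume eq: "base_figure p x k = base_figure p x l"
  have "k mod p = l mod p \<or> k mod p = Suc l mod p"
    using normal_vertex_eq[of l k] normal_edge(1)[of l] eq by simp
  moreover have "l mod p = k mod p \<or> l mod p = Suc k mod p"
    using normal_vertex_eq[of k l] normal_edge(1)[of k] eq by simp
  \<comment> \<open>Each index being the successor of the other would make 2 divisible by
    \<open>p\<close>.\<close>
  moreover have "\<not> (k mod p = Suc l mod p \<and> l mod p = Suc k mod p)"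
  proof
    assume A: "k mod p = Suc l mod p \<and> l mod p = Suc k mod p"
    then have "k mod p = Suc (Suc k) mod p" by (metis mod_Suc_eq)
    then have "p dvd 2" by (metis add_2_eq_Suc' add_diff_cancel_left' le_add1 mod_eq_dvd_iff_nat)
    then show False using p by (auto dest: dvd_imp_le)
  qed
  ultimately show "k mod p = l mod p" by auto
next
  assume "k mod p = l mod p"
  then show "base_figure p x k = base_figure p x l"
    using p base_figure_mod[of p x k] base_figure_mod[of p x l] by simp
qed

lemma polygon_edge_conv: "polygon_edge p (base_figure p x) k = closed_segment (base_figure p x k) (base_figure p x (Suc k))"
  using p by (simp add: polygon_edge_def base_figure_mod)

lemma edge_subset_body: "polygon_edge p (base_figure p x) k \<subseteq> polygon_body p x"
proof -
  have "convex (polygon_body p x)"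
  proof -
    have "polygon_body p x = (\<Inter>j\<in>{..<p}. {w. edge_normal p j \<bullet> w \<le> x * cos (pi / p)})"
      by (auto simp: polygon_body_def)
    then show ?thesis by (simp add: convex_INT convex_halfspace_le)
  qed
  moreover have "base_figure p x k \<in> polygon_body p x" for k
    by (simp add: polygon_body_def normal_vertex_le)
  ultimately show ?thesis
    unfolding polygon_edge_conv by (simp add: closed_segment_subset)
qed

text \<open>The point is located in one of the \<open>p\<close> sectors between consecutive
  vertices. Its coordinates there come from the sine rule, and the half plane of the edge opposite
  to the origin bounds their sum by 1.\<close>

lemma body_triangle:
  assumes "w \<in> polygon_body p x"
  obtains j s t where "0 \<le> s" "0 \<le> t" "s + t \<le> 1"
    "w = s *\<^sub>R base_figure p x j + t *\<^sub>R base_figure p x (Suc j)"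
proof -
  define z where "z = Complex (fst w) (snd w)"
  define r \<phi> where "r = cmod z" and "\<phi> = Arg2pi z"
  have "Re z = r * cos \<phi>" "Im z = r * sin \<phi>"
    by (simp_all add: r_def \<phi>_def cos_Arg2pi sin_Arg2pi)
  then have w: "w = (r * cos \<phi>, r * sin \<phi>)" by (simp add: z_def prod_eq_iff)
  have \<phi>: "0 \<le> \<phi>" "\<phi> < 2 * pi" unfolding \<phi>_def using Arg2pi[of z] by simp_all
  have r: "r \<ge> 0" by (simp add: r_def)
  define h where "h = pi / p"
  have h: "0 < h" using p by (simp add: h_def)
  \<comment> \<open>The index of the sector; \<open>h\<close> is half of the opening angle of a
    sector.\<close>
  define j where "j = nat \<lfloor>\<phi> / (2 * h)\<rfloor>"
  have "real j \<le> \<phi> / (2 * h)" "\<phi> / (2 * h) < real j + 1"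
    using \<phi>(1) h by (simp_all add: j_def)
  then have j: "2 * j * h \<le> \<phi>" "\<phi> < 2 * j * h + 2 * h"
    using h by (simp_all add: field_simps)
  have "2 * j * h < 2 * pi" using j \<phi> by linarith
  then have "j < p" using p by (simp add: h_def field_simps)
  define \<psi> where "\<psi> = \<phi> - 2 * j * h"
  have \<psi>: "0 \<le> \<psi>" "\<psi> \<le> 2 * h" using j by (simp_all add: \<psi>_def)
  have "3 * h \<le> pi" using p by (simp add: h_def field_simps)
  have trig: "sin h > 0" "cos h > 0" using sin_pos cos_pos by (simp_all add: h_def)
  define S where "S = 2 * x * sin h * cos h"
  have S: "S > 0" using trig x by (simp add: S_def)
  have S2: "S = x * sin (2 * h)" by (simp add: S_def sin_double)
  \<comment> \<open>Cramer's rule for the two vertices: \<open>S\<close> is the determinant of the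
    vertices divided by \<open>x\<close>.\<close>
  define s t where "s = r * sin (2 * h - \<psi>) / S" and "t = r * sin \<psi> / S"
  have "s \<ge> 0" "t \<ge> 0"
    using S r \<psi> \<open>3 * h \<le> pi\<close> h by (auto simp: s_def t_def intro!: divide_nonneg_pos mult_nonneg_nonneg sin_ge_zero)
  moreover have "s + t \<le> 1"
  proof -
    have "r * cos (\<psi> - h) = edge_normal p j \<bullet> w"
    proof -
      have "(2 * real j + 1) * pi / p = 2 * j * h + h" using p by (simp add: h_def field_simps)
      then have "edge_normal p j \<bullet> w = r * cos (\<phi> - (2 * j * h + h))"
        by (simp add: w edge_normal_def cos_diff algebra_simps)
      then show ?thesis by (simp add: \<psi>_def algebra_simps)
    qed
    also have "\<dots> \<le> x * cos h"
      using assms \<open>j < p\<close> by (simp add: polygon_body_def h_def)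
    finally have le: "r * cos (\<psi> - h) \<le> x * cos h" .
    \<comment> \<open>Sum-to-product turns \<open>s + t\<close> into the inner product with the edge
      normal, which is at angle \<open>h\<close> within the sector.\<close>
    have "sin (2 * h - \<psi>) + sin \<psi> = 2 * sin h * cos (\<psi> - h)"
      using sin_diff[of h "\<psi> - h"] sin_add[of h "\<psi> - h"] by (simp add: algebra_simps)
    moreover have "(s + t) * S = r * (sin (2 * h - \<psi>) + sin \<psi>)"
      using S by (simp add: s_def t_def field_simps)
    ultimately have "(s + t) * S = 2 * sin h * (r * cos (\<psi> - h))" by simp
    also have "\<dots> \<le> 2 * sin h * (x * cos h)"
      using le trig by (intro mult_left_mono) auto
    also have "\<dots> = 1 * S" by (simp add: S_def)
    finally show ?thesis using S by (simp only: mult_le_cancel_right_pos)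
  qed
  moreover have "w = s *\<^sub>R base_figure p x j + t *\<^sub>R base_figure p x (Suc j)"
  proof -
    have v: "2 * real j * pi / p = \<phi> - \<psi>" "2 * real (Suc j) * pi / p = \<phi> - \<psi> + 2 * h"
      using p by (simp_all add: \<psi>_def h_def field_simps)
    have "sin (2 * h - \<psi>) * cos a + sin \<psi> * cos (a + 2 * h) = sin (2 * h) * cos (a + \<psi>)"
      "sin (2 * h - \<psi>) * sin a + sin \<psi> * sin (a + 2 * h) = sin (2 * h) * sin (a + \<psi>)" for a
      unfolding sin_diff[of "2 * h"] cos_add[of a] sin_add[of a] by (simp_all add: algebra_simps)
    from this[of "\<phi> - \<psi>"]
    have "sin (2 * h - \<psi>) * cos (\<phi> - \<psi>) + sin \<psi> * cos (\<phi> - \<psi> + 2 * h) = sin (2 * h) * cos \<phi>"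
      "sin (2 * h - \<psi>) * sin (\<phi> - \<psi>) + sin \<psi> * sin (\<phi> - \<psi> + 2 * h) = sin (2 * h) * sin \<phi>"
      by simp_all
    then have "x * r / S * (sin (2 * h - \<psi>) * cos (\<phi> - \<psi>) + sin \<psi> * cos (\<phi> - \<psi> + 2 * h)) = r * cos \<phi>"
      "x * r / S * (sin (2 * h - \<psi>) * sin (\<phi> - \<psi>) + sin \<psi> * sin (\<phi> - \<psi> + 2 * h)) = r * sin \<phi>"
      using S x zero_less_mult_pos[of x "sin (2 * h)"] by (simp_all add: S2)
    then have "s * (x * cos (\<phi> - \<psi>)) + t * (x * cos (\<phi> - \<psi> + 2 * h)) = r * cos \<phi>"
      "s * (x * sin (\<phi> - \<psi>)) + t * (x * sin (\<phi> - \<psi> + 2 * h)) = r * sin \<phi>"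
      using S by (simp_all add: s_def t_def field_simps)
    then show ?thesis
      by (simp only: w base_figure_conv v) simp
  qed
  ultimately show ?thesis by (rule that)
qed

lemma norm_vertex: "norm (base_figure p x k) = x"
proof -
  have "x\<^sup>2 * (cos a)\<^sup>2 + x\<^sup>2 * (sin a)\<^sup>2 = x\<^sup>2" for a
    by (simp flip: distrib_left)
  then show ?thesis using x by (simp add: base_figure_conv norm_Pair power_mult_distrib)
qed

lemma body_norm_le:
  assumes "w \<in> polygon_body p x"
  shows "norm w \<le> x"
proof -
  obtain j s t where st: "0 \<le> s" "0 \<le> t" "s + t \<le> 1"
    "w = s *\<^sub>R base_figure p x j + t *\<^sub>R base_figure p x (Suc j)"
    using body_triangle[OF assms] .
  have "norm w \<le> s * x + t * x"
    unfolding st(4) by (rule norm_triangle_le) (use st in \<open>simp add: norm_vertex\<close>)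
  also have "\<dots> \<le> 1 * x" unfolding distrib_right[symmetric] using st x by (intro mult_right_mono) auto
  finally show ?thesis by simp
qed

text \<open>A linear functional attains its maximum at a convex combination only if every corner
  with positive weight attains it. The origin has value 0 < \<open>h\<close>, so its weight
  vanishes, and the remaining corners are vertices of the edge \<open>j\<close>.\<close>

lemma body_face:
  assumes w: "w \<in> polygon_body p x" and eq: "edge_normal p j \<bullet> w = x * cos (pi / p)"
  shows "w \<in> polygon_edge p (base_figure p x) j"
proof -
  obtain i s t where st: "0 \<le> s" "0 \<le> t" "s + t \<le> 1"
    "w = s *\<^sub>R base_figure p x i + t *\<^sub>R base_figure p x (Suc i)"
    using body_triangle[OF w] .
  define h where "h = x * cos (pi / p)"
  have h: "h > 0" using cos_pos x by (simp add: h_def)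
  define a b where "a = edge_normal p j \<bullet> base_figure p x i" and "b = edge_normal p j \<bullet> base_figure p x (Suc i)"
  have ab: "a \<le> h" "b \<le> h" using normal_vertex_le by (simp_all add: a_def b_def h_def)
  have sum: "s * a + t * b = h"
    using eq by (simp add: st(4) a_def b_def h_def inner_add_right)
  \<comment> \<open>A sum of nonnegative slacks; the last one is that of the origin.\<close>
  have "s * (h - a) + t * (h - b) + (1 - s - t) * h = 0" using sum by (simp add: algebra_simps)
  moreover have "s * (h - a) \<ge> 0" "t * (h - b) \<ge> 0" "(1 - s - t) * h \<ge> 0"
    using st ab h by auto
  ultimately have "s * (h - a) = 0" "t * (h - b) = 0" "(1 - s - t) * h = 0" by linarith+
  then have z: "s = 0 \<or> a = h" "t = 0 \<or> b = h" "s + t = 1" using h by auto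
  have i: "i mod p = j mod p \<or> i mod p = Suc j mod p" if "a = h"
    using normal_vertex_eq[of j i] that by (simp add: a_def h_def)
  have i': "Suc i mod p = j mod p \<or> Suc i mod p = Suc j mod p" if "b = h"
    using normal_vertex_eq[of j "Suc i"] that by (simp add: b_def h_def)
  consider "s = 0" "b = h" | "t = 0" "a = h" | "a = h" "b = h" using z by auto
  then show ?thesis
  proof cases
    case 1
    then have "w = base_figure p x (Suc i)" using z st by simp
    moreover have "base_figure p x (Suc i) = base_figure p x j \<or> base_figure p x (Suc i) = base_figure p x (Suc j)"
      using i'[OF 1(2)] by (simp add: vertex_eq_iff)
    ultimately show ?thesis by (auto simp: polygon_edge_conv)
  next
    case 2
    then have "w = base_figure p x i" using z st by simp
    moreover have "base_figure p x i = base_figure p x j \<or> base_figure p x i = base_figure p x (Suc j)"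
      using i[OF 2(2)] by (simp add: vertex_eq_iff)
    ultimately show ?thesis by (auto simp: polygon_edge_conv)
  next
    case 3
    have "i mod p = j mod p"
    proof (rule ccontr)
      assume "i mod p \<noteq> j mod p"
      with i[OF 3(1)] have 1: "i mod p = Suc j mod p" by simp
      then have "Suc i mod p = Suc (Suc j) mod p" by (metis mod_Suc_eq)
      with i'[OF 3(2)] have "p dvd 2 \<or> p dvd 1"
        by (metis Suc_eq_plus1 add_2_eq_Suc' add_diff_cancel_left' le_add1 mod_eq_dvd_iff_nat)
      then show False using p by (auto dest: dvd_imp_le)
    qed
    then have "base_figure p x i = base_figure p x j" "base_figure p x (Suc i) = base_figure p x (Suc j)"
      by (simp_all add: vertex_eq_iff) (metis mod_Suc_eq)
    moreover have "s = 1 - t" using z by simp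
    ultimately show ?thesis
      using st by (auto simp: polygon_edge_conv in_segment)
  qed
qed

text \<open>If an inner point of an edge touched another edge line, both ends of the edge would lie
  on that line, which contains only its own two vertices.\<close>

lemma edge_vertices:
  assumes "w \<in> polygon_edge p (base_figure p x) i" "edge_normal p j \<bullet> w = x * cos (pi / p)" "i mod p \<noteq> j mod p"
  shows "w \<in> {base_figure p x i, base_figure p x (Suc i)}"
proof (rule ccontr)
  assume nv: "\<not> ?thesis"
  obtain u where u: "0 \<le> u" "u \<le> 1" "w = (1 - u) *\<^sub>R base_figure p x i + u *\<^sub>R base_figure p x (Suc i)"
    using assms(1) by (auto simp: polygon_edge_conv in_segment)
  have "u \<noteq> 0" "u \<noteq> 1" using nv u by auto
  with u have u': "0 < u" "u < 1" by auto
  define h where "h = x * cos (pi / p)"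
  define a b where "a = edge_normal p j \<bullet> base_figure p x i" and "b = edge_normal p j \<bullet> base_figure p x (Suc i)"
  have ab: "a \<le> h" "b \<le> h" using normal_vertex_le by (simp_all add: a_def b_def h_def)
  have "(1 - u) * a + u * b = h"
    using assms(2) by (simp add: u(3) a_def b_def h_def inner_add_right)
  then have "(1 - u) * (h - a) + u * (h - b) = 0" by (simp add: algebra_simps)
  moreover have "(1 - u) * (h - a) \<ge> 0" "u * (h - b) \<ge> 0" using u' ab by auto
  ultimately have "(1 - u) * (h - a) = 0" "u * (h - b) = 0" by linarith+
  then have "a = h" "b = h" using u' by auto
  then have i: "i mod p = Suc j mod p" and i': "Suc i mod p = j mod p \<or> Suc i mod p = Suc j mod p"
    using normal_vertex_eq[of j i] normal_vertex_eq[of j "Suc i"] assms(3)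
    by (auto simp: a_def b_def h_def)
  then have "Suc i mod p = Suc (Suc j) mod p" by (metis mod_Suc_eq)
  with i' have "p dvd 2 \<or> p dvd 1"
    by (metis Suc_eq_plus1 add_2_eq_Suc' add_diff_cancel_left' le_add1 mod_eq_dvd_iff_nat)
  then show False using p by (auto dest: dvd_imp_le)
qed

lemma normal_edge_mem: "w \<in> polygon_edge p (base_figure p x) j \<Longrightarrow> edge_normal p j \<bullet> w = x * cos (pi / p)"
  unfolding polygon_edge_conv in_segment
  by (elim exE conjE, simp only: inner_add_right inner_scaleR_right normal_edge) (simp add: algebra_simps)

lemma is_polygon: "is_polygon p (base_figure p x)"
  unfolding is_polygon_def
proof (intro conjI allI impI)
  show "p \<ge> 3" by (rule p)
  show "inj_on (base_figure p x) {..<p}" by (auto simp: inj_on_def vertex_eq_iff)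
  fix i j assume ij: "i < p" "j < p" "i \<noteq> j"
  show "polygon_edge p (base_figure p x) i \<inter> polygon_edge p (base_figure p x) j
          \<subseteq> {base_figure p x i, base_figure p x (Suc i mod p)} \<inter> {base_figure p x j, base_figure p x (Suc j mod p)}"
    using edge_vertices[of _ i j] edge_vertices[of _ j i] normal_edge_mem[of _ i] normal_edge_mem[of _ j] ij p
    by (simp add: base_figure_mod subset_iff)
qed

text \<open>The outline is the frontier of the half-plane intersection, since a point where no
  constraint is tight is interior. For a bounded convex set the inside of the frontier is the
  interior, so no Jordan curve argument is needed.\<close>

lemma polygon_region_eq: "polygon_region p (base_figure p x) = polygon_body p x"
proof -
  define h where "h = x * cos (pi / p)"
  have body: "polygon_body p x = (\<Inter>j\<in>{..<p}. {w. edge_normal p j \<bullet> w \<le> h})"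
    by (auto simp: polygon_body_def h_def)
  have nz: "edge_normal p j \<noteq> 0" for j
    by (simp add: edge_normal_def zero_prod_def) (metis sin_zero_norm_cos_one norm_zero zero_neq_one)
  have convex: "convex (polygon_body p x)"
    unfolding body by (intro convex_INT convex_halfspace_le)
  have closed: "closed (polygon_body p x)"
    unfolding body by (intro closed_INT ballI closed_halfspace_le)
  have bounded: "bounded (polygon_body p x)"
    unfolding bounded_iff using body_norm_le by blast
  have "frontier (polygon_body p x) = polygon_outline p (base_figure p x)"
  proof (intro equalityI subsetI)
    fix w assume "w \<in> frontier (polygon_body p x)"
    then have w: "w \<in> polygon_body p x" "w \<notin> interior (polygon_body p x)"
      using closed by (auto simp: frontier_def)
    have "\<exists>j<p. edge_normal p j \<bullet> w = h"
    proof (rule ccontr)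
      assume "\<not> ?thesis"
      with w have "w \<in> (\<Inter>j\<in>{..<p}. {w. edge_normal p j \<bullet> w < h})"
        by (auto simp: body less_le)
      moreover have "open (\<Inter>j\<in>{..<p}. {w. edge_normal p j \<bullet> w < h})"
        by (intro open_INT ballI open_halfspace_lt) auto
      moreover have "(\<Inter>j\<in>{..<p}. {w. edge_normal p j \<bullet> w < h}) \<subseteq> polygon_body p x"
        by (auto simp: body intro: less_imp_le)
      ultimately have "w \<in> interior (polygon_body p x)" by (meson interiorI)
      with w show False by simp
    qed
    then show "w \<in> polygon_outline p (base_figure p x)"
      using body_face[OF w(1)] by (auto simp: polygon_outline_def h_def)
  next
    fix w assume "w \<in> polygon_outline p (base_figure p x)"
    then obtain j where j: "j < p" "w \<in> polygon_edge p (base_figure p x) j"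
      by (auto simp: polygon_outline_def)
    have "interior (polygon_body p x) \<subseteq> interior {w. edge_normal p j \<bullet> w \<le> h}"
      using j by (intro interior_mono) (auto simp: body)
    then have "w \<notin> interior (polygon_body p x)"
      using normal_edge_mem[OF j(2)] nz by (auto simp: h_def)
    then show "w \<in> frontier (polygon_body p x)"
      using edge_subset_body j(2) closed by (auto simp: frontier_def)
  qed
  then have "polygon_region p (base_figure p x) = frontier (polygon_body p x) \<union> interior (polygon_body p x)"
    using inside_frontier_eq_interior[OF bounded convex] by (simp add: polygon_region_def)
  also have "\<dots> = polygon_body p x"
    using closed interior_subset by (auto simp: frontier_def)
  finally show ?thesis .
qed

end

section \<open>The rotations and their group\<close>

lemma rot_a_eq: "rot_a p = nil_map (cis (2 * pi / p)) 0 0"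
  by (simp add: rot_a_def nil_rotation_eq_nil_map)

lemma bottom_vertex_0: "bottom_vertex p x 0 = (x, 0, 0)"
  by (simp add: bottom_vertex_def)

lemma rot_b_eq:
  "rot_b p q x = nil_map (cis (2 * pi / q)) ((1 - cis (2 * pi / q)) * x) (- x\<^sup>2 * sin (2 * pi / q) / 2)"
proof -
  have "base_pt (x, 0, 0) = of_real x" by (simp add: complex_eq_iff)
  then show ?thesis
    by (simp add: rot_b_def bottom_vertex_0 nil_rotation_about_eq_nil_map mult.commute)
qed

lemma nil_isometry_rot_a: "nil_isometry (rot_a p)"
  by (simp add: rot_a_def nil_isometry_rotation)

lemma nil_isometry_rot_b: "nil_isometry (rot_b p q x)"
  by (simp add: rot_b_def nil_isometry_rotation_about)

lemma nil_isometry_inverse: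
  assumes "nil_isometry f"
  shows "inv\<^bsub>Nil_Isom\<^esub> f = inv_into UNIV f"
proof -
  interpret N: group Nil_Isom by (rule group_Nil_Isom)
  have "bij f" using assms by (simp add: nil_isometry_def)
  then show ?thesis
    using assms by (intro N.inv_equality)
      (simp_all add: Nil_Isom_def nil_isometry_inv bij_is_surj surj_iff[symmetric])
qed

lemma funpow_nil_map:
  assumes "cmod \<rho> = 1"
  shows "\<exists>v' s'. (nil_map \<rho> v s) ^^ n = nil_map (\<rho> ^ n) v' s'"
proof (induction n)
  case 0
  then show ?case by (auto simp flip: nil_map_id)
next
  case (Suc n)
  then obtain v' s' where "(nil_map \<rho> v s) ^^ n = nil_map (\<rho> ^ n) v' s'" by blast
  then show ?case by (simp only: funpow.simps nil_map_comp[OF assms] power_Suc) blast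
qed

text \<open>The translation parts cancel, and the area term vanishes because \<open>v\<close> and
  \<open>- v\<close> are parallel; the height shift doubles.\<close>

lemma nil_half_turn: "nil_map (- 1) v s \<circ> nil_map (- 1) v s = nil_map 1 0 (2 * s)"
  by (simp add: nil_map_comp nil_map_eq_iff)

section \<open>The group generated by the two rotations\<close>

lemma subgroup_tiling_group: "subgroup (tiling_group p q x) Nil_Isom"
  unfolding tiling_group_def
  by (rule group.generate_is_subgroup[OF group_Nil_Isom])
    (simp add: Nil_Isom_def nil_isometry_rot_a nil_isometry_rot_b)

lemma tiling_group_isometry: "g \<in> tiling_group p q x \<Longrightarrow> nil_isometry g"
  using subgroup.mem_carrier[OF subgroup_tiling_group] by (fastforce simp: Nil_Isom_def)

lemma tiling_group_comp: "g \<in> tiling_group p q x \<Longrightarrow> h \<in> tiling_group p q x \<Longrightarrow> h \<circ> g \<in> tiling_group p q x"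
  using subgroup.m_closed[OF subgroup_tiling_group] by (fastforce simp: Nil_Isom_def)

lemma tiling_group_id: "id \<in> tiling_group p q x"
  using subgroup.one_closed[OF subgroup_tiling_group] by (simp add: Nil_Isom_def)

lemma tiling_group_inv: "g \<in> tiling_group p q x \<Longrightarrow> inv_into UNIV g \<in> tiling_group p q x"
  using subgroup.m_inv_closed[OF subgroup_tiling_group] nil_isometry_inverse[OF tiling_group_isometry]
  by metis

lemma tiling_group_funpow: "g \<in> tiling_group p q x \<Longrightarrow> g ^^ n \<in> tiling_group p q x"
  by (induction n) (simp_all add: tiling_group_id tiling_group_comp)

lemma rot_a_in_tiling_group: "rot_a p \<in> tiling_group p q x"
  and rot_b_in_tiling_group: "rot_b p q x \<in> tiling_group p q x"
  by (simp_all add: tiling_group_def generate.incl)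

text \<open>Both generators have finite order, so their inverses are covered by positive powers.\<close>

lemma tiling_group_induct [consumes 3, case_names id a b]:
  assumes "g \<in> tiling_group p q x" "p > 0" "q > 0"
    and "P id"
    and a: "\<And>g. P g \<Longrightarrow> P (rot_a p \<circ> g)"
    and b: "\<And>g. P g \<Longrightarrow> P (rot_b p q x \<circ> g)"
  shows "P g"
proof -
  have pow: "P (f ^^ n \<circ> g)" if "\<And>g. P g \<Longrightarrow> P (f \<circ> g)" "P g" for f g and n :: nat
    using that by (induction n) (simp_all add: comp_assoc)
  have inverse: "inv_into UNIV f = f ^^ (n - 1)" if "f ^^ n = id" "n > 0" for f :: "nil_point \<Rightarrow> nil_point" and n
  proof (rule inv_unique_comp)
    show "f \<circ> f ^^ (n - 1) = id" "f ^^ (n - 1) \<circ> f = id"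
      using that by (cases n; simp add: funpow_swap1 fun_eq_iff)+
  qed
  have "(rot_a p) ^^ p = id" "(rot_b p q x) ^^ q = id"
    unfolding rot_a_def rot_b_def funpow_nil_rotation funpow_nil_rotation_about
    unfolding nil_rotation_eq_nil_map nil_rotation_about_eq_nil_map
    using assms(2,3) by (simp_all add: nil_map_id)
  note inverses = inverse[OF this(1) assms(2)] inverse[OF this(2) assms(3)]
  \<comment> \<open>Generalized over \<open>h\<close>, because \<open>generate\<close> multiplies
    arbitrary elements of the subgroup and not only generators.\<close>
  have "P (g \<circ> h)" if "P h" for h
    using assms(1) that unfolding tiling_group_def
  proof (induction arbitrary: h)
    case one
    then show ?case by (simp add: Nil_Isom_def)
  next
    case (incl f)
    then have "f = rot_a p \<or> f = rot_b p q x" by simp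
    with a b incl.prems show ?case by metis
  next
    case (inv f)
    then have "inv\<^bsub>Nil_Isom\<^esub> f = inv_into UNIV f"
      by (intro nil_isometry_inverse) (auto simp: nil_isometry_rot_a nil_isometry_rot_b)
    then have "inv\<^bsub>Nil_Isom\<^esub> f \<in> {rot_a p ^^ (p - 1), rot_b p q x ^^ (q - 1)}"
      using inv.hyps by (auto simp: inverses)
    moreover have "P (rot_a p ^^ (p - 1) \<circ> h)" "P (rot_b p q x ^^ (q - 1) \<circ> h)"
      by (rule pow[OF a inv.prems], assumption) (rule pow[OF b inv.prems])
    ultimately show ?case by (elim insertE emptyE) (simp_all only:)
  next
    case (eng f1 f2)
    then show ?case by (simp add: Nil_Isom_def comp_assoc)
  qed
  from this[OF assms(4)] show ?thesis by simp
qed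

text \<open>The angle condition says that the two rotation parts multiply to -1. For
  \<open>p\<close>, \<open>q\<close> \<ge> 3 this is the only way for the rotation part of
  \<open>abab\<close> to be trivial.\<close>

locale prism_group = regular_polygon +
  fixes q :: nat
  assumes q: "q \<ge> 3" and pq: "1 / real p + 1 / real q = 1 / 2"
begin

definition \<alpha> :: complex where "\<alpha> = cis (2 * pi / p)"
definition \<beta> :: complex where "\<beta> = cis (2 * pi / q)"
text \<open>Twice the height shift of \<open>b\<close>, as \<open>abab\<close> is the square of a
  half turn with that shift. It is negative, so the tile extends downwards from the cover
  surface.\<close>

definition t :: real where "t = - x\<^sup>2 * sin (2 * pi / q)"

abbreviation "a \<equiv> rot_a p"
abbreviation "b \<equiv> rot_b p q x"
abbreviation "\<Gamma> \<equiv> tiling_group p q x"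

lemma norm_\<alpha> [simp]: "cmod \<alpha> = 1" and norm_\<beta> [simp]: "cmod \<beta> = 1"
  by (simp_all add: \<alpha>_def \<beta>_def)

lemma a_eq: "a = nil_map \<alpha> 0 0"
  by (simp add: rot_a_eq \<alpha>_def)

lemma b_eq: "b = nil_map \<beta> ((1 - \<beta>) * x) (t / 2)"
  by (simp add: rot_b_eq \<beta>_def t_def)

lemma t_neg: "t < 0"
  using x q by (auto simp: t_def field_simps intro!: mult_pos_pos sin_gt_zero)

lemma \<alpha>\<beta>: "\<alpha> * \<beta> = - 1"
proof -
  have "2 * pi / p + 2 * pi / q = 2 * pi * (1 / p + 1 / q)" by (simp add: algebra_simps)
  also have "\<dots> = pi" unfolding pq by simp
  finally show ?thesis by (simp add: \<alpha>_def \<beta>_def cis_mult)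
qed

text \<open>Both products of \<open>a\<close> and \<open>b\<close> are half turns with height shift
  \<open>t / 2\<close>, though about different fibres; by \<open>nil_half_turn\<close> their squares
  agree.\<close>

lemma abab:
  "a \<otimes>\<^bsub>Nil_Isom\<^esub> b \<otimes>\<^bsub>Nil_Isom\<^esub> a \<otimes>\<^bsub>Nil_Isom\<^esub> b = fibre_translation t"
  "b \<otimes>\<^bsub>Nil_Isom\<^esub> a \<otimes>\<^bsub>Nil_Isom\<^esub> b \<otimes>\<^bsub>Nil_Isom\<^esub> a = fibre_translation t"
proof -
  have "b \<circ> a = nil_map (- 1) ((1 - \<beta>) * x) (t / 2)"
    by (simp add: a_eq b_eq nil_map_comp \<alpha>\<beta> mult.commute[of \<beta>])
  then have "b \<circ> a \<circ> (b \<circ> a) = nil_map 1 0 t"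
    by (simp add: nil_half_turn)
  then show "a \<otimes>\<^bsub>Nil_Isom\<^esub> b \<otimes>\<^bsub>Nil_Isom\<^esub> a \<otimes>\<^bsub>Nil_Isom\<^esub> b = fibre_translation t"
    by (simp add: Nil_Isom_def fibre_translation_eq_nil_map comp_assoc)
  have "a \<circ> b = nil_map (- 1) (\<alpha> * ((1 - \<beta>) * x)) (t / 2)"
    by (simp add: a_eq b_eq nil_map_comp \<alpha>\<beta>)
  then have "a \<circ> b \<circ> (a \<circ> b) = nil_map 1 0 t"
    by (simp add: nil_half_turn)
  then show "b \<otimes>\<^bsub>Nil_Isom\<^esub> a \<otimes>\<^bsub>Nil_Isom\<^esub> b \<otimes>\<^bsub>Nil_Isom\<^esub> a = fibre_translation t"
    by (simp add: Nil_Isom_def fibre_translation_eq_nil_map comp_assoc)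
qed

lemma fibre_translation_in_group: "fibre_translation (of_int l * t) \<in> \<Gamma>"
proof -
  have "fibre_translation t \<in> \<Gamma>"
  proof -
    have "b \<circ> (a \<circ> (b \<circ> a)) \<in> \<Gamma>"
      by (intro tiling_group_comp rot_a_in_tiling_group rot_b_in_tiling_group)
    then show ?thesis using abab(1) by (simp add: Nil_Isom_def)
  qed
  moreover have "fibre_translation t ^^ n = fibre_translation (of_nat n * t)" for n
    by (induction n) (simp_all add: fibre_translation_eq_nil_map nil_map_comp nil_map_id nil_map_eq_iff algebra_simps)
  ultimately have nat: "fibre_translation (of_nat n * t) \<in> \<Gamma>" for n
    by (metis tiling_group_funpow)
  show ?thesis
  proof (cases "l \<ge> 0")
    case True
    then show ?thesis using nat[of "nat l"] by simp
  next
    case False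
    have "inv_into UNIV (fibre_translation (of_nat (nat (- l)) * t)) = fibre_translation (of_int l * t)"
      using False by (simp add: fibre_translation_eq_nil_map inv_nil_map)
    then show ?thesis using tiling_group_inv[OF nat[of "nat (- l)"]] by simp
  qed
qed

lemma pq_pos: "p > 0" "q > 0"
  using p q by simp_all

lemma group_nil_map:
  assumes "g \<in> \<Gamma>"
  shows "\<exists>\<rho> v s. g = nil_map \<rho> v s \<and> cmod \<rho> = 1"
  using assms pq_pos
proof (induction rule: tiling_group_induct)
  case id
  then show ?case by (intro exI[of _ 1] exI[of _ 0]) (simp add: nil_map_id)
next
  case (a g)
  then obtain \<rho> v s where "g = nil_map \<rho> v s" "cmod \<rho> = 1" by blast
  then show ?case
    by (simp only: a_eq nil_map_comp[OF norm_\<alpha>]) (metis norm_\<alpha> norm_mult mult_1)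
next
  case (b g)
  then obtain \<rho> v s where "g = nil_map \<rho> v s" "cmod \<rho> = 1" by blast
  then show ?case
    by (simp only: b_eq nil_map_comp[OF norm_\<beta>]) (metis norm_\<beta> norm_mult mult_1)
qed

lemma group_nil_mapE:
  assumes "g \<in> \<Gamma>"
  obtains \<rho> v s where "g = nil_map \<rho> v s" "cmod \<rho> = 1"
  using group_nil_map[OF assms] by blast

lemma group_bij: "g \<in> \<Gamma> \<Longrightarrow> bij g"
  by (metis bij_nil_map group_nil_map)

lemma group_dist:
  assumes "g \<in> \<Gamma>"
  shows "cmod (base_pt (g P) - base_pt (g Q)) = cmod (base_pt P - base_pt Q)"
proof -
  obtain \<rho> v s where g: "g = nil_map \<rho> v s" "cmod \<rho> = 1" using group_nil_mapE[OF assms] .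
  have "base_pt (g P) - base_pt (g Q) = \<rho> * (base_pt P - base_pt Q)"
    by (simp add: g algebra_simps)
  then show ?thesis by (simp add: norm_mult g)
qed

definition origin :: nil_point where "origin = (0, 0, 0)"
definition vertex :: nil_point where "vertex = (x, 0, 0)"

lemma origin_coords [simp]: "base_pt origin = 0" "height origin = 0"
  by (simp_all add: origin_def complex_eq_iff)

lemma vertex_coords [simp]: "base_pt vertex = of_real x" "height vertex = 0"
  by (simp_all add: vertex_def complex_eq_iff)

lemma a_funpow: "a ^^ j = nil_map (\<alpha> ^ j) 0 0"
  unfolding rot_a_def funpow_nil_rotation unfolding nil_rotation_eq_nil_map \<alpha>_def Complex.DeMoivre by simp

lemma b_funpow: "b ^^ j = nil_rotation_about vertex (real j * (2 * pi / q))"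
  by (simp add: rot_b_def funpow_nil_rotation_about bottom_vertex_0 vertex_def)

lemma b_funpow_nil_map: "b ^^ j = nil_map (\<beta> ^ j) ((1 - \<beta> ^ j) * x) (- Im (\<beta> ^ j) * x\<^sup>2 / 2)"
  unfolding b_funpow nil_rotation_about_eq_nil_map \<beta>_def Complex.DeMoivre by simp

lemma b_funpow_fibre: "base_pt P = of_real x \<Longrightarrow> (b ^^ j) P = P"
proof (rule nil_point_eqI)
  assume P: "base_pt P = of_real x"
  define B where "B = \<beta> ^ j"
  have norm: "cnj B * B = 1"
    using complex_norm_square[of B] by (simp add: B_def norm_power mult.commute)
  show "base_pt ((b ^^ j) P) = base_pt P"
    unfolding b_funpow_nil_map by (simp add: P algebra_simps)
  have "cnj ((1 - B) * x) * (B * x) = (B - cnj B * B) * of_real (x\<^sup>2)"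
    by (simp add: power2_eq_square algebra_simps)
  then have "Im (cnj ((1 - B) * x) * (B * x)) = Im B * x\<^sup>2"
    unfolding norm by simp
  then show "height ((b ^^ j) P) = height P"
    unfolding b_funpow_nil_map height_nil_map P B_def by simp
qed

lemma vertex_eq: "(Re (x * \<alpha> ^ k), Im (x * \<alpha> ^ k)) = base_figure p x k"
  unfolding \<alpha>_def Complex.DeMoivre by (simp add: base_figure_conv algebra_simps)

definition body :: "complex set" where
  "body = {c. (Re c, Im c) \<in> polygon_body p x}"

lemma body_cmod_le: "c \<in> body \<Longrightarrow> cmod c \<le> x"
  using body_norm_le[of "(Re c, Im c)"] by (simp add: body_def norm_Pair cmod_def)

text \<open>The centre opposite to the origin across an edge of the polygon.\<close>

lemma opposite_centre:
  "base_pt ((a ^^ Suc j) (b origin)) = of_real (2 * (x * cos (pi / p))) * cis ((2 * j + 1) * pi / p)"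
proof -
  have *: "pi / q = pi / 2 - pi / p"
  proof -
    have "pi / p + pi / q = pi * (1 / p + 1 / q)" by (simp add: algebra_simps)
    also have "\<dots> = pi / 2" by (simp only: pq)
    finally show ?thesis by argo
  qed
  have s: "sin (pi / q) = cos (pi / p)" "cos (pi / q) = sin (pi / p)"
    unfolding * by (simp_all add: sin_diff cos_diff)
  have "2 * pi / q = 2 * (pi / q)" by simp
  then have \<beta>: "\<beta> = Complex (1 - 2 * (cos (pi / p))\<^sup>2) (2 * sin (pi / p) * cos (pi / p))"
    unfolding \<beta>_def cis.code by (simp only: cos_double_sin sin_double s) simp
  \<comment> \<open>The direction is - pi / p, hence the exponent \<open>Suc j\<close> for the edge
    with normal direction (2 j + 1) pi / p.\<close>
  have "1 - \<beta> = of_real (2 * cos (pi / p)) * cis (- pi / p)"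
    unfolding \<beta> by (simp add: complex_eq_iff power2_eq_square)
  then have "base_pt ((a ^^ Suc j) (b origin))
      = of_real (2 * (x * cos (pi / p))) * (\<alpha> ^ Suc j * cis (- pi / p))"
    unfolding a_funpow by (simp add: b_eq del: power_Suc)
  also have "\<alpha> ^ Suc j * cis (- pi / p) = cis ((2 * real j + 1) * pi / p)"
    unfolding \<alpha>_def Complex.DeMoivre cis_mult by (rule arg_cong[of _ _ cis]) (use p in \<open>simp add: field_simps\<close>)
  finally show ?thesis .
qed

text \<open>Each edge lies on the perpendicular bisector between the origin and the opposite centre,
  so comparing distances to these neighbouring centres yields the half-plane conditions.\<close>

lemma nearest_imp_body:
  assumes "\<And>g. g \<in> \<Gamma> \<Longrightarrow> cmod c \<le> cmod (c - base_pt (g origin))"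
  shows "c \<in> body"
proof -
  have "edge_normal p j \<bullet> (Re c, Im c) \<le> x * cos (pi / p)" for j
  proof -
    define h n where "h = x * cos (pi / p)" and "n = cis ((2 * j + 1) * pi / p)"
    have h: "h > 0" using cos_pos x by (simp add: h_def)
    have "a ^^ Suc j \<circ> b \<in> \<Gamma>"
      by (intro tiling_group_comp tiling_group_funpow rot_a_in_tiling_group rot_b_in_tiling_group)
    from assms[OF this] have "cmod c \<le> cmod (c - of_real (2 * h) * n)"
      using opposite_centre[of j] by (simp add: h_def n_def add.commute)
    then have "(cmod c)\<^sup>2 \<le> (cmod (c - of_real (2 * h) * n))\<^sup>2" by simp
    moreover have "(Re n)\<^sup>2 + (Im n)\<^sup>2 = 1" by (simp add: n_def)
    moreover have "(cmod (c - of_real (2 * h) * n))\<^sup>2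
        = (cmod c)\<^sup>2 - 4 * h * (Re n * Re c + Im n * Im c) + 4 * h\<^sup>2 * ((Re n)\<^sup>2 + (Im n)\<^sup>2)"
      unfolding cmod_power2 by (simp add: power2_eq_square algebra_simps)
    ultimately have "h * (Re n * Re c + Im n * Im c) \<le> h * h"
      by (simp add: power2_eq_square)
    then have "Re n * Re c + Im n * Im c \<le> h" using h by simp
    then show ?thesis by (simp add: edge_normal_def n_def h_def add.commute)
  qed
  then show ?thesis by (simp add: body_def polygon_body_def)
qed

end

section \<open>The tiling\<close>

text \<open>The assumptions hold for a group of motions of the plane preserving a lattice whose minimal vectors
  have length \<open>x\<close>, provided that the centres and the vertices lie in different classes of the lattice.\<close>

locale prism_tiling = prism_group +
  assumes admissible: "\<And>g. g \<in> \<Gamma> \<Longrightarrow> \<exists>(\<rho>::complex) (v::complex) (s::real). g = nil_map \<rho> v s \<and> cmod \<rho> = 1 \<and>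
      cmod (\<rho> * x + v) \<ge> x \<and>
      (cmod (\<rho> * x + v) = x \<longrightarrow> (\<exists>j. \<rho> * x + v = x * \<alpha> ^ j)) \<and>
      (v = 0 \<longrightarrow> (\<exists>j. \<rho> = \<alpha> ^ j)) \<and>
      (\<rho> * x + v = x \<longrightarrow> (\<exists>j. \<rho> = \<beta> ^ j)) \<and>
      (v = 0 \<longrightarrow> (\<exists>l::int. s = l * t))"
begin

section \<open>Stabilizers of fibres and the Voronoi cell of the origin\<close>

lemma vertex_far:
  assumes "g \<in> \<Gamma>"
  shows "cmod (base_pt (g vertex)) \<ge> x"
proof -
  obtain \<rho> v s where "g = nil_map \<rho> v s" "cmod (\<rho> * x + v) \<ge> x"
    using admissible[OF assms] by blast
  then show ?thesis by simp
qed

lemma vertex_near: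
  assumes "g \<in> \<Gamma>" "cmod (base_pt (g vertex)) \<le> x"
  obtains j where "base_pt (g vertex) = base_pt ((a ^^ j) vertex)"
proof -
  obtain \<rho> v :: complex and s where g: "g = nil_map \<rho> v s" "cmod (\<rho> * x + v) = x \<longrightarrow> (\<exists>j. \<rho> * x + v = x * \<alpha> ^ j)"
    using admissible[OF assms(1)] by blast
  have "cmod (\<rho> * x + v) = x" using vertex_far[OF assms(1)] assms(2) by (simp add: g)
  then obtain j where "\<rho> * x + v = x * \<alpha> ^ j" using g(2) by blast
  then show ?thesis using that[of j] unfolding a_funpow by (simp add: g mult.commute)
qed

lemma fix_origin:
  assumes "g \<in> \<Gamma>" "base_pt (g origin) = 0"
  obtains j l where "g = fibre_translation (of_int l * t) \<circ> a ^^ j"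
proof -
  obtain \<rho> v s where g: "g = nil_map \<rho> v s" and *: "v = 0 \<longrightarrow> (\<exists>j. \<rho> = \<alpha> ^ j)" "v = 0 \<longrightarrow> (\<exists>l::int. s = l * t)"
    using admissible[OF assms(1)] by blast
  have "v = 0" using assms(2) by (simp add: g)
  with * obtain j l where "\<rho> = \<alpha> ^ j" "s = of_int l * t" by blast
  with \<open>v = 0\<close> have "g = fibre_translation (of_int l * t) \<circ> a ^^ j"
    by (simp add: g a_funpow fibre_translation_eq_nil_map nil_map_comp)
  then show ?thesis by (rule that)
qed

text \<open>A suitable power of \<open>b\<close> has the same rotation part as \<open>g\<close> and
  also fixes this fibre. The quotient is a vertical translation, to which the height condition of
  \<open>admissible\<close> applies.\<close>

lemma fix_vertex:
  assumes "g \<in> \<Gamma>" "base_pt (g vertex) = of_real x"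
  obtains j l where "g = b ^^ j \<circ> fibre_translation (of_int l * t)"
proof -
  obtain \<rho> v s where g: "g = nil_map \<rho> v s" and *: "\<rho> * x + v = x \<longrightarrow> (\<exists>j. \<rho> = \<beta> ^ j)"
    using admissible[OF assms(1)] by blast
  have v: "\<rho> * x + v = x" using assms(2) by (simp add: g)
  with * obtain j where j: "\<rho> = \<beta> ^ j" by blast
  define B where "B = b ^^ j"
  have B: "B \<in> \<Gamma>" unfolding B_def by (intro tiling_group_funpow rot_b_in_tiling_group)
  obtain v' s' where B_eq: "B = nil_map \<rho> v' s'" "v' = (1 - \<rho>) * x"
    unfolding B_def b_funpow_nil_map j by blast
  have "v' = v" using v unfolding B_eq(2) by (simp add: algebra_simps)
  have norm: "cmod \<rho> = 1" by (simp add: j norm_power)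
  then have \<rho>: "cnj \<rho> * \<rho> = 1" using complex_norm_square[of \<rho>] by (simp add: mult.commute)
  obtain s'' where s'': "inv_into UNIV B \<circ> g = nil_map 1 0 s''"
    using norm \<rho> unfolding B_eq(1) \<open>v' = v\<close> g by (simp add: inv_nil_map nil_map_comp)
  have "inv_into UNIV B \<circ> g \<in> \<Gamma>" using B assms(1) by (intro tiling_group_comp tiling_group_inv)
  then obtain l :: int where "s'' = l * t"
    using admissible[of "nil_map 1 0 s''"] unfolding s'' nil_map_eq_iff by blast
  then have "B \<circ> fibre_translation (of_int l * t) = B \<circ> (inv_into UNIV B \<circ> g)"
    unfolding s'' by (simp add: fibre_translation_eq_nil_map)
  also have "\<dots> = g" using group_bij[OF B] by (simp add: fun_eq_iff bij_is_surj surj_f_inv_f)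
  finally show ?thesis using that unfolding B_def by metis
qed

lemma body_nearest:
  assumes "c \<in> body" "g \<in> \<Gamma>"
  shows "cmod c \<le> cmod (c - base_pt (g origin))"
proof -
  define m where "m = base_pt (g origin)"
  have vertex: "2 * Re (x * \<alpha> ^ k * cnj m) \<le> (cmod m)\<^sup>2" for k
  proof -
    define h where "h = inv_into UNIV g \<circ> a ^^ k"
    have h: "h \<in> \<Gamma>" unfolding h_def
      by (intro tiling_group_comp tiling_group_inv tiling_group_funpow assms(2) rot_a_in_tiling_group)
    have "g (h vertex) = (a ^^ k) vertex"
      using group_bij[OF assms(2)] by (simp add: h_def bij_is_surj surj_f_inv_f)
    then have "cmod ((x * \<alpha> ^ k) - m) = cmod (base_pt (h vertex))"
      using group_dist[OF assms(2), of "h vertex" origin]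
      by (simp add: m_def a_funpow mult.commute)
    then have "x \<le> cmod ((x * \<alpha> ^ k) - m)" using vertex_far[OF h] by simp
    then have "x\<^sup>2 \<le> (cmod ((x * \<alpha> ^ k) - m))\<^sup>2" using x by simp
    also have "\<dots> = (cmod (x * \<alpha> ^ k))\<^sup>2 - 2 * Re (x * \<alpha> ^ k * cnj m) + (cmod m)\<^sup>2"
      unfolding cmod_power2 by (simp add: power2_eq_square algebra_simps)
    also have "cmod (x * \<alpha> ^ k) = x" using x by (simp add: norm_mult norm_power)
    finally show ?thesis by simp
  qed
  have "(Re c, Im c) \<in> polygon_body p x" using assms(1) by (simp add: body_def)
  then obtain j s u where st: "0 \<le> s" "0 \<le> u" "s + u \<le> 1"
    "(Re c, Im c) = s *\<^sub>R base_figure p x j + u *\<^sub>R base_figure p x (Suc j)"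
    by (rule body_triangle)
  then have c: "c = of_real s * (x * \<alpha> ^ j) + of_real u * (x * \<alpha> ^ Suc j)"
    unfolding vertex_eq[symmetric] by (simp add: complex_eq_iff)
  have "2 * Re (c * cnj m) = s * (2 * Re (x * \<alpha> ^ j * cnj m)) + u * (2 * Re (x * \<alpha> ^ Suc j * cnj m))"
    unfolding c by (simp add: algebra_simps del: power_Suc)
  also have "\<dots> \<le> s * (cmod m)\<^sup>2 + u * (cmod m)\<^sup>2"
    using st by (intro add_mono mult_left_mono vertex) simp_all
  \<comment> \<open>The missing weight belongs to the origin, where the affine inequality is
    trivial.\<close>
  also have "\<dots> \<le> 1 * (cmod m)\<^sup>2"
    using st by (simp only: distrib_right[symmetric]) (intro mult_right_mono, auto)
  finally have "2 * Re (c * cnj m) \<le> (cmod m)\<^sup>2" by simp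
  moreover have "(cmod (c - m))\<^sup>2 = (cmod c)\<^sup>2 - 2 * Re (c * cnj m) + (cmod m)\<^sup>2"
    unfolding cmod_power2 by (simp add: power2_eq_square algebra_simps)
  ultimately have "(cmod c)\<^sup>2 \<le> (cmod (c - m))\<^sup>2" by simp
  then show ?thesis by (simp add: m_def)
qed

lemma body_iff: "c \<in> body \<longleftrightarrow> (\<forall>g\<in>\<Gamma>. cmod c \<le> cmod (c - base_pt (g origin)))"
  using body_nearest nearest_imp_body by blast

lemma vertex_in_body: "of_real x \<in> body"
  using edge_subset_body[of 0] vertex_eq[of 0] by (auto simp: body_def polygon_edge_conv)

text \<open>After moving one centre to the origin, the other lies within the inscribed circle, hence
  in the cell of the origin; but it is at distance 0 from itself.\<close>

lemma centres_discrete: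
  assumes "g \<in> \<Gamma>" "h \<in> \<Gamma>" "dist (base_pt (g origin)) (base_pt (h origin)) < x * cos (pi / p)"
  shows "base_pt (g origin) = base_pt (h origin)"
proof -
  define k where "k = inv_into UNIV h \<circ> g"
  have k: "k \<in> \<Gamma>" unfolding k_def by (intro tiling_group_comp tiling_group_inv assms)
  define m where "m = base_pt (k origin)"
  have g: "h (k origin) = g origin"
    using group_bij[OF assms(2)] by (simp add: k_def bij_is_surj surj_f_inv_f)
  have m: "cmod m = dist (base_pt (g origin)) (base_pt (h origin))"
    using group_dist[OF assms(2), of "k origin" origin] by (simp add: g m_def dist_norm)
  have "m \<in> body"
  proof -
    have "edge_normal p j \<bullet> (Re m, Im m) \<le> x * cos (pi / p)" for j
    proof -
      have "edge_normal p j \<bullet> (Re m, Im m) \<le> norm (edge_normal p j) * norm (Re m, Im m)"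
        by (rule norm_cauchy_schwarz)
      also have "\<dots> = cmod m" by (simp add: edge_normal_def norm_Pair cmod_def)
      finally show ?thesis using assms(3) m by simp
    qed
    then show ?thesis by (simp add: body_def polygon_body_def)
  qed
  then have "m = 0" using body_nearest[OF _ k, of m] by (simp add: m_def)
  then show ?thesis using m by simp
qed

text \<open>The group is infinite, so a minimal distance needs an argument: uniformly separated
  centres form a closed set, on which the distance is attained.\<close>

lemma nearest_centre:
  obtains g where "g \<in> \<Gamma>" "\<forall>h\<in>\<Gamma>. cmod (c - base_pt (g origin)) \<le> cmod (c - base_pt (h origin))"
proof -
  define S where "S = (\<lambda>g. base_pt (g origin)) ` \<Gamma>"
  have "uniform_discrete S"
    unfolding uniform_discrete_def S_def
    using centres_discrete x cos_pos by (intro exI[of _ "x * cos (pi / p)"]) auto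
  then have "closed S" by (rule uniform_discrete_imp_closed)
  moreover have "S \<noteq> {}" using tiling_group_id by (auto simp: S_def)
  ultimately obtain m where "m \<in> S" "\<And>y. y \<in> S \<Longrightarrow> dist c m \<le> dist c y"
    using distance_attains_inf by blast
  then show ?thesis using that by (auto simp: S_def dist_norm)
qed

section \<open>Covering and disjointness\<close>

definition tile :: "nil_point set" where
  "tile = bounded_prism id p (base_figure p x) t"

text \<open>Measured in units of \<open>t\<close>, the layer becomes the interval from 0 to 1 in
  spite of the negative sign of \<open>t\<close>.\<close>

definition rel_height :: "nil_point \<Rightarrow> real" where
  "rel_height P = height P / t"

lemma layer_iff: "P \<in> layer t \<longleftrightarrow> 0 \<le> rel_height P \<and> rel_height P \<le> 1"
proof
  assume "P \<in> layer t"
  then obtain s Q where s: "s \<in> closed_segment 0 t" and Q: "Q \<in> cover_surface" "P = fibre_translation s Q"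
    by (auto simp: layer_def)
  obtain u where u: "0 \<le> u" "u \<le> 1" "s = u * t" using s by (auto simp: in_segment)
  have "height Q = 0" using Q(1) by (cases Q) (auto simp: cover_surface_def)
  then have "height P = u * t" using Q(2) u by (simp add: fibre_translation_eq_nil_map)
  then show "0 \<le> rel_height P \<and> rel_height P \<le> 1" using u t_neg by (simp add: rel_height_def)
next
  assume A: "0 \<le> rel_height P \<and> rel_height P \<le> 1"
  define Q where "Q = mk_pt (base_pt P) 0"
  have "Q \<in> cover_surface" by (simp add: cover_surface_def Q_def mk_pt_def)
  moreover have "P = fibre_translation (height P) Q"
    by (rule nil_point_eqI) (simp_all add: fibre_translation_eq_nil_map Q_def)
  moreover have "height P \<in> closed_segment 0 t"
    using A t_neg by (auto simp: in_segment rel_height_def intro!: exI[of _ "height P / t"])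
  ultimately show "P \<in> layer t" by (auto simp: layer_def)
qed

lemma tile_iff: "P \<in> tile \<longleftrightarrow> base_pt P \<in> body \<and> 0 \<le> rel_height P \<and> rel_height P \<le> 1"
  by (simp add: tile_def bounded_prism_def infinite_prism_def fibres_over_def polygon_region_eq
      layer_iff body_def base_proj_conv)

lemma group_inv_simps [simp]:
  "g \<in> \<Gamma> \<Longrightarrow> g (inv_into UNIV g P) = P" "g \<in> \<Gamma> \<Longrightarrow> inv_into UNIV g (g P) = P"
  using group_bij by (simp_all add: bij_is_surj surj_f_inv_f bij_is_inj)

lemma group_image_iff:
  assumes "g \<in> \<Gamma>"
  shows "P \<in> g ` S \<longleftrightarrow> inv_into UNIV g P \<in> S"
proof
  assume "inv_into UNIV g P \<in> S"
  then have "g (inv_into UNIV g P) \<in> g ` S" by (rule imageI)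
  then show "P \<in> g ` S" using assms by simp
qed (use assms in auto)

definition nearest :: "(nil_point \<Rightarrow> nil_point) \<Rightarrow> nil_point \<Rightarrow> bool" where
  "nearest g P \<longleftrightarrow> (\<forall>h\<in>\<Gamma>. cmod (base_pt P - base_pt (g origin)) \<le> cmod (base_pt P - base_pt (h origin)))"

lemma body_inv_iff:
  assumes "g \<in> \<Gamma>"
  shows "base_pt (inv_into UNIV g P) \<in> body \<longleftrightarrow> nearest g P"
proof -
  have dist: "cmod (base_pt (inv_into UNIV g P) - base_pt (h origin)) = cmod (base_pt P - base_pt (g (h origin)))" for h
    using group_dist[OF assms, of "inv_into UNIV g P" "h origin"] assms by simp
  \<comment> \<open>Left multiplication by \<open>g\<close> permutes the group, so it permutes the
    centres.\<close>
  have "(\<forall>h\<in>\<Gamma>. Q (g \<circ> h)) \<longleftrightarrow> (\<forall>h\<in>\<Gamma>. Q h)" for Q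
  proof
    assume *: "\<forall>h\<in>\<Gamma>. Q (g \<circ> h)"
    show "\<forall>h\<in>\<Gamma>. Q h"
    proof
      fix h assume "h \<in> \<Gamma>"
      then have "inv_into UNIV g \<circ> h \<in> \<Gamma>" using assms by (intro tiling_group_comp tiling_group_inv)
      with * have "Q (g \<circ> (inv_into UNIV g \<circ> h))" by blast
      moreover have "g \<circ> (inv_into UNIV g \<circ> h) = h" using assms by (simp add: fun_eq_iff)
      ultimately show "Q h" by simp
    qed
  qed (use assms tiling_group_comp in blast)
  from this[of "\<lambda>h. cmod (base_pt P - base_pt (g origin)) \<le> cmod (base_pt P - base_pt (h origin))"]
  show ?thesis
    using group_dist[OF assms, of "inv_into UNIV g P" origin] assms
    unfolding body_iff nearest_def dist by simp
qed

lemma tile_image_iff: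
  "g \<in> \<Gamma> \<Longrightarrow> P \<in> g ` tile \<longleftrightarrow>
     nearest g P \<and> 0 \<le> rel_height (inv_into UNIV g P) \<and> rel_height (inv_into UNIV g P) \<le> 1"
  by (simp add: group_image_iff tile_iff body_inv_iff)

lemma a_pow_body: "base_pt ((a ^^ j) P) \<in> body \<longleftrightarrow> base_pt P \<in> body"
proof -
  have in_group: "a ^^ j \<in> \<Gamma>" by (intro tiling_group_funpow rot_a_in_tiling_group)
  have "base_pt ((a ^^ j) origin) = base_pt (id origin)" by (simp add: a_funpow)
  then have "nearest (a ^^ j) Q \<longleftrightarrow> nearest id Q" for Q by (simp add: nearest_def)
  then show ?thesis
    using body_inv_iff[OF in_group, of "(a ^^ j) P"] body_inv_iff[OF tiling_group_id, of "(a ^^ j) P"]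
      in_group by simp
qed

lemma a_pow_rel_height [simp]: "rel_height ((a ^^ j) P) = rel_height P"
  by (simp add: rel_height_def a_funpow)

lemma a_pow_tile: "(a ^^ j) ` tile = tile"
proof (intro equalityI subsetI)
  fix P assume "P \<in> tile"
  have "a ^^ j \<in> \<Gamma>" by (intro tiling_group_funpow rot_a_in_tiling_group)
  moreover from this have "inv_into UNIV (a ^^ j) P \<in> tile"
    using \<open>P \<in> tile\<close> a_pow_body[of j "inv_into UNIV (a ^^ j) P"] a_pow_rel_height[of j "inv_into UNIV (a ^^ j) P"]
    by (simp add: tile_iff)
  ultimately show "P \<in> (a ^^ j) ` tile" by (simp add: group_image_iff)
qed (auto simp: tile_iff a_pow_body)

lemma rel_height_shift: "rel_height (fibre_translation (l * t) P) = rel_height P + l"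
  using t_neg by (simp add: rel_height_def fibre_translation_eq_nil_map field_simps)

lemma fibre_translation_inv: "inv_into UNIV (fibre_translation s) = fibre_translation (- s)"
  by (simp add: fibre_translation_eq_nil_map inv_nil_map)

lemma inv_comp_group: "g \<in> \<Gamma> \<Longrightarrow> h \<in> \<Gamma> \<Longrightarrow> inv_into UNIV (g \<circ> h) P = inv_into UNIV h (inv_into UNIV g P)"
  using group_bij by (simp add: o_inv_distrib)

text \<open>Group elements commute with vertical shifts; in particular none of them reverses the
  fibres.\<close>

lemma rel_height_vertical:
  assumes "g \<in> \<Gamma>"
  shows "rel_height (inv_into UNIV g (P + (0, 0, e * t))) = rel_height (inv_into UNIV g P) + e"
proof -
  obtain \<rho> v s where g: "inv_into UNIV g = nil_map \<rho> v s" "cmod \<rho> = 1"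
    using group_nil_mapE[OF tiling_group_inv[OF assms]] .
  have "base_pt (P + (0, 0, e * t)) = base_pt P" "height (P + (0, 0, e * t)) = height P + e * t"
    by (cases P; simp)+
  then show ?thesis using t_neg by (simp add: g rel_height_def add_divide_distrib)
qed

text \<open>The quotient fixes the fibre over the origin, so it is a power of \<open>a\<close>,
  which preserves the tile, followed by a power of the fibre translation.\<close>

lemma same_centre:
  assumes "g \<in> \<Gamma>" "h \<in> \<Gamma>" "base_pt (g origin) = base_pt (h origin)"
  obtains l :: int where "h ` tile = g ` fibre_translation (l * t) ` tile"
proof -
  define k where "k = inv_into UNIV g \<circ> h"
  have k: "k \<in> \<Gamma>" unfolding k_def by (intro tiling_group_comp tiling_group_inv assms)
  have gk: "g \<circ> k = h" using assms by (simp add: k_def fun_eq_iff)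
  have "g (k origin) = h origin" unfolding gk[symmetric] by simp
  then have "cmod (base_pt (k origin)) = 0"
    using group_dist[OF assms(1), of "k origin" origin] assms(3) by simp
  then have "base_pt (k origin) = 0" by simp
  from fix_origin[OF k this] obtain j l where "k = fibre_translation (of_int l * t) \<circ> a ^^ j" .
  then have "h ` tile = g ` fibre_translation (of_int l * t) ` (a ^^ j) ` tile"
    unfolding gk[symmetric] by (simp add: image_comp comp_assoc)
  then show ?thesis using that by (simp add: a_pow_tile)
qed

definition tiles :: "nil_point set set" where
  "tiles = {g ` tile |g. g \<in> \<Gamma>}"

lemma tiles_cover: "\<Union>tiles = UNIV"
proof -
  have "P \<in> \<Union>tiles" for P
  proof -
    obtain g where g: "g \<in> \<Gamma>" "nearest g P"
      unfolding nearest_def by (rule nearest_centre)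
    \<comment> \<open>The floor selects the tile of the stack over this cell.\<close>
    define l where "l = \<lfloor>rel_height (inv_into UNIV g P)\<rfloor>"
    define T where "T = fibre_translation (of_int l * t)"
    have T: "T \<in> \<Gamma>" unfolding T_def by (rule fibre_translation_in_group)
    have inv: "inv_into UNIV (g \<circ> T) P = fibre_translation (of_int (- l) * t) (inv_into UNIV g P)"
      by (simp add: inv_comp_group g T) (simp add: T_def fibre_translation_inv)
    have "base_pt ((g \<circ> T) origin) = base_pt (g origin)"
      using group_dist[OF g(1), of "T origin" origin] by (simp add: T_def fibre_translation_eq_nil_map)
    then have "nearest (g \<circ> T) P" using g(2) by (simp add: nearest_def)
    moreover have "0 \<le> rel_height (inv_into UNIV (g \<circ> T) P)" "rel_height (inv_into UNIV (g \<circ> T) P) \<le> 1"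
      unfolding inv rel_height_shift l_def of_int_minus by linarith+
    ultimately have "P \<in> (g \<circ> T) ` tile"
      using tile_image_iff tiling_group_comp[OF T g(1)] by blast
    then show ?thesis using tiling_group_comp[OF T g(1)] by (auto simp: tiles_def)
  qed
  then show ?thesis by blast
qed

lemma open_line:
  fixes U :: "'a :: real_normed_vector set"
  assumes "open U" "y \<in> U"
  obtains e where "e > 0" "y + e *\<^sub>R w \<in> U"
proof -
  have "((\<lambda>e. y + e *\<^sub>R w) \<longlongrightarrow> y + 0 *\<^sub>R w) (at_right 0)"
    by (intro tendsto_intros)
  then have "eventually (\<lambda>e. y + e *\<^sub>R w \<in> U) (at_right 0)"
    using assms by (intro topological_tendstoD) auto
  moreover have "eventually (\<lambda>e. e > (0::real)) (at_right 0)"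
    by (rule eventually_at_right_less)
  ultimately have "eventually (\<lambda>e. e > 0 \<and> y + e *\<^sub>R w \<in> U) (at_right 0)"
    by eventually_elim simp
  then show ?thesis using that eventually_happens'[OF trivial_limit_at_right_real] by blast
qed

text \<open>In a common open set all points are equidistant from both centres, which a small move
  towards one centre contradicts unless the centres agree. Then the tiles belong to one stack, and a
  small vertical move leaves their common part.\<close>

lemma tiles_disjoint:
  assumes "g \<in> \<Gamma>" "h \<in> \<Gamma>" "g ` tile \<noteq> h ` tile"
  shows "interior (g ` tile) \<inter> interior (h ` tile) = {}"
proof (rule ccontr)
  define U where "U = interior (g ` tile) \<inter> interior (h ` tile)"
  assume "interior (g ` tile) \<inter> interior (h ` tile) \<noteq> {}"
  then obtain y where y: "y \<in> U" by (auto simp: U_def)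
  have U: "open U" "P \<in> U \<Longrightarrow> P \<in> g ` tile" "P \<in> U \<Longrightarrow> P \<in> h ` tile" for P
    using interior_subset by (auto simp: U_def)
  define m n where "m = base_pt (g origin)" and "n = base_pt (h origin)"
  have eq: "cmod (base_pt P - m) = cmod (base_pt P - n)" if "P \<in> U" for P
    using U(2,3)[OF that] assms(1,2) tile_image_iff unfolding nearest_def m_def n_def
    by (meson antisym)
  have "m = n"
  proof (rule ccontr)
    assume "m \<noteq> n"
    obtain e where e: "e > 0" "y + e *\<^sub>R (Re (n - m), Im (n - m), 0) \<in> U"
      using open_line[OF U(1) y] .
    define c where "c = base_pt y"
    have c: "base_pt (y + e *\<^sub>R (Re (n - m), Im (n - m), 0)) = c + e *\<^sub>R (n - m)"
      by (cases y) (simp add: c_def complex_eq_iff)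
    have "(cmod (c + e *\<^sub>R (n - m) - m))\<^sup>2 = (cmod (c + e *\<^sub>R (n - m) - n))\<^sup>2"
      using eq[OF e(2)] unfolding c by simp
    moreover have "(cmod (c - m))\<^sup>2 = (cmod (c - n))\<^sup>2"
      using eq[OF y] by (simp add: c_def)
    ultimately have "2 * e * ((Re (n - m))\<^sup>2 + (Im (n - m))\<^sup>2) = 0"
      unfolding cmod_power2 by (simp add: power2_eq_square algebra_simps)
    then have "(cmod (n - m))\<^sup>2 = 0" unfolding cmod_power2 using e by simp
    then show False using \<open>m \<noteq> n\<close> by simp
  qed
  then have "base_pt (g origin) = base_pt (h origin)" by (simp add: m_def n_def)
  from same_centre[OF assms(1,2) this]
  obtain l :: int where l: "h ` tile = g ` fibre_translation (l * t) ` tile" .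
  define r where "r P = rel_height (inv_into UNIV g P)" for P
  have r: "0 \<le> r P \<and> r P \<le> 1 \<and> 0 \<le> r P - l \<and> r P - l \<le> 1" if "P \<in> U" for P
  proof -
    have "P \<in> g ` fibre_translation (l * t) ` tile" using U(3)[OF that] l by simp
    then obtain Q where Q: "Q \<in> tile" "P = g (fibre_translation (l * t) Q)" by auto
    then have "r P = rel_height Q + l" using assms(1) by (simp add: r_def rel_height_shift)
    moreover have "0 \<le> rel_height Q \<and> rel_height Q \<le> 1" using Q(1) by (simp add: tile_iff)
    ultimately show ?thesis
      using U(2)[OF that] assms(1) tile_image_iff by (simp add: r_def)
  qed
  have "l \<noteq> 0"
  proof
    assume "l = 0"
    then have "h ` tile = g ` tile" using l by (simp add: fibre_translation_eq_nil_map nil_map_id)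
    then show False using assms(3) by simp
  qed
  define \<sigma> where "\<sigma> = (if l > 0 then 1 else - 1 :: real)"
  obtain e where e: "e > 0" "y + e *\<^sub>R (0, 0, \<sigma> * t) \<in> U"
    using open_line[OF U(1) y] .
  have "y + e *\<^sub>R (0, 0, \<sigma> * t) = y + (0, 0, (e * \<sigma>) * t)" by (cases y) simp
  then have "r (y + e *\<^sub>R (0, 0, \<sigma> * t)) = r y + e * \<sigma>"
    using rel_height_vertical[OF assms(1), of y "e * \<sigma>"] by (simp add: r_def mult.assoc)
  with r[OF y] r[OF e(2)] e(1) \<open>l \<noteq> 0\<close> show False
    unfolding \<sigma>_def by (cases "l > 0") auto
qed

lemma is_tiling: "is_tiling tiles"
  unfolding is_tiling_def
proof (intro conjI ballI impI tiles_cover)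
  fix T T' assume "T \<in> tiles" "T' \<in> tiles" "T \<noteq> T'"
  then obtain g h where "g \<in> \<Gamma>" "T = g ` tile" "h \<in> \<Gamma>" "T' = h ` tile"
    unfolding tiles_def by blast
  with \<open>T \<noteq> T'\<close> show "interior T \<inter> interior T' = {}"
    using tiles_disjoint by simp
qed

end

text \<open>Conjugation carries the rotation about a fibre to the rotation about the image fibre.
  Only \<open>base_pt W\<close> is prescribed, since the rotation depends on the fibre
  alone.\<close>

lemma nil_rotation_about_conj:
  assumes "cmod \<rho> = 1" "base_pt W = \<rho> * base_pt P + v"
  shows "nil_rotation_about W \<omega> \<circ> nil_map \<rho> v s = nil_map \<rho> v s \<circ> nil_rotation_about P \<omega>"
proof -
  define c d where "c = cis \<omega>" and "d = base_pt P"
  define u where "u = \<rho> * d"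
  have c: "cmod c = 1" "cnj c * c = 1"
    using complex_norm_square[of c] by (simp_all add: c_def mult.commute)
  have u: "cmod u = cmod d" by (simp add: u_def norm_mult assms(1))
  have W: "base_pt W = u + v" using assms(2) by (simp add: u_def d_def)
  have v: "cnj v * v = of_real ((cmod v)\<^sup>2)"
    using complex_norm_square[of v] by (simp add: mult.commute)
  have "cnj ((1 - c) * (u + v)) * (c * v) = (c - cnj c * c) * (cnj u * v + cnj v * v)"
    by (simp add: algebra_simps)
  also have "\<dots> = (c - 1) * (cnj u * v) + (c - 1) * of_real ((cmod v)\<^sup>2)"
    unfolding c(2) v by (simp only: distrib_left)
  finally have 1: "Im (cnj ((1 - c) * (u + v)) * (c * v)) = Im ((c - 1) * (cnj u * v)) + Im c * (cmod v)\<^sup>2"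
    by (simp only: plus_complex.simps) simp
  have 2: "(cmod (u + v))\<^sup>2 = (cmod d)\<^sup>2 + (cmod v)\<^sup>2 + 2 * Re (cnj u * v)"
    unfolding u[symmetric] cmod_power2 by (simp add: power2_eq_square algebra_simps)
  have 3: "Im ((c - 1) * (cnj u * v)) - Im (cnj v * ((1 - c) * u)) = 2 * Im c * Re (cnj u * v)"
    by (simp add: algebra_simps)
  have 4: "Im (cnj v * (\<rho> * ((1 - c) * d))) = Im (cnj v * ((1 - c) * u))"
    by (simp add: u_def mult.assoc mult.left_commute)
  have "s + - Im c * (cmod (u + v))\<^sup>2 / 2 + Im (cnj ((1 - c) * (u + v)) * (c * v)) / 2
      = - Im c * (cmod d)\<^sup>2 / 2 + s + Im (cnj v * (\<rho> * ((1 - c) * d))) / 2"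
    unfolding 1 2 4 using 3 by (simp add: field_simps)
  moreover have "c * v + (1 - c) * (u + v) = \<rho> * ((1 - c) * d) + v"
    by (simp add: u_def algebra_simps)
  ultimately show ?thesis
    unfolding nil_rotation_about_eq_nil_map W c_def[symmetric] d_def[symmetric]
    using assms(1) c(1) by (simp only: nil_map_comp mult.commute[of c])
qed

section \<open>Tiles around a side edge\<close>

context prism_tiling
begin

lemma vertex_fibre_in_tile:
  assumes "g \<in> \<Gamma>" "base_pt P = base_pt (g vertex)"
  shows "P \<in> g ` tile \<longleftrightarrow> 0 \<le> rel_height (inv_into UNIV g P) \<and> rel_height (inv_into UNIV g P) \<le> 1"
proof -
  have "cmod (base_pt (inv_into UNIV g P) - base_pt vertex) = 0"
    using group_dist[OF assms(1), of "inv_into UNIV g P" vertex] assms by simp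
  then have "base_pt (inv_into UNIV g P) = of_real x" by simp
  then show ?thesis
    using assms(1) vertex_in_body by (simp add: group_image_iff tile_iff)
qed

text \<open>The relative height parametrizes the fibre affinely, so the side edge is a segment with
  direction vector (0, 0, \<open>t\<close>), and its relative interior is the open segment.\<close>

lemma rel_interior_side_edge:
  assumes "g \<in> \<Gamma>" "base_proj W = base_proj (g vertex)"
  shows "rel_interior (g ` tile \<inter> fibres_over {base_proj W}) =
    {P. base_pt P = base_pt (g vertex) \<and> 0 < rel_height (inv_into UNIV g P) \<and> rel_height (inv_into UNIV g P) < 1}"
proof -
  define A where "A = g vertex"
  have fibre: "P \<in> fibres_over {base_proj W} \<longleftrightarrow> base_pt P = base_pt A" for P
    unfolding fibres_over_def A_def using assms(2) by (auto simp: base_proj_conv complex_eq_iff)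
  have line: "base_pt P = base_pt A \<longleftrightarrow> (\<exists>e. P = A + (0, 0, e * t))" for P
  proof
    assume eq: "base_pt P = base_pt A"
    have "P = A + (0, 0, ((snd (snd P) - snd (snd A)) / t) * t)"
      using eq t_neg by (cases P; cases A) simp
    then show "\<exists>e. P = A + (0, 0, e * t)" by blast
  qed (cases A; auto)
  have h: "rel_height (inv_into UNIV g (A + (0, 0, e * t))) = e" for e
    using rel_height_vertical[OF assms(1), of A e] assms(1) by (simp add: A_def rel_height_def)
  have seg: "(1 - e) *\<^sub>R A + e *\<^sub>R (A + (0, 0, t)) = A + (0, 0, e * t)" for e
    by (cases A) (simp add: algebra_simps)
  have "A + (0, 0, t) \<noteq> A" using t_neg by (cases A) simp
  have "g ` tile \<inter> fibres_over {base_proj W} = closed_segment A (A + (0, 0, t))"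
  proof (intro equalityI subsetI)
    fix P assume P: "P \<in> g ` tile \<inter> fibres_over {base_proj W}"
    then obtain e where e: "P = A + (0, 0, e * t)" using fibre line by auto
    have "0 \<le> e \<and> e \<le> 1"
      using P vertex_fibre_in_tile[OF assms(1), of P] fibre[of P] h[of e] by (simp add: e A_def)
    then show "P \<in> closed_segment A (A + (0, 0, t))"
      unfolding in_segment seg e by blast
  next
    fix P assume "P \<in> closed_segment A (A + (0, 0, t))"
    then obtain e where e: "0 \<le> e" "e \<le> 1" "P = A + (0, 0, e * t)"
      unfolding in_segment seg by blast
    then have "base_pt P = base_pt A" using line by blast
    then show "P \<in> g ` tile \<inter> fibres_over {base_proj W}"
      using vertex_fibre_in_tile[OF assms(1), of P] fibre[of P] h[of e] e by (simp add: A_def)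
  qed
  then have "rel_interior (g ` tile \<inter> fibres_over {base_proj W}) = open_segment A (A + (0, 0, t))"
    using \<open>A + (0, 0, t) \<noteq> A\<close> by (simp add: rel_interior_closed_segment)
  also have "\<dots> = {P. base_pt P = base_pt A \<and> 0 < rel_height (inv_into UNIV g P) \<and> rel_height (inv_into UNIV g P) < 1}"
  proof (intro equalityI subsetI)
    fix P assume "P \<in> open_segment A (A + (0, 0, t))"
    then obtain e where e: "0 < e" "e < 1" "P = A + (0, 0, e * t)"
      unfolding in_segment seg by blast
    then show "P \<in> {P. base_pt P = base_pt A \<and> 0 < rel_height (inv_into UNIV g P) \<and> rel_height (inv_into UNIV g P) < 1}"
      using line[of P] h[of e] by auto
  next
    fix P assume P: "P \<in> {P. base_pt P = base_pt A \<and> 0 < rel_height (inv_into UNIV g P) \<and> rel_height (inv_into UNIV g P) < 1}"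
    then obtain e where e: "P = A + (0, 0, e * t)" using line by auto
    then have "0 < e" "e < 1" using P h[of e] by simp_all
    then show "P \<in> open_segment A (A + (0, 0, t))"
      unfolding in_segment seg using e \<open>A + (0, 0, t) \<noteq> A\<close> by auto
  qed
  finally show ?thesis by (simp add: A_def)
qed

lemma b_pow_in_group: "b ^^ j \<in> \<Gamma>"
  by (intro tiling_group_funpow rot_b_in_tiling_group)

lemma b_pow_mod: "b ^^ (j mod q) = b ^^ j"
proof -
  have "\<beta> ^ q = 1" using pq_pos(2) by (simp add: \<beta>_def Complex.DeMoivre)
  then have "\<beta> ^ (j mod q) = \<beta> ^ (j mod q + q * (j div q))"
    by (simp only: power_add power_mult) simp
  also have "\<dots> = \<beta> ^ j" by (simp only: mod_mult_div_eq)
  finally have "\<beta> ^ (j mod q) = \<beta> ^ j" .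
  then show ?thesis unfolding b_funpow_nil_map by simp
qed

text \<open>If two of the tiles agreed, the centre of one would be a nearest centre to that of the
  other, at distance 0. But the centres are (1 - \<beta>^j) x with distinct roots of unity.\<close>

lemma b_pow_tile_inj: "inj_on (\<lambda>j. (b ^^ j) ` tile) {..<q}"
proof (rule inj_onI)
  fix i j assume ij: "i \<in> {..<q}" "j \<in> {..<q}" and eq: "(b ^^ i) ` tile = (b ^^ j) ` tile"
  have "origin \<in> tile"
    using x cos_pos by (simp add: tile_iff rel_height_def body_def polygon_body_def flip: zero_prod_def)
  then have "(b ^^ i) origin \<in> (b ^^ j) ` tile" unfolding eq[symmetric] by (rule imageI)
  then have "nearest (b ^^ j) ((b ^^ i) origin)" using tile_image_iff[OF b_pow_in_group] by blast
  then have "cmod (base_pt ((b ^^ i) origin) - base_pt ((b ^^ j) origin))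
      \<le> cmod (base_pt ((b ^^ i) origin) - base_pt ((b ^^ i) origin))"
    using b_pow_in_group unfolding nearest_def by blast
  then have "base_pt ((b ^^ i) origin) = base_pt ((b ^^ j) origin)" by simp
  then have "\<beta> ^ i = \<beta> ^ j" using x unfolding b_funpow_nil_map by simp
  then have "cis (2 * pi * real i / real q) = cis (2 * pi * real j / real q)"
    unfolding \<beta>_def Complex.DeMoivre by (simp add: mult.commute mult.left_commute)
  then show "i = j"
    using bij_betw_imp_inj_on[OF Complex.bij_betw_roots_unity[OF pq_pos(2)]] ij by (auto dest: inj_onD)
qed

text \<open>Pulled back to \<open>tile\<close>, the fibre is over a point of the cell at distance at
  most \<open>x\<close> from the origin, hence over a vertex of the polygon. A rotation by
  \<open>a\<close> makes it the first vertex, and \<open>fix_vertex\<close> leaves a power of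
  \<open>b\<close> and a vertical shift to be excluded.\<close>

lemma tile_at_vertex:
  assumes "k \<in> \<Gamma>" "P \<in> k ` tile" "base_pt P = of_real x" "0 < rel_height P" "rel_height P < 1"
  obtains j where "k ` tile = (b ^^ j) ` tile"
proof -
  define k' where "k' = inv_into UNIV k"
  have k': "k' \<in> \<Gamma>" unfolding k'_def by (rule tiling_group_inv[OF assms(1)])
  have "k' P \<in> tile" using assms(1,2) by (simp add: group_image_iff k'_def)
  then have "base_pt (k' P) \<in> body" by (simp add: tile_iff)
  moreover have eq: "base_pt (k' P) = base_pt (k' vertex)"
    using group_dist[OF k', of P vertex] assms(3) by simp
  ultimately have "cmod (base_pt (k' vertex)) \<le> x" using body_cmod_le by simp
  from vertex_near[OF k' this] obtain j where j: "base_pt (k' vertex) = base_pt ((a ^^ j) vertex)" .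
  \<comment> \<open>The same tile, now with its first vertex on the fibre in question.\<close>
  define h where "h = k \<circ> a ^^ j"
  have h: "h \<in> \<Gamma>" unfolding h_def
    by (intro tiling_group_comp tiling_group_funpow rot_a_in_tiling_group assms(1))
  have "cmod (base_pt (h vertex) - base_pt (k (k' vertex))) = 0"
    unfolding h_def comp_apply using group_dist[OF assms(1), of "(a ^^ j) vertex" "k' vertex"] j by simp
  then have "base_pt (h vertex) = of_real x" using assms(1) by (simp add: k'_def)
  from fix_vertex[OF h this] obtain i l where i: "h = b ^^ i \<circ> fibre_translation (of_int l * t)" .
  have "k ` tile = h ` tile" unfolding h_def image_comp[symmetric] a_pow_tile ..
  then have k: "k ` tile = (b ^^ i) ` fibre_translation (of_int l * t) ` tile"
    unfolding i image_comp .
  then obtain Q where Q: "Q \<in> tile" "P = (b ^^ i) (fibre_translation (of_int l * t) Q)"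
    using assms(2) by auto
  have "(b ^^ i) P = P" by (rule b_funpow_fibre[OF assms(3)])
  then have "P = fibre_translation (of_int l * t) Q"
    using Q(2) group_bij[OF b_pow_in_group[of i]] by (metis bij_is_inj injD)
  then have "rel_height P = rel_height Q + l" by (simp add: rel_height_shift)
  moreover have "0 \<le> rel_height Q" "rel_height Q \<le> 1" using Q(1) by (simp_all add: tile_iff)
  \<comment> \<open>Strictness comes from \<open>P\<close> lying inside the edge; at an end point
    neighbours in the stack would remain possible.\<close>
  ultimately have "real_of_int l < 1" "real_of_int l > - 1" using assms(4,5) by linarith+
  then have "l = 0" by linarith
  then have "k ` tile = (b ^^ i) ` tile"
    unfolding k by (simp add: fibre_translation_eq_nil_map nil_map_id)
  then show ?thesis by (rule that)
qed

text \<open>Conjugation by \<open>g\<close> reduces the claim to the fibre over the first vertex.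
  Fixing only the projection of \<open>W\<close> matters, because the tiling definition names a
  point of the side line that need not be a corner of the tile.\<close>

lemma meet_regularly_vertex:
  assumes g: "g \<in> \<Gamma>" and W: "base_proj W = base_proj (g vertex)"
  shows "meet_regularly q tiles (g ` tile) W"
proof -
  define E where "E = rel_interior (g ` tile \<inter> fibres_over {base_proj W})"
  have E: "P \<in> E \<longleftrightarrow> base_pt P = base_pt (g vertex) \<and> 0 < rel_height (inv_into UNIV g P) \<and> rel_height (inv_into UNIV g P) < 1" for P
    unfolding E_def rel_interior_side_edge[OF g W] by simp
  obtain \<rho> v s where gm: "g = nil_map \<rho> v s" "cmod \<rho> = 1" using group_nil_mapE[OF g] .
  have "base_pt W = base_pt (g vertex)" using W by (simp add: base_proj_conv complex_eq_iff)
  then have "base_pt W = \<rho> * base_pt vertex + v" by (simp add: gm)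
  note conj = nil_rotation_about_conj[OF gm(2) this, of _ s, folded gm(1)]
  have rot: "((nil_rotation_about W (2 * pi / real q)) ^^ j) ` g ` tile = g ` (b ^^ j) ` tile" for j
    unfolding image_comp funpow_nil_rotation_about b_funpow using conj by simp
  have "{T'\<in>tiles. T' \<inter> E \<noteq> {}} = (\<lambda>j. g ` (b ^^ j) ` tile) ` {..<q}"
  proof (intro equalityI subsetI)
    fix T' assume "T' \<in> {T'\<in>tiles. T' \<inter> E \<noteq> {}}"
    then obtain P where "T' \<in> tiles" "P \<in> T'" and "P \<in> E" by blast
    moreover from this obtain h where h: "h \<in> \<Gamma>" "T' = h ` tile" unfolding tiles_def by blast
    ultimately have P: "P \<in> h ` tile" "P \<in> E" by simp_all
    define k where "k = inv_into UNIV g \<circ> h"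
    have k: "k \<in> \<Gamma>" unfolding k_def by (intro tiling_group_comp tiling_group_inv g h)
    have gk: "g \<circ> k = h" using g by (simp add: k_def fun_eq_iff)
    have "inv_into UNIV g P \<in> k ` tile" using P(1) by (auto simp: k_def)
    moreover have "base_pt (inv_into UNIV g P) = of_real x"
      using group_dist[OF g, of "inv_into UNIV g P" vertex] P(2) g by (simp add: E)
    moreover have "0 < rel_height (inv_into UNIV g P)" "rel_height (inv_into UNIV g P) < 1"
      using P(2) by (simp_all add: E)
    ultimately obtain j where "k ` tile = (b ^^ j) ` tile"
      by (rule tile_at_vertex[OF k])
    then have "T' = g ` (b ^^ j) ` tile" unfolding h(2) gk[symmetric] image_comp[symmetric] by simp
    then have "T' = g ` (b ^^ (j mod q)) ` tile" unfolding b_pow_mod .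
    moreover have "j mod q \<in> {..<q}" using pq_pos(2) by simp
    ultimately show "T' \<in> (\<lambda>j. g ` (b ^^ j) ` tile) ` {..<q}" by (rule image_eqI)
  next
    fix T' assume "T' \<in> (\<lambda>j. g ` (b ^^ j) ` tile) ` {..<q}"
    then obtain j where T': "T' = g ` (b ^^ j) ` tile" by blast
    \<comment> \<open>The midpoint of the side edge is fixed by all powers of \<open>b\<close>, so
      it lies in all \<open>q\<close> tiles.\<close>
    define P where "P = mk_pt (of_real x) (t / 2)"
    have P: "base_pt P = of_real x" "rel_height P = 1 / 2"
      using t_neg by (simp_all add: P_def rel_height_def)
    then have "P \<in> tile" using vertex_in_body by (simp add: tile_iff)
    then have "g ((b ^^ j) P) \<in> T'" unfolding T' by blast
    then have "g P \<in> T'" using b_funpow_fibre[OF P(1)] by simp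
    moreover have "g P \<in> E"
      using group_dist[OF g, of P vertex] g P by (simp add: E)
    moreover have "T' \<in> tiles"
    proof -
      have "T' = (g \<circ> b ^^ j) ` tile" by (simp only: T' image_comp)
      then show ?thesis unfolding tiles_def using tiling_group_comp[OF b_pow_in_group g] by blast
    qed
    ultimately show "T' \<in> {T'\<in>tiles. T' \<inter> E \<noteq> {}}" by blast
  qed
  moreover have "card ((\<lambda>j. g ` (b ^^ j) ` tile) ` {..<q}) = q"
  proof -
    have "inj_on (\<lambda>j. g ` (b ^^ j) ` tile) {..<q}"
      using b_pow_tile_inj inj_image_eq_iff[OF bij_is_inj[OF group_bij[OF g]]]
      unfolding inj_on_def by simp
    then show ?thesis by (simp add: card_image)
  qed
  ultimately show ?thesis
    unfolding meet_regularly_def Let_def E_def[symmetric] rot by (auto simp: image_def)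
qed

lemma regular_bounded_prism: "regular_bounded_prism id p (base_figure p x) t"
  unfolding regular_bounded_prism_def
proof (intro conjI exI[of _ origin] allI impI)
  show "nil_isometry id" by (rule nil_isometry_id)
  show "is_polygon p (base_figure p x)" by (rule is_polygon)
  show "t \<noteq> 0" using t_neg by simp
  fix k l assume kl: "k < p" "l < p"
  have rot: "nil_rotation_about origin (2 * pi / real p) = a"
    by (simp add: nil_rotation_about_eq_nil_map a_eq \<alpha>_def)
  define S where "S k = side_surface id p (base_figure p x) t k" for k
  have S: "P \<in> S k \<longleftrightarrow> base_pt P \<in> closed_segment (x * \<alpha> ^ k) (x * \<alpha> ^ Suc k) \<and> 0 \<le> rel_height P \<and> rel_height P \<le> 1" for P k
  proof -
    have seg: "(Re c, Im c) \<in> closed_segment (Re A, Im A) (Re B, Im B) \<longleftrightarrow> c \<in> closed_segment A B" for c A B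
      unfolding in_segment by (simp add: complex_eq_iff)
    then show ?thesis
      unfolding S_def side_surface_def fibres_over_def polygon_edge_conv vertex_eq[symmetric]
      by (simp only: image_id id_apply Int_iff vimage_eq layer_iff base_proj_conv seg)
  qed
  have image: "(a ^^ j) ` S k = S (k + j)" for j
  proof -
    have "\<alpha> \<noteq> 0" by (simp add: \<alpha>_def)
    have *: "(a ^^ j) P \<in> S (k + j) \<longleftrightarrow> P \<in> S k" for P
    proof -
      have "\<alpha> ^ j * c \<in> closed_segment (x * \<alpha> ^ (k + j)) (x * \<alpha> ^ Suc (k + j))
          \<longleftrightarrow> c \<in> closed_segment (x * \<alpha> ^ k) (x * \<alpha> ^ Suc k)" for c
      proof -
        have "\<alpha> ^ j * c = (1 - u) *\<^sub>R (x * \<alpha> ^ (k + j)) + u *\<^sub>R (x * \<alpha> ^ Suc (k + j))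
            \<longleftrightarrow> \<alpha> ^ j * c = \<alpha> ^ j * ((1 - u) *\<^sub>R (x * \<alpha> ^ k) + u *\<^sub>R (x * \<alpha> ^ Suc k))" for u
          by (simp add: power_add algebra_simps)
        then show ?thesis unfolding in_segment using \<open>\<alpha> \<noteq> 0\<close> by simp
      qed
      then show ?thesis unfolding S a_pow_rel_height by (simp add: a_funpow)
    qed
    have in_group: "a ^^ j \<in> \<Gamma>" by (intro tiling_group_funpow rot_a_in_tiling_group)
    have "P \<in> (a ^^ j) ` S k \<longleftrightarrow> P \<in> S (k + j)" for P
      unfolding group_image_iff[OF in_group] using *[of "inv_into UNIV (a ^^ j) P"] in_group by simp
    then show ?thesis by blast
  qed
  have "\<alpha> ^ p = 1" using pq_pos(1) by (simp add: \<alpha>_def Complex.DeMoivre)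
  \<comment> \<open>Adding \<open>p\<close> keeps the subtraction within the natural numbers when
    \<open>l\<close> is smaller than \<open>k\<close>.\<close>
  then have "S (k + (l + p - k)) = S l"
    using kl by (intro equalityI subsetI) (simp_all add: S power_add)
  then have "(a ^^ (l + p - k)) ` S k = S l" using image by simp
  then show "\<exists>j. (nil_rotation_about origin (2 * pi / real p) ^^ j) ` side_surface id p (base_figure p x) t k =
      side_surface id p (base_figure p x) t l"
    unfolding rot S_def by blast
qed

lemma regular_prism_tiling: "regular_prism_tiling p q id (base_figure p x) t tiles"
  unfolding regular_prism_tiling_def
proof (intro conjI ballI regular_bounded_prism is_tiling)
  fix T assume "T \<in> tiles"
  then obtain g where g: "g \<in> \<Gamma>" "T = g ` tile" by (auto simp: tiles_def)
  show "\<exists>g. nil_isometry g \<and> T = g ` bounded_prism id p (base_figure p x) t \<and>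
    (\<forall>k<p. meet_regularly q tiles T (g (id (fst (base_figure p x k), snd (base_figure p x k), 0))))"
  proof (intro exI[of _ g] conjI allI impI)
    show "nil_isometry g" using tiling_group_isometry g(1) .
    show "T = g ` bounded_prism id p (base_figure p x) t" using g(2) by (simp add: tile_def)
    fix k
    \<comment> \<open>The same tile with its \<open>k\<close>-th vertex renamed to be the first
      one.\<close>
    define h where "h = g \<circ> a ^^ k"
    have h: "h \<in> \<Gamma>" unfolding h_def by (intro tiling_group_comp tiling_group_funpow rot_a_in_tiling_group g)
    have "T = h ` tile" unfolding h_def g(2) image_comp[symmetric] a_pow_tile ..
    define A where "A = (fst (base_figure p x k), snd (base_figure p x k), 0::real)"
    have "base_pt A = base_pt ((a ^^ k) vertex)"
      unfolding A_def a_funpow vertex_eq[symmetric] by (simp add: mult.commute complex_eq_iff)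
    then have "base_pt (g A) = base_pt (h vertex)"
      using group_dist[OF g(1), of A "(a ^^ k) vertex"] by (simp add: h_def)
    then have "base_proj (g A) = base_proj (h vertex)" by (simp add: base_proj_conv)
    from meet_regularly_vertex[OF h this]
    show "meet_regularly q tiles T (g (id (fst (base_figure p x k), snd (base_figure p x k), 0)))"
      unfolding \<open>T = h ` tile\<close> A_def by simp
  qed
qed

end

section \<open>Faithfulness of the realization\<close>

lemma Nil_Isom_mult: "f \<otimes>\<^bsub>Nil_Isom\<^esub> g = g \<circ> f"
  by (simp add: Nil_Isom_def)

lemma Nil_Isom_one: "\<one>\<^bsub>Nil_Isom\<^esub> = id"
  by (simp add: Nil_Isom_def)

lemma Nil_Isom_nat_pow: "f [^]\<^bsub>Nil_Isom\<^esub> (n::nat) = f ^^ n"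
proof (induction n)
  case (Suc n)
  interpret N: group Nil_Isom by (rule group_Nil_Isom)
  show ?case by (simp add: Suc) (simp add: Nil_Isom_def)
qed (simp add: Nil_Isom_def)

text \<open>All powers translate along parallel vectors, so the area terms vanish and heights simply
  add up.\<close>

lemma Nil_Isom_int_pow_translation:
  assumes "nil_map 1 v s \<in> carrier Nil_Isom"
  shows "nil_map 1 v s [^]\<^bsub>Nil_Isom\<^esub> (i::int) = nil_map 1 (of_int i * v) (of_int i * s)"
proof -
  interpret N: group Nil_Isom by (rule group_Nil_Isom)
  have nat: "nil_map 1 v s ^^ n = nil_map 1 (of_nat n * v) (of_nat n * s)" for n
  proof (induction n)
    case (Suc n)
    have "cnj v * (of_nat n * v) = of_nat n * of_real ((cmod v)\<^sup>2)"
      using complex_norm_square[of v] by (simp add: mult.commute mult.left_commute)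
    then have "Im (cnj v * (1 * (of_nat n * v))) = 0" by simp
    then have "nil_map 1 v s \<circ> nil_map 1 (of_nat n * v) (of_nat n * s) = nil_map 1 (of_nat (Suc n) * v) (of_nat (Suc n) * s)"
      by (simp only: nil_map_comp norm_one) (simp add: nil_map_eq_iff algebra_simps)
    then show ?case by (simp only: funpow.simps Suc)
  qed (simp add: nil_map_id)
  show ?thesis
  proof (cases i)
    case (nonneg n)
    then show ?thesis by (simp add: int_pow_int Nil_Isom_nat_pow nat)
  next
    case (neg n)
    have "nil_map 1 v s [^]\<^bsub>Nil_Isom\<^esub> (- int (Suc n)) = inv\<^bsub>Nil_Isom\<^esub> (nil_map 1 v s ^^ Suc n)"
      using N.int_pow_neg_int[OF assms, of "Suc n"] by (simp only: Nil_Isom_nat_pow)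
    also have "\<dots> = inv_into UNIV (nil_map 1 v s ^^ Suc n)"
    proof (rule nil_isometry_inverse)
      have "nil_map 1 v s [^]\<^bsub>Nil_Isom\<^esub> Suc n \<in> carrier Nil_Isom" using assms by (rule N.nat_pow_closed)
      then show "nil_isometry (nil_map 1 v s ^^ Suc n)"
        unfolding Nil_Isom_nat_pow by (simp add: Nil_Isom_def)
    qed
    also have "\<dots> = nil_map 1 (of_int i * v) (of_int i * s)"
      unfolding nat by (subst inv_nil_map) (simp_all add: neg nil_map_eq_iff del: of_nat_Suc)
    finally show ?thesis unfolding neg .
  qed
qed

text \<open>The coordinates are read off one after another: the rotation part settles
  \<open>R [^] n\<close> through \<open>order\<close>; then the exponents of \<open>X\<close> and
  \<open>Y\<close> vanish, because \<open>v\<close> and its rotated copy are independent over the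
  reals by \<open>Im \<rho> \<noteq> 0\<close>; the height settles the exponent of
  \<open>Z\<close>.\<close>

lemma normal_form_trivial:
  fixes G (structure)
  assumes hc: "heisenberg_cyclic G X Y Z R c" and \<phi>: "\<phi> \<in> hom G Nil_Isom"
    and X: "\<phi> X = nil_map 1 v s" and Z: "\<phi> Z = nil_map 1 0 \<tau>" and R: "\<phi> R = nil_map \<rho> w u"
    and v: "v \<noteq> 0" and \<tau>: "\<tau> \<noteq> 0" and \<rho>: "cmod \<rho> = 1" "Im \<rho> \<noteq> 0"
    and order: "\<And>n. \<rho> ^ n = 1 \<Longrightarrow> R [^] (n::nat) = \<one>"
    and g: "g \<in> heisenberg_cyclic.normal_forms G X Y Z R" and ker: "\<phi> g = \<one>\<^bsub>Nil_Isom\<^esub>"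
  shows "g = \<one>"
proof -
  interpret H: heisenberg_cyclic G X Y Z R c by (rule hc)
  interpret N: group Nil_Isom by (rule group_Nil_Isom)
  interpret \<phi>: group_hom G Nil_Isom \<phi>
    using \<phi> by (simp add: group_hom_def group_hom_axioms_def H.is_group group_Nil_Isom)
  have carr: "\<phi> X \<in> carrier Nil_Isom" "\<phi> Y \<in> carrier Nil_Isom" "\<phi> Z \<in> carrier Nil_Isom" "\<phi> R \<in> carrier Nil_Isom"
    by (rule \<phi>.hom_closed, simp)+
  \<comment> \<open>The conjugate \<open>cnj \<rho>\<close> appears because products apply the left
    factor first, so conjugation by \<open>R\<close> acts on vectors by the inverse
    rotation.\<close>
  obtain s' where Y: "\<phi> Y = nil_map 1 (cnj \<rho> * v) s'"
  proof -
    have "\<phi> Y = \<phi> R \<otimes>\<^bsub>Nil_Isom\<^esub> \<phi> X \<otimes>\<^bsub>Nil_Isom\<^esub> inv\<^bsub>Nil_Isom\<^esub> \<phi> R"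
      unfolding H.rx[symmetric] by simp
    also have "inv\<^bsub>Nil_Isom\<^esub> \<phi> R = nil_map (cnj \<rho>) (- cnj \<rho> * w) (- u)"
      using carr(4) nil_isometry_inverse[of "\<phi> R"] \<rho>(1) unfolding R
      by (simp add: Nil_Isom_def inv_nil_map)
    finally have "\<phi> Y = nil_map (cnj \<rho>) (- cnj \<rho> * w) (- u) \<circ> (nil_map 1 v s \<circ> nil_map \<rho> w u)"
      unfolding X R Nil_Isom_mult .
    also have "\<dots> = nil_map (cnj \<rho> * (1 * \<rho>)) (cnj \<rho> * (1 * w + v) + - cnj \<rho> * w)
        (u + s + Im (cnj v * (1 * w)) / 2 + - u + Im (cnj (- cnj \<rho> * w) * (cnj \<rho> * (1 * w + v))) / 2)"
      using \<rho>(1) by (simp only: nil_map_comp norm_one complex_mod_cnj)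
    also have "cnj \<rho> * (1 * \<rho>) = 1"
      using complex_norm_square[of \<rho>] \<rho>(1) by (simp add: mult.commute)
    also have "cnj \<rho> * (1 * w + v) + - cnj \<rho> * w = cnj \<rho> * v" by (simp add: algebra_simps)
    finally show ?thesis by (rule that)
  qed
  obtain i j k :: int and n :: nat where g: "g = X [^] i \<otimes> Y [^] j \<otimes> Z [^] k \<otimes> R [^] n"
    using g unfolding H.normal_forms_def by blast
  have "\<phi> g = \<phi> R ^^ n \<circ> (nil_map 1 0 (of_int k * \<tau>) \<circ>
      (nil_map 1 (of_int j * (cnj \<rho> * v)) (of_int j * s') \<circ> nil_map 1 (of_int i * v) (of_int i * s)))"
    unfolding g using carr
    by (simp add: \<phi>.hom_int_pow \<phi>.hom_nat_pow X Y Z Nil_Isom_int_pow_translation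
        Nil_Isom_nat_pow Nil_Isom_mult)
  also have "\<dots> = \<phi> R ^^ n \<circ> nil_map 1 (of_int i * v + of_int j * (cnj \<rho> * v))
      (of_int i * s + of_int j * s' + Im (cnj (of_int j * (cnj \<rho> * v)) * (of_int i * v)) / 2 + of_int k * \<tau>)"
    by (simp add: nil_map_comp)
  finally have \<phi>g: "\<phi> R ^^ n \<circ> nil_map 1 (of_int i * v + of_int j * (cnj \<rho> * v))
      (of_int i * s + of_int j * s' + Im (cnj (of_int j * (cnj \<rho> * v)) * (of_int i * v)) / 2 + of_int k * \<tau>) = id"
    using ker by (simp add: Nil_Isom_one)
  obtain w' u' where Rn: "\<phi> R ^^ n = nil_map (\<rho> ^ n) w' u'"
    unfolding R using funpow_nil_map[OF \<rho>(1)] by blast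
  have "\<rho> ^ n = 1"
    using \<phi>g \<rho>(1) unfolding Rn nil_map_id[symmetric] by (simp add: nil_map_comp norm_power nil_map_eq_iff)
  then have Rn1: "R [^] n = \<one>" by (rule order)
  then have "\<phi> R ^^ n = id"
    using \<phi>.hom_nat_pow[of R n] by (simp add: Nil_Isom_nat_pow Nil_Isom_one)
  from \<phi>g[unfolded this id_comp, unfolded nil_map_id[symmetric] nil_map_eq_iff] have vs: "of_int i * v + of_int j * (cnj \<rho> * v) = 0"
    "of_int i * s + of_int j * s' + Im (cnj (of_int j * (cnj \<rho> * v)) * (of_int i * v)) / 2 + of_int k * \<tau> = 0"
    by blast+
  have "(of_int i + of_int j * cnj \<rho>) * v = 0" using vs(1) by (simp add: algebra_simps)
  then have "of_int i + of_int j * cnj \<rho> = 0" using v by simp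
  from arg_cong[OF this, of Im] arg_cong[OF this, of Re] have "j = 0" "i = 0" using \<rho>(2) by simp_all
  moreover from vs(2) this have "k = 0" using \<tau> by simp
  ultimately show ?thesis by (simp add: g Rn1)
qed

context prism_group
begin

lemma realizes_pq21I:
  assumes ker: "\<And>\<phi> g. \<lbrakk>\<phi> \<in> hom (pq21 p q) Nil_Isom; \<phi> (pq21_class p q [(GenA, True)]) = a;
       \<phi> (pq21_class p q [(GenB, True)]) = b; g \<in> carrier (pq21 p q); \<phi> g = \<one>\<^bsub>Nil_Isom\<^esub>\<rbrakk>
       \<Longrightarrow> g = \<one>\<^bsub>pq21 p q\<^esub>"
  shows "realizes_pq21 p q x"
  unfolding realizes_pq21_def tiling_group_def
proof (rule pq21_iso_generate[OF group_Nil_Isom])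
  show "a \<in> carrier Nil_Isom" "b \<in> carrier Nil_Isom"
    by (simp_all add: Nil_Isom_def nil_isometry_rot_a nil_isometry_rot_b)
  have "\<alpha> ^ p = 1" "\<beta> ^ q = 1" using pq_pos by (simp_all add: \<alpha>_def \<beta>_def Complex.DeMoivre)
  then have "a ^^ p = id" "b ^^ q = id"
    unfolding a_funpow b_funpow_nil_map by (simp_all add: nil_map_id)
  then show "a [^]\<^bsub>Nil_Isom\<^esub> p = \<one>\<^bsub>Nil_Isom\<^esub>" "b [^]\<^bsub>Nil_Isom\<^esub> q = \<one>\<^bsub>Nil_Isom\<^esub>"
    unfolding Nil_Isom_nat_pow by (simp_all add: Nil_Isom_def)
  show "a \<otimes>\<^bsub>Nil_Isom\<^esub> b \<otimes>\<^bsub>Nil_Isom\<^esub> a \<otimes>\<^bsub>Nil_Isom\<^esub> b = b \<otimes>\<^bsub>Nil_Isom\<^esub> a \<otimes>\<^bsub>Nil_Isom\<^esub> b \<otimes>\<^bsub>Nil_Isom\<^esub> a"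
    unfolding abab ..
qed (rule ker)

text \<open>Here \<open>R\<close> is the generator of larger order \<open>n\<close> and \<open>D\<close> the other one. Since \<open>D\<close> and \<open>R ^ e\<close> rotate by
  the same angle, their quotient is a translation, which is not vertical by the last assumption.\<close>

lemma kernel_trivial:
  fixes \<phi> and A B R D :: "pq_word set" and e n :: nat
  defines "A \<equiv> pq21_class p q [(GenA, True)]" and "B \<equiv> pq21_class p q [(GenB, True)]"
  assumes RD: "R = B \<and> D = A \<or> R = A \<and> D = B"
    and hc: "heisenberg_cyclic (pq21 p q) (D \<otimes>\<^bsub>pq21 p q\<^esub> inv\<^bsub>pq21 p q\<^esub> (R [^]\<^bsub>pq21 p q\<^esub> e)) Y Z R c"
    and Z: "Z = D \<otimes>\<^bsub>pq21 p q\<^esub> R \<otimes>\<^bsub>pq21 p q\<^esub> D \<otimes>\<^bsub>pq21 p q\<^esub> R"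
    and \<phi>: "\<phi> \<in> hom (pq21 p q) Nil_Isom" "\<phi> A = a" "\<phi> B = b"
    and r: "\<phi> R = nil_map (cis (2 * pi / n)) w u" and n: "n \<ge> 3" "R [^]\<^bsub>pq21 p q\<^esub> n = \<one>\<^bsub>pq21 p q\<^esub>"
    and d: "\<phi> D = nil_map (cis (2 * pi / n) ^ e) w' u'"
    and g: "g \<in> carrier (pq21 p q)" "\<phi> g = \<one>\<^bsub>Nil_Isom\<^esub>"
    and free: "base_pt ((\<phi> R ^^ e) origin) \<noteq> base_pt (\<phi> D origin)"
  shows "g = \<one>\<^bsub>pq21 p q\<^esub>"
proof -
  interpret G: group "pq21 p q" by (rule group_pq21)
  interpret N: group Nil_Isom by (rule group_Nil_Isom)
  interpret \<phi>: group_hom "pq21 p q" Nil_Isom \<phi>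
    using \<phi>(1) by (simp add: group_hom_def group_hom_axioms_def group_pq21 group_Nil_Isom)
  interpret H: heisenberg_cyclic "pq21 p q" "D \<otimes>\<^bsub>pq21 p q\<^esub> inv\<^bsub>pq21 p q\<^esub> (R [^]\<^bsub>pq21 p q\<^esub> e)" Y Z R c by (rule hc)
  define \<rho> where "\<rho> = cis (2 * pi / n)"
  have carr: "A \<in> carrier (pq21 p q)" "B \<in> carrier (pq21 p q)" "D \<in> carrier (pq21 p q)"
    using RD by (auto simp: A_def B_def)
  define X where "X = D \<otimes>\<^bsub>pq21 p q\<^esub> inv\<^bsub>pq21 p q\<^esub> (R [^]\<^bsub>pq21 p q\<^esub> e)"
  have X: "X \<in> carrier (pq21 p q)" using carr by (simp add: X_def)
  \<comment> \<open>Right multiplication by \<open>D\<close> is thus one by \<open>X\<close>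
    followed by powers of \<open>R\<close>, both of which preserve normal forms.\<close>
  have D: "D = X \<otimes>\<^bsub>pq21 p q\<^esub> R [^]\<^bsub>pq21 p q\<^esub> e" using carr by (simp add: X_def G.m_assoc)
  have closed: "h \<otimes>\<^bsub>pq21 p q\<^esub> D \<in> H.normal_forms" "h \<otimes>\<^bsub>pq21 p q\<^esub> R \<in> H.normal_forms"
    if "h \<in> carrier (pq21 p q)" "h \<in> H.normal_forms" for h
    using H.normal_forms_r[OF that(2)] H.normal_forms_r_pow[OF H.normal_forms_x[OF that(2)], of e]
      that(1) X unfolding X_def[symmetric] D by (simp_all add: G.m_assoc)
  have "g \<in> H.normal_forms"
    using g(1) pq_pos
  proof (induction rule: pq21_word_induct)
    case one
    show ?case by (rule H.normal_forms_one)
  next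
    case (a h)
    then show ?case using closed[of h] RD by (auto simp: A_def)
  next
    case (b h)
    then show ?case using closed[of h] RD by (auto simp: B_def)
  qed
  obtain w'' u'' where Re: "\<phi> R ^^ e = nil_map (\<rho> ^ e) w'' u''"
    unfolding r \<rho>_def[symmetric] using funpow_nil_map[of \<rho> e w u] by (auto simp: \<rho>_def)
  have norm: "cmod (\<rho> ^ e) = 1" "cmod \<rho> = 1" by (simp_all add: \<rho>_def norm_power)
  have "\<phi> X = \<phi> D \<otimes>\<^bsub>Nil_Isom\<^esub> inv\<^bsub>Nil_Isom\<^esub> (\<phi> R ^^ e)"
    unfolding X_def using carr by (simp add: \<phi>.hom_nat_pow Nil_Isom_nat_pow)
  also have "inv\<^bsub>Nil_Isom\<^esub> (\<phi> R ^^ e) = inv_into UNIV (\<phi> R ^^ e)"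
  proof (rule nil_isometry_inverse)
    have "\<phi> (R [^]\<^bsub>pq21 p q\<^esub> e) \<in> carrier Nil_Isom" by (rule \<phi>.hom_closed) simp
    then show "nil_isometry (\<phi> R ^^ e)"
      by (simp add: \<phi>.hom_nat_pow Nil_Isom_nat_pow) (simp add: Nil_Isom_def)
  qed
  finally have "\<phi> X = nil_map (cnj (\<rho> ^ e)) (- cnj (\<rho> ^ e) * w'') (- u'') \<circ> nil_map (\<rho> ^ e) w' u'"
    unfolding Re d \<rho>_def[symmetric] inv_nil_map[OF norm(1)] Nil_Isom_mult .
  also have "\<dots> = nil_map (cnj (\<rho> ^ e) * \<rho> ^ e) (cnj (\<rho> ^ e) * w' + - cnj (\<rho> ^ e) * w'')
      (u' + - u'' + Im (cnj (- cnj (\<rho> ^ e) * w'') * (cnj (\<rho> ^ e) * w')) / 2)"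
    using norm(1) by (simp only: nil_map_comp complex_mod_cnj)
  also have "cnj (\<rho> ^ e) * \<rho> ^ e = 1"
    using complex_norm_square[of "\<rho> ^ e"] norm(1) by (simp add: mult.commute)
  also have "cnj (\<rho> ^ e) * w' + - cnj (\<rho> ^ e) * w'' = cnj (\<rho> ^ e) * (w' - w'')" by (simp add: algebra_simps)
  finally obtain s where \<phi>X: "\<phi> X = nil_map 1 (cnj (\<rho> ^ e) * (w' - w'')) s" by blast
  \<comment> \<open>The two translation parts are the images of the origin under \<open>D\<close>
    and under the power of \<open>R\<close>.\<close>
  have "w' \<noteq> w''" using free unfolding Re d by simp
  then have v: "cnj (\<rho> ^ e) * (w' - w'') \<noteq> 0" by (simp add: \<rho>_def)
  have \<phi>Z: "\<phi> Z = nil_map 1 0 t"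
    using RD carr abab unfolding Z fibre_translation_eq_nil_map by (auto simp: \<phi>(2,3))
  have "Im \<rho> > 0"
    unfolding \<rho>_def using n(1) by (auto simp: field_simps intro!: sin_gt_zero)
  then have im: "Im \<rho> \<noteq> 0" by simp
  have order: "R [^]\<^bsub>pq21 p q\<^esub> m = \<one>\<^bsub>pq21 p q\<^esub>" if "\<rho> ^ m = 1" for m :: nat
  proof -
    have "cis (2 * pi * real (m mod n) / real n) = \<rho> ^ (m mod n)"
      by (simp add: \<rho>_def Complex.DeMoivre mult.commute)
    also have "\<dots> = \<rho> ^ (m mod n + n * (m div n))"
    proof -
      have "\<rho> ^ n = 1" using n(1) by (simp add: \<rho>_def Complex.DeMoivre)
      then show ?thesis by (simp only: power_add power_mult) simp
    qed
    also have "\<dots> = cis (2 * pi * real 0 / real n)" using that by simp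
    finally have "m mod n = 0"
      using n(1) inj_onD[OF bij_betw_imp_inj_on[OF Complex.bij_betw_roots_unity[of n]], of "m mod n" 0] by simp
    then obtain l where "m = n * l" by auto
    then show ?thesis using n(2) by (simp add: G.nat_pow_pow[symmetric])
  qed
  show ?thesis
    using normal_form_trivial[OF hc \<phi>(1) \<phi>X[unfolded X_def] \<phi>Z r[folded \<rho>_def] v _ norm(2) im order \<open>g \<in> H.normal_forms\<close> g(2)]
      t_neg by simp
qed

end

section \<open>Square and triangular lattices\<close>

definition eis :: "int \<Rightarrow> int \<Rightarrow> complex" where
  "eis m n = Complex (of_int m - of_int n / 2) (of_int n * sqrt 3 / 2)"

definition eis_norm :: "int \<Rightarrow> int \<Rightarrow> int" where
  "eis_norm m n = m\<^sup>2 - m * n + n\<^sup>2"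

lemma cis_60: "cis (pi / 3) = eis 1 1" "cis (2 * pi / 6) = eis 1 1"
  by (simp_all add: eis_def complex_eq_iff cos_60 sin_60)

lemma cis_120: "cis (2 * pi / 3) = eis 0 1"
  by (simp add: eis_def complex_eq_iff cos_120 sin_120)

lemma eis_60: "eis 1 1 * eis m n = eis (m - n) m"
  by (simp add: eis_def complex_eq_iff field_simps)

lemma eis_120: "eis 0 1 * eis m n = eis (- n) (m - n)"
  by (simp add: eis_def complex_eq_iff field_simps)

lemma eis_add: "eis m n + eis m' n' = eis (m + m') (n + n')"
  by (simp add: eis_def complex_eq_iff field_simps)

lemma eis_1: "eis 1 0 = 1"
  by (simp add: eis_def complex_eq_iff)

lemma eis_eq_iff: "eis m n = eis m' n' \<longleftrightarrow> m = m' \<and> n = n'"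
  by (auto simp: eis_def complex_eq_iff)

lemma cmod_eis: "(cmod (eis m n))\<^sup>2 = of_int (eis_norm m n)"
  unfolding cmod_power2 eis_def eis_norm_def by (simp add: field_simps power2_eq_square)

lemma eis_unit:
  assumes "eis_norm m n = 1"
  shows "(m, n) \<in> {(1, 0), (1, 1), (0, 1), (- 1, 0), (- 1, - 1), (0, - 1)}"
proof -
  \<comment> \<open>Completing the square in either variable bounds the other one.\<close>
  have "4 * eis_norm m n = (2 * m - n)\<^sup>2 + 3 * n\<^sup>2" "4 * eis_norm m n = (2 * n - m)\<^sup>2 + 3 * m\<^sup>2"
    by (simp_all add: eis_norm_def power2_eq_square algebra_simps)
  then have "3 * n\<^sup>2 \<le> 4" "3 * m\<^sup>2 \<le> 4"
    using assms zero_le_power2[of "2 * m - n"] zero_le_power2[of "2 * n - m"] by linarith+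
  then have "n\<^sup>2 < 2\<^sup>2" "m\<^sup>2 < 2\<^sup>2" by simp_all
  then have "\<bar>n\<bar> < 2" "\<bar>m\<bar> < 2" using power2_less_imp_less[of "\<bar>n\<bar>" 2] power2_less_imp_less[of "\<bar>m\<bar>" 2] by simp_all
  then have "n \<in> {- 1, 0, 1}" "m \<in> {- 1, 0, 1}" by auto
  then show ?thesis using assms by (auto simp: eis_norm_def)
qed

lemma eis_norm_pos: "(m, n) \<noteq> (0, 0) \<Longrightarrow> eis_norm m n \<ge> 1"
proof -
  assume "(m, n) \<noteq> (0, 0)"
  then have "eis m n \<noteq> eis 0 0" by (simp add: eis_eq_iff)
  moreover have "eis 0 0 = 0" by (simp add: eis_def complex_eq_iff)
  ultimately have "(cmod (eis m n))\<^sup>2 > 0" by simp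
  then show ?thesis unfolding cmod_eis by linarith
qed

text \<open>With \<omega> the cube root of unity, \<open>(m + n) mod 3\<close> is the residue of m +
  n \<omega> modulo the prime 1 - \<omega>, as \<omega> is congruent to 1; the sixth root 1 +
  \<omega> is then congruent to -1. These residues separate centres from vertices.\<close>

lemma eis_60_pow: "\<exists>m n. eis 1 1 ^ k = eis m n \<and> (m + n) mod 3 = (if even k then 1 else 2)"
proof (induction k)
  case 0
  show ?case by (rule exI[of _ 1], rule exI[of _ 0]) (simp add: eis_1)
next
  case (Suc k)
  then obtain m n where "eis 1 1 ^ k = eis m n" and mn: "(m + n) mod 3 = (if even k then 1 else 2)" by blast
  then have "eis 1 1 ^ Suc k = eis (m - n) m" by (simp add: eis_60)
  moreover have "(m - n + m) mod 3 = (if even (Suc k) then 1 else 2)"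
    using mn by (cases "even k"; simp; presburger)
  ultimately show ?case by blast
qed

lemma norm_eis_60 [simp]: "cmod (eis 1 1) = 1"
  by (simp flip: cis_60)

lemma norm_eis_120 [simp]: "cmod (eis 0 1) = 1"
  by (simp flip: cis_120)

lemma eis_120_eq: "eis 0 1 = eis 1 1 ^ 2"
  by (simp add: power2_eq_square eis_60)

text \<open>The lattice vectors of norm 1 are the sixth roots of unity. Residue 1 singles out the
  cube roots, which matters for \<open>p\<close> = 3, where \<alpha> generates only these.\<close>

lemma eis_unit_pow:
  assumes "eis_norm m n = 1"
  obtains j where "eis m n = eis 1 1 ^ j" "(m + n) mod 3 = 1 \<Longrightarrow> even j"
proof -
  have pow: "eis 1 1 ^ 2 = eis 0 1" "eis 1 1 ^ 3 = eis (- 1) 0" "eis 1 1 ^ 4 = eis (- 1) (- 1)" "eis 1 1 ^ 5 = eis 0 (- 1)"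
    by (simp_all add: numeral_eq_Suc eis_60)
  have "\<exists>j. eis m n = eis 1 1 ^ j \<and> ((m + n) mod 3 = 1 \<longrightarrow> even j)"
    using eis_unit[OF assms]
  proof (elim insertE emptyE; clarsimp)
    show "\<exists>j. eis 1 0 = eis 1 1 ^ j \<and> even j" by (rule exI[of _ 0]) (simp add: eis_1)
    show "\<exists>j. eis 1 1 = eis 1 1 ^ j" by (rule exI[of _ 1]) simp
    show "\<exists>j. eis 0 1 = eis 1 1 ^ j \<and> even j" by (rule exI[of _ 2]) (simp add: pow)
    show "\<exists>j. eis (- 1) 0 = eis 1 1 ^ j" by (rule exI[of _ 3]) (simp add: pow)
    show "\<exists>j. eis (- 1) (- 1) = eis 1 1 ^ j \<and> even j" by (rule exI[of _ 4]) (simp add: pow)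
    show "\<exists>j. eis 0 (- 1) = eis 1 1 ^ j" by (rule exI[of _ 5]) (simp add: pow)
  qed
  then show ?thesis using that by blast
qed

lemma cmod_scaled_eis:
  assumes "x > 0"
  shows "x \<le> cmod (of_real x * eis m n) \<longleftrightarrow> eis_norm m n \<ge> 1"
    and "cmod (of_real x * eis m n) = x \<longleftrightarrow> eis_norm m n = 1"
proof -
  have sq: "(cmod (of_real x * eis m n))\<^sup>2 = x\<^sup>2 * of_int (eis_norm m n)"
    by (simp add: norm_mult power_mult_distrib cmod_eis)
  have "x \<le> cmod (of_real x * eis m n) \<longleftrightarrow> x\<^sup>2 \<le> (cmod (of_real x * eis m n))\<^sup>2"
    using assms by (intro power_mono_iff[symmetric]) auto
  also have "\<dots> \<longleftrightarrow> eis_norm m n \<ge> 1" unfolding sq using assms by simp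
  finally show "x \<le> cmod (of_real x * eis m n) \<longleftrightarrow> eis_norm m n \<ge> 1" .
  have "cmod (of_real x * eis m n) = x \<longleftrightarrow> (cmod (of_real x * eis m n))\<^sup>2 = x\<^sup>2"
    using assms by (intro power_eq_iff_eq_base[symmetric]) auto
  also have "\<dots> \<longleftrightarrow> eis_norm m n = 1" unfolding sq using assms by simp
  finally show "cmod (of_real x * eis m n) = x \<longleftrightarrow> eis_norm m n = 1" .
qed

text \<open>With \<open>\<omega> = cis (2 * pi / 3)\<close>, \<open>eis m n\<close> is \<open>m + n * \<omega>\<close>. In all motions generated by the two rotations the
  height shift is determined modulo \<open>t\<close> by the norm of the translation part.\<close>

definition eis_map :: "real \<Rightarrow> real \<Rightarrow> nat \<Rightarrow> int \<Rightarrow> int \<Rightarrow> int \<Rightarrow> nil_point \<Rightarrow> nil_point" where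
  "eis_map x t k m n l = nil_map (eis 1 1 ^ k) (x * eis m n) (t * (of_int (eis_norm m n) / 2 + of_int l))"

lemma eis_map_id: "eis_map x t 0 0 0 0 = id"
proof -
  have "eis 0 0 = 0" by (simp add: eis_def complex_eq_iff)
  then show ?thesis by (simp add: eis_map_def eis_norm_def nil_map_id)
qed

lemma eis_map_rotation_60: "nil_map (eis 1 1) 0 0 \<circ> eis_map x t k m n l = eis_map x t (Suc k) (m - n) m l"
proof -
  have "eis_norm (m - n) m = eis_norm m n" by (simp add: eis_norm_def power2_eq_square algebra_simps)
  then show ?thesis
    by (simp add: eis_map_def nil_map_comp nil_map_eq_iff eis_60[symmetric] mult.left_commute)
qed

lemma eis_map_rotation_120: "nil_map (eis 0 1) 0 0 \<circ> eis_map x t k m n l = eis_map x t (k + 2) (- n) (m - n) l"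
proof -
  have "eis_norm (- n) (m - n) = eis_norm m n" by (simp add: eis_norm_def power2_eq_square algebra_simps)
  moreover have pow: "eis 1 1 ^ (k + 2) = eis 0 1 * eis 1 1 ^ k" by (simp only: eis_120_eq power_add mult.commute)
  ultimately show ?thesis
    unfolding eis_map_def pow by (simp add: nil_map_comp nil_map_eq_iff eis_120[symmetric] mult.left_commute)
qed

text \<open>The condition on \<open>l'\<close> is the equation of heights divided by
  \<open>t / 2\<close>. Over the integers it turns preservation of the integral vertical part into a
  polynomial identity.\<close>

lemma eis_map_vertex_rotation:
  assumes \<beta>: "\<beta> * eis m n = eis m' n'" "cmod \<beta> = 1" "\<beta> * eis 1 1 ^ k = eis 1 1 ^ k'" and "1 - \<beta> = eis u w"
    and t: "t = - x\<^sup>2 * sqrt 3 / 2"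
    and l: "2 * l' = 2 * l + eis_norm m n + 1 - (n' - n) - eis_norm (m' + u) (n' + w)"
  shows "nil_map \<beta> ((1 - \<beta>) * x) (t / 2) \<circ> eis_map x t k m n l = eis_map x t k' (m' + u) (n' + w) l'"
proof -
  have "cnj \<beta> * \<beta> = 1" using complex_norm_square[of \<beta>] \<beta>(2) by (simp add: mult.commute)
  then have "cnj ((1 - \<beta>) * x) * (\<beta> * (x * eis m n)) = (\<beta> * eis m n - eis m n) * of_real (x\<^sup>2)"
  proof -
    have "cnj ((1 - \<beta>) * x) * (\<beta> * (x * eis m n)) = (\<beta> * eis m n - cnj \<beta> * \<beta> * eis m n) * of_real (x\<^sup>2)"
      by (simp add: algebra_simps power2_eq_square)
    then show ?thesis unfolding \<open>cnj \<beta> * \<beta> = 1\<close> by simp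
  qed
  also have "\<dots> = (eis m' n' - eis m n) * of_real (x\<^sup>2)" unfolding \<beta>(1) ..
  finally have "Im (cnj ((1 - \<beta>) * x) * (\<beta> * (x * eis m n))) = Im ((eis m' n' - eis m n) * of_real (x\<^sup>2))"
    by (rule arg_cong)
  also have "\<dots> = x\<^sup>2 * (of_int (n' - n) * sqrt 3 / 2)"
    by (simp add: eis_def algebra_simps)
  also have "\<dots> = - t * of_int (n' - n)" by (simp add: t)
  finally have im: "Im (cnj ((1 - \<beta>) * x) * (\<beta> * (x * eis m n))) = - t * of_int (n' - n)" .
  have "real_of_int (2 * l') = of_int (2 * l + eis_norm m n + 1 - (n' - n) - eis_norm (m' + u) (n' + w))"
    using l by (simp only:)
  then have l2: "real_of_int l' = of_int l + of_int (eis_norm m n) / 2 + 1 / 2 - of_int (n' - n) / 2 - of_int (eis_norm (m' + u) (n' + w)) / 2"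
    by (simp add: field_simps)
  have "t * (of_int (eis_norm m n) / 2 + of_int l) + t / 2 + - t * of_int (n' - n) / 2
      = t * (of_int (eis_norm (m' + u) (n' + w)) / 2 + of_int l')"
    unfolding l2 by (simp add: field_simps)
  moreover have "\<beta> * (x * eis m n) + (1 - \<beta>) * x = x * eis (m' + u) (n' + w)"
    unfolding eis_add[symmetric] \<beta>(1)[symmetric] assms(4)[symmetric] by (simp add: algebra_simps)
  ultimately show ?thesis
    unfolding eis_map_def nil_map_comp[OF \<beta>(2)] im \<beta>(3) by simp
qed

lemma eis_map_vertex_rotation_60:
  assumes "t = - x\<^sup>2 * sqrt 3 / 2"
  shows "nil_map (eis 1 1) ((1 - eis 1 1) * x) (t / 2) \<circ> eis_map x t k m n l
    = eis_map x t (Suc k) (m - n) (m - 1) (l + n)"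
  using eis_map_vertex_rotation[of "eis 1 1" m n "m - n" m k "Suc k" 0 "- 1" t x "l + n" l] assms
  by (simp add: eis_60 eis_norm_def power2_eq_square algebra_simps) (simp add: eis_def complex_eq_iff)

lemma eis_map_vertex_rotation_120:
  assumes "t = - x\<^sup>2 * sqrt 3 / 2"
  shows "nil_map (eis 0 1) ((1 - eis 0 1) * x) (t / 2) \<circ> eis_map x t k m n l
    = eis_map x t (k + 2) (1 - n) (m - n - 1) (l + n + m - 1)"
proof -
  have "1 - eis 0 1 = eis 1 (- 1)" by (simp add: eis_def complex_eq_iff)
  moreover have "eis 0 1 * eis 1 1 ^ k = eis 1 1 ^ (k + 2)" by (simp only: eis_120_eq power_add mult.commute)
  ultimately have "nil_map (eis 0 1) ((1 - eis 0 1) * x) (t / 2) \<circ> eis_map x t k m n l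
      = eis_map x t (k + 2) (- n + 1) (m - n + - 1) (l + n + m - 1)"
    by (intro eis_map_vertex_rotation eis_120 norm_eis_120 assms)
      (simp_all add: eis_norm_def power2_eq_square algebra_simps)
  then show ?thesis by simp
qed

section \<open>The three tilings\<close>

lemma prism_group_36: "x > 0 \<Longrightarrow> prism_group 3 x 6"
  and prism_group_63: "x > 0 \<Longrightarrow> prism_group 6 x 3"
  and prism_group_44: "x > 0 \<Longrightarrow> prism_group 4 x 4"
  by (unfold_locales; simp)+

lemma prism_tiling_36:
  assumes x: "x > 0"
  shows "prism_tiling 3 x 6"
proof -
  interpret prism_group 3 x 6 using x by (rule prism_group_36)
  have \<alpha>: "\<alpha> = eis 0 1" and \<beta>: "\<beta> = eis 1 1" by (simp_all add: \<alpha>_def \<beta>_def cis_60 cis_120)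
  have t: "t = - x\<^sup>2 * sqrt 3 / 2" by (simp add: t_def sin_60)
  show ?thesis
  proof
    fix g assume "g \<in> \<Gamma>"
    \<comment> \<open>Centres have residue 0 or 2, according to the parity of the rotation. Adding
      the rotated vertex vector of residue 1 or 2 always gives residue 1, so the vertices fill
      exactly the remaining class.\<close>
    then have "\<exists>k m n l. g = eis_map x t k m n l \<and> (m + n) mod 3 = (if even k then 0 else 2)"
      using pq_pos
    proof (induction rule: tiling_group_induct)
      case id
      show ?case by (intro exI[of _ 0]) (simp add: eis_map_id)
    next
      case (a g)
      then obtain k m n l where g: "g = eis_map x t k m n l" "(m + n) mod 3 = (if even k then 0 else 2)" by blast
      have "a \<circ> g = eis_map x t (k + 2) (- n) (m - n) l"
        unfolding g(1) a_eq \<alpha> by (rule eis_map_rotation_120)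
      moreover have "(- n + (m - n)) mod 3 = (if even (k + 2) then 0 else 2)"
        using g(2) by (cases "even k"; simp; presburger)
      ultimately show ?case by blast
    next
      case (b g)
      then obtain k m n l where g: "g = eis_map x t k m n l" "(m + n) mod 3 = (if even k then 0 else 2)" by blast
      have "b \<circ> g = eis_map x t (Suc k) (m - n) (m - 1) (l + n)"
        unfolding g(1) b_eq \<beta> using t by (rule eis_map_vertex_rotation_60)
      moreover have "(m - n + (m - 1)) mod 3 = (if even (Suc k) then 0 else 2)"
        using g(2) by (cases "even k"; simp; presburger)
      ultimately show ?case by blast
    qed
    then obtain k m n l where g: "g = eis_map x t k m n l" and mn: "(m + n) mod 3 = (if even k then 0 else 2)" by blast
    obtain m' n' where k: "eis 1 1 ^ k = eis m' n'" and mn': "(m' + n') mod 3 = (if even k then 1 else 2)"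
      using eis_60_pow by blast
    have v: "eis 1 1 ^ k * x + x * eis m n = x * eis (m' + m) (n' + n)"
      unfolding k by (simp add: algebra_simps flip: eis_add)
    have residue: "(m' + m + (n' + n)) mod 3 = 1" using mn mn' by (cases "even k"; simp; presburger)
    have zero: "m = 0 \<and> n = 0" if "x * eis m n = 0" using that x by (simp add: eis_def complex_eq_iff)
    \<comment> \<open>A motion fixing the origin has residue 0, so it turns by a multiple of 120
      degrees.\<close>
    have even: "even k" if "x * eis m n = 0" using zero[OF that] mn by (simp split: if_splits)
    show "\<exists>(\<rho>::complex) (v::complex) (s::real). g = nil_map \<rho> v s \<and> cmod \<rho> = 1 \<and>
      cmod (\<rho> * x + v) \<ge> x \<and>
      (cmod (\<rho> * x + v) = x \<longrightarrow> (\<exists>j. \<rho> * x + v = x * \<alpha> ^ j)) \<and>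
      (v = 0 \<longrightarrow> (\<exists>j. \<rho> = \<alpha> ^ j)) \<and>
      (\<rho> * x + v = x \<longrightarrow> (\<exists>j. \<rho> = \<beta> ^ j)) \<and>
      (v = 0 \<longrightarrow> (\<exists>l::int. s = l * t))"
    proof (rule exI[of _ "eis 1 1 ^ k"], rule exI[of _ "x * eis m n"],
        rule exI[of _ "t * (of_int (eis_norm m n) / 2 + of_int l)"], intro conjI impI)
      show "g = nil_map (eis 1 1 ^ k) (x * eis m n) (t * (of_int (eis_norm m n) / 2 + of_int l))"
        unfolding g eis_map_def ..
      show "cmod (eis 1 1 ^ k) = 1" by (simp add: norm_power)
      have "(m' + m, n' + n) \<noteq> (0, 0)" using residue by auto
      then show "x \<le> cmod (eis 1 1 ^ k * x + x * eis m n)"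
        unfolding v cmod_scaled_eis(1)[OF x] by (rule eis_norm_pos)
      show "\<exists>j. eis 1 1 ^ k = \<beta> ^ j" by (auto simp: \<beta>)
    next
      assume "cmod (eis 1 1 ^ k * x + x * eis m n) = x"
      then have "eis_norm (m' + m) (n' + n) = 1" unfolding v cmod_scaled_eis(2)[OF x] .
      then obtain j where "eis (m' + m) (n' + n) = eis 1 1 ^ j" "even j"
        using eis_unit_pow residue by metis
      then have "eis (m' + m) (n' + n) = \<alpha> ^ (j div 2)"
        by (simp add: \<alpha> eis_120_eq flip: power_mult)
      then show "\<exists>j. eis 1 1 ^ k * x + x * eis m n = x * \<alpha> ^ j" unfolding v by auto
    next
      assume "x * eis m n = 0"
      then have "eis 1 1 ^ k = \<alpha> ^ (k div 2)"
        using even by (simp add: \<alpha> eis_120_eq flip: power_mult)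
      then show "\<exists>j. eis 1 1 ^ k = \<alpha> ^ j" ..
    next
      assume "x * eis m n = 0"
      then have "t * (of_int (eis_norm m n) / 2 + of_int l) = of_int l * t"
        using zero by (simp add: eis_norm_def)
      then show "\<exists>l'::int. t * (of_int (eis_norm m n) / 2 + of_int l) = of_int l' * t" ..
    qed
  qed
qed

lemma prism_tiling_63:
  assumes x: "x > 0"
  shows "prism_tiling 6 x 3"
proof -
  interpret prism_group 6 x 3 using x by (rule prism_group_63)
  have \<alpha>: "\<alpha> = eis 1 1" and \<beta>: "\<beta> = eis 0 1" by (simp_all add: \<alpha>_def \<beta>_def cis_60 cis_120)
  have t: "t = - x\<^sup>2 * sqrt 3 / 2" by (simp add: t_def sin_120)
  show ?thesis
  proof
    fix g assume "g \<in> \<Gamma>"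
    \<comment> \<open>Here all centres have residue 0, and the vertices have residues 1 and 2,
      depending on the parity of \<open>k\<close>.\<close>
    then have "\<exists>(k::nat) (m::int) (n::int) (l::int). g = eis_map x t k m n l \<and> 3 dvd m + n"
      using pq_pos
    proof (induction rule: tiling_group_induct)
      case id
      show ?case by (intro exI[of _ 0]) (simp add: eis_map_id)
    next
      case (a g)
      then obtain k :: nat and m n l :: int where g: "g = eis_map x t k m n l" "3 dvd m + n" by blast
      have "a \<circ> g = eis_map x t (Suc k) (m - n) m l"
        unfolding g(1) a_eq \<alpha> by (rule eis_map_rotation_60)
      moreover have "3 dvd m - n + m" using g(2) by presburger
      ultimately show ?case by blast
    next
      case (b g)
      then obtain k :: nat and m n l :: int where g: "g = eis_map x t k m n l" "3 dvd m + n" by blast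
      have "b \<circ> g = eis_map x t (k + 2) (1 - n) (m - n - 1) (l + n + m - 1)"
        unfolding g(1) b_eq \<beta> using t by (rule eis_map_vertex_rotation_120)
      moreover have "3 dvd 1 - n + (m - n - 1)" using g(2) by presburger
      ultimately show ?case by blast
    qed
    then obtain k :: nat and m n l :: int where g: "g = eis_map x t k m n l" and mn: "3 dvd m + n" by blast
    obtain m' n' where k: "eis 1 1 ^ k = eis m' n'" and mn': "(m' + n') mod 3 = (if even k then 1 else 2)"
      using eis_60_pow by blast
    have v: "eis 1 1 ^ k * x + x * eis m n = x * eis (m' + m) (n' + n)"
      unfolding k by (simp add: algebra_simps flip: eis_add)
    have residue: "(m' + m + (n' + n)) mod 3 = (if even k then 1 else 2)" using mn mn' by (cases "even k"; simp; presburger)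
    show "\<exists>(\<rho>::complex) (v::complex) (s::real). g = nil_map \<rho> v s \<and> cmod \<rho> = 1 \<and>
      cmod (\<rho> * x + v) \<ge> x \<and>
      (cmod (\<rho> * x + v) = x \<longrightarrow> (\<exists>j. \<rho> * x + v = x * \<alpha> ^ j)) \<and>
      (v = 0 \<longrightarrow> (\<exists>j. \<rho> = \<alpha> ^ j)) \<and>
      (\<rho> * x + v = x \<longrightarrow> (\<exists>j. \<rho> = \<beta> ^ j)) \<and>
      (v = 0 \<longrightarrow> (\<exists>l::int. s = l * t))"
    proof (rule exI[of _ "eis 1 1 ^ k"], rule exI[of _ "x * eis m n"],
        rule exI[of _ "t * (of_int (eis_norm m n) / 2 + of_int l)"], intro conjI impI)
      show "g = nil_map (eis 1 1 ^ k) (x * eis m n) (t * (of_int (eis_norm m n) / 2 + of_int l))"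
        unfolding g eis_map_def ..
      show "cmod (eis 1 1 ^ k) = 1" by (simp add: norm_power)
      have "(m' + m, n' + n) \<noteq> (0, 0)" using residue by (auto split: if_splits)
      then show "x \<le> cmod (eis 1 1 ^ k * x + x * eis m n)"
        unfolding v cmod_scaled_eis(1)[OF x] by (rule eis_norm_pos)
      show "\<exists>j. eis 1 1 ^ k = \<alpha> ^ j" by (auto simp: \<alpha>)
    next
      assume "cmod (eis 1 1 ^ k * x + x * eis m n) = x"
      then have "eis_norm (m' + m) (n' + n) = 1" unfolding v cmod_scaled_eis(2)[OF x] .
      then have "\<exists>j. eis (m' + m) (n' + n) = \<alpha> ^ j" unfolding \<alpha> using eis_unit_pow by metis
      then show "\<exists>j. eis 1 1 ^ k * x + x * eis m n = x * \<alpha> ^ j" unfolding v by auto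
    next
      assume "eis 1 1 ^ k * x + x * eis m n = x"
      then have "x * eis (m' + m) (n' + n) = x * eis 1 0" unfolding v eis_1 by simp
      then have "m' + m = 1" "n' + n = 0" using x by (simp_all add: eis_eq_iff)
      \<comment> \<open>The first vertex has residue 1, so a motion fixing it turns by a multiple of
        120 degrees.\<close>
      then have "even k" using residue by (simp split: if_splits)
      then have "eis 1 1 ^ k = \<beta> ^ (k div 2)" by (simp add: \<beta> eis_120_eq flip: power_mult)
      then show "\<exists>j. eis 1 1 ^ k = \<beta> ^ j" ..
    next
      assume "x * eis m n = 0"
      then have "m = 0 \<and> n = 0" using x by (simp add: eis_def complex_eq_iff)
      then have "t * (of_int (eis_norm m n) / 2 + of_int l) = of_int l * t"
        by (simp add: eis_norm_def)
      then show "\<exists>l'::int. t * (of_int (eis_norm m n) / 2 + of_int l) = of_int l' * t" ..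
    qed
  qed
qed

text \<open>The denominator is 4 because \<open>b\<close> has height shift \<open>t / 2\<close> and
  translation part (1 - \<i>) x, where 1 - \<i> has norm 2.\<close>

definition gauss_map :: "real \<Rightarrow> real \<Rightarrow> nat \<Rightarrow> int \<Rightarrow> int \<Rightarrow> int \<Rightarrow> nil_point \<Rightarrow> nil_point" where
  "gauss_map x t k m n l = nil_map (\<i> ^ k) (x * Complex (of_int m) (of_int n)) (t * ((of_int m ^ 2 + of_int n ^ 2) / 4 + of_int l))"

lemma gauss_map_id: "gauss_map x t 0 0 0 0 = id"
  by (simp add: gauss_map_def nil_map_id complex_eq_iff flip: nil_map_id) (simp add: nil_map_eq_iff complex_eq_iff)

lemma gauss_map_rotation: "nil_map \<i> 0 0 \<circ> gauss_map x t k m n l = gauss_map x t (Suc k) (- n) m l"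
  by (simp add: gauss_map_def nil_map_comp nil_map_eq_iff complex_eq_iff)

lemma gauss_map_vertex_rotation:
  assumes t: "t = - x\<^sup>2"
  shows "nil_map \<i> ((1 - \<i>) * x) (t / 2) \<circ> gauss_map x t k m n l = gauss_map x t (Suc k) (1 - n) (m - 1) (l + n)"
  by (simp add: gauss_map_def nil_map_comp nil_map_eq_iff complex_eq_iff t)
    (simp add: power2_eq_square field_simps)

lemma gauss_i_pow: "\<exists>m n::int. \<i> ^ k = Complex (of_int m) (of_int n) \<and> odd (m + n)"
proof (induction k)
  case 0
  show ?case by (rule exI[of _ 1], rule exI[of _ 0]) (simp add: complex_eq_iff)
next
  case (Suc k)
  then obtain m n :: int where "\<i> ^ k = Complex (of_int m) (of_int n)" "odd (m + n)" by blast
  then have "\<i> ^ Suc k = Complex (of_int (- n)) (of_int m)" "odd (- n + m)" by (simp_all add: complex_eq_iff)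
  then show ?case by blast
qed

lemma gauss_unit_pow:
  fixes m n :: int
  assumes "m\<^sup>2 + n\<^sup>2 = 1"
  obtains j where "Complex (of_int m) (of_int n) = \<i> ^ j"
proof -
  have "n\<^sup>2 < 4" "m\<^sup>2 < 4"
    using assms zero_le_power2[of m] zero_le_power2[of n] by linarith+
  then have "n\<^sup>2 < 2\<^sup>2" "m\<^sup>2 < 2\<^sup>2" by simp_all
  then have "\<bar>n\<bar> < 2" "\<bar>m\<bar> < 2" using power2_less_imp_less[of "\<bar>n\<bar>" 2] power2_less_imp_less[of "\<bar>m\<bar>" 2] by simp_all
  then have "n \<in> {- 1, 0, 1}" "m \<in> {- 1, 0, 1}" by auto
  with assms have "(m, n) \<in> {(1, 0), (0, 1), (- 1, 0), (0, - 1)}" by auto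
  moreover have "Complex 1 0 = \<i> ^ 0" "Complex 0 1 = \<i> ^ 1" "Complex (- 1) 0 = \<i> ^ 2" "Complex 0 (- 1) = \<i> ^ 3"
    by (simp_all add: complex_eq_iff numeral_eq_Suc)
  ultimately have "\<exists>j. Complex (of_int m) (of_int n) = \<i> ^ j"
    by (elim insertE emptyE; simp only: prod.inject of_int_0 of_int_1 of_int_minus) blast+
  then show ?thesis using that by blast
qed

lemma prism_tiling_44:
  assumes x: "x > 0"
  shows "prism_tiling 4 x 4"
proof -
  interpret prism_group 4 x 4 using x by (rule prism_group_44)
  have \<alpha>: "\<alpha> = \<i>" and \<beta>: "\<beta> = \<i>" by (simp_all add: \<alpha>_def \<beta>_def)
  have t: "t = - x\<^sup>2" by (simp add: t_def)
  show ?thesis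
  proof
    fix g assume "g \<in> \<Gamma>"
    \<comment> \<open>A checkerboard colouring: centres have even and vertices odd coordinate
      sum.\<close>
    then have "\<exists>(k::nat) (m::int) (n::int) (l::int). g = gauss_map x t k m n l \<and> even (m + n)"
      using pq_pos
    proof (induction rule: tiling_group_induct)
      case id
      show ?case by (intro exI[of _ 0]) (simp add: gauss_map_id)
    next
      case (a g)
      then obtain k :: nat and m n l :: int where g: "g = gauss_map x t k m n l" "even (m + n)" by blast
      have "a \<circ> g = gauss_map x t (Suc k) (- n) m l"
        unfolding g(1) a_eq \<alpha> by (rule gauss_map_rotation)
      moreover have "even (- n + m)" using g(2) by simp
      ultimately show ?case by blast
    next
      case (b g)
      then obtain k :: nat and m n l :: int where g: "g = gauss_map x t k m n l" "even (m + n)" by blast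
      have "b \<circ> g = gauss_map x t (Suc k) (1 - n) (m - 1) (l + n)"
        unfolding g(1) b_eq \<beta> using t by (rule gauss_map_vertex_rotation)
      moreover have "even (1 - n + (m - 1))" using g(2) by simp
      ultimately show ?case by blast
    qed
    then obtain k :: nat and m n l :: int where g: "g = gauss_map x t k m n l" and mn: "even (m + n)" by blast
    obtain m' n' :: int where k: "\<i> ^ k = Complex (of_int m') (of_int n')" and mn': "odd (m' + n')"
      using gauss_i_pow by blast
    define u w where "u = m' + m" and "w = n' + n"
    have v: "\<i> ^ k * x + x * Complex (of_int m) (of_int n) = x * Complex (of_int u) (of_int w)"
      unfolding k by (simp add: complex_eq_iff u_def w_def algebra_simps)
    have "odd (u + w)" using mn mn' unfolding u_def w_def by presburger
    then have "u \<noteq> 0 \<or> w \<noteq> 0" by auto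
    then have "u\<^sup>2 + w\<^sup>2 > 0" by (simp add: sum_power2_gt_zero_iff)
    have sq: "(cmod (x * Complex (of_int u) (of_int w)))\<^sup>2 = x\<^sup>2 * of_int (u\<^sup>2 + w\<^sup>2)"
      by (simp add: norm_mult power_mult_distrib cmod_power2)
    show "\<exists>(\<rho>::complex) (v::complex) (s::real). g = nil_map \<rho> v s \<and> cmod \<rho> = 1 \<and>
      cmod (\<rho> * x + v) \<ge> x \<and>
      (cmod (\<rho> * x + v) = x \<longrightarrow> (\<exists>j. \<rho> * x + v = x * \<alpha> ^ j)) \<and>
      (v = 0 \<longrightarrow> (\<exists>j. \<rho> = \<alpha> ^ j)) \<and>
      (\<rho> * x + v = x \<longrightarrow> (\<exists>j. \<rho> = \<beta> ^ j)) \<and>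
      (v = 0 \<longrightarrow> (\<exists>l::int. s = l * t))"
    proof (rule exI[of _ "\<i> ^ k"], rule exI[of _ "x * Complex (of_int m) (of_int n)"],
        rule exI[of _ "t * ((of_int m ^ 2 + of_int n ^ 2) / 4 + of_int l)"], intro conjI impI)
      show "g = nil_map (\<i> ^ k) (x * Complex (of_int m) (of_int n)) (t * ((of_int m ^ 2 + of_int n ^ 2) / 4 + of_int l))"
        unfolding g gauss_map_def ..
      show "cmod (\<i> ^ k) = 1" by (simp add: norm_power)
      have "x\<^sup>2 * 1 \<le> x\<^sup>2 * of_int (u\<^sup>2 + w\<^sup>2)"
        using \<open>u\<^sup>2 + w\<^sup>2 > 0\<close> by (intro mult_left_mono) (linarith, simp)
      then have "x\<^sup>2 \<le> (cmod (x * Complex (of_int u) (of_int w)))\<^sup>2" unfolding sq by simp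
      then show "x \<le> cmod (\<i> ^ k * x + x * Complex (of_int m) (of_int n))"
        unfolding v by (rule power2_le_imp_le) simp
      show "\<exists>j. \<i> ^ k = \<alpha> ^ j" "\<exists>j. \<i> ^ k = \<beta> ^ j" by (auto simp: \<alpha> \<beta>)
    next
      assume "cmod (\<i> ^ k * x + x * Complex (of_int m) (of_int n)) = x"
      then have "x\<^sup>2 * of_int (u\<^sup>2 + w\<^sup>2) = x\<^sup>2" unfolding v sq[symmetric] by simp
      then have "real_of_int (u\<^sup>2 + w\<^sup>2) = 1" using x by simp
      then have "u\<^sup>2 + w\<^sup>2 = 1" by linarith
      then have "\<exists>j. Complex (of_int u) (of_int w) = \<alpha> ^ j" unfolding \<alpha> using gauss_unit_pow by metis
      then show "\<exists>j. \<i> ^ k * x + x * Complex (of_int m) (of_int n) = x * \<alpha> ^ j" unfolding v by auto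
    next
      assume "x * Complex (of_int m) (of_int n) = 0"
      then have "m = 0 \<and> n = 0" using x by (simp add: complex_eq_iff)
      then have "t * ((of_int m ^ 2 + of_int n ^ 2) / 4 + of_int l) = of_int l * t" by simp
      then show "\<exists>l'::int. t * ((of_int m ^ 2 + of_int n ^ 2) / 4 + of_int l) = of_int l' * t" ..
    qed
  qed
qed

section \<open>The realization in the three cases\<close>

lemma (in monoid) nat_pow_2: "y \<in> carrier G \<Longrightarrow> y [^] (2::nat) = y \<otimes> y"
  by (simp add: numeral_2_eq_2)

text \<open>The normal forms use powers of \<open>B\<close>; \<open>e\<close> is the exponent with
  \<alpha> = \<beta>^e.\<close>

lemma realizes_pq21_larger_q:
  assumes "prism_group p x q" and cases: "p = 4 \<and> q = 4 \<and> e = 1 \<or> p = 3 \<and> q = 6 \<and> e = (2::nat)"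
  shows "realizes_pq21 p q x"
proof -
  interpret prism_group p x q by fact
  interpret G: group "pq21 p q" by (rule group_pq21)
  define A B where "A = pq21_class p q [(GenA, True)]" and "B = pq21_class p q [(GenB, True)]"
  have carr [simp]: "A \<in> carrier (pq21 p q)" "B \<in> carrier (pq21 p q)" by (simp_all add: A_def B_def)
  note rels = pq21_generator_relations(3-5)[of p q, folded A_def B_def]
  let ?Z = "A \<otimes>\<^bsub>pq21 p q\<^esub> B \<otimes>\<^bsub>pq21 p q\<^esub> A \<otimes>\<^bsub>pq21 p q\<^esub> B"
  have "\<exists>Y c. heisenberg_cyclic (pq21 p q) (A \<otimes>\<^bsub>pq21 p q\<^esub> inv\<^bsub>pq21 p q\<^esub> (B [^]\<^bsub>pq21 p q\<^esub> e)) Y ?Z B c"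
    using cases
  proof
    assume 4: "p = 4 \<and> q = 4 \<and> e = 1"
    then have "A [^]\<^bsub>pq21 p q\<^esub> (4::nat) = \<one>\<^bsub>pq21 p q\<^esub>" "B [^]\<^bsub>pq21 p q\<^esub> (4::nat) = \<one>\<^bsub>pq21 p q\<^esub>"
      using rels(1,2) by simp_all
    from G.heisenberg_cyclic_4[OF carr this rels(3)]
    have "heisenberg_cyclic (pq21 p q) (A \<otimes>\<^bsub>pq21 p q\<^esub> inv\<^bsub>pq21 p q\<^esub> B)
        (B \<otimes>\<^bsub>pq21 p q\<^esub> (A \<otimes>\<^bsub>pq21 p q\<^esub> inv\<^bsub>pq21 p q\<^esub> B) \<otimes>\<^bsub>pq21 p q\<^esub> inv\<^bsub>pq21 p q\<^esub> B) ?Z B 2" .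
    moreover have "B [^]\<^bsub>pq21 p q\<^esub> Suc 0 = B" by simp
    then have "B [^]\<^bsub>pq21 p q\<^esub> e = B" using 4 by (simp only: One_nat_def)
    ultimately show ?thesis by metis
  next
    assume 6: "p = 3 \<and> q = 6 \<and> e = 2"
    then have "A [^]\<^bsub>pq21 p q\<^esub> (3::nat) = \<one>\<^bsub>pq21 p q\<^esub>" "B [^]\<^bsub>pq21 p q\<^esub> (6::nat) = \<one>\<^bsub>pq21 p q\<^esub>"
      using rels(1,2) by simp_all
    from G.heisenberg_cyclic_6[OF carr this rels(3)]
    have "heisenberg_cyclic (pq21 p q) (A \<otimes>\<^bsub>pq21 p q\<^esub> inv\<^bsub>pq21 p q\<^esub> (B \<otimes>\<^bsub>pq21 p q\<^esub> B))
        (B \<otimes>\<^bsub>pq21 p q\<^esub> (A \<otimes>\<^bsub>pq21 p q\<^esub> inv\<^bsub>pq21 p q\<^esub> (B \<otimes>\<^bsub>pq21 p q\<^esub> B)) \<otimes>\<^bsub>pq21 p q\<^esub> inv\<^bsub>pq21 p q\<^esub> B) ?Z B 3" .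
    moreover have "B [^]\<^bsub>pq21 p q\<^esub> e = B \<otimes>\<^bsub>pq21 p q\<^esub> B" using 6 G.nat_pow_2[OF carr(2)] by (simp only:)
    ultimately show ?thesis by metis
  qed
  then obtain Y c where hc:
    "heisenberg_cyclic (pq21 p q) (A \<otimes>\<^bsub>pq21 p q\<^esub> inv\<^bsub>pq21 p q\<^esub> (B [^]\<^bsub>pq21 p q\<^esub> e)) Y ?Z B c"
    by blast
  have "eis 0 1 \<noteq> 1" using eis_eq_iff[of 0 1 1 0] by (simp add: eis_1)
  have "\<alpha> = \<beta> ^ e \<and> \<alpha> \<noteq> 1"
    using cases
  proof
    assume 4: "p = 4 \<and> q = 4 \<and> e = 1"
    then have "\<alpha> = \<i>" "\<beta> = \<i>" "e = 1" unfolding \<alpha>_def \<beta>_def by simp_all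
    then show ?thesis by (simp only:) (simp add: complex_eq_iff)
  next
    assume 6: "p = 3 \<and> q = 6 \<and> e = 2"
    then have "\<alpha> = eis 0 1" "\<beta> = eis 1 1" "e = 2" unfolding \<alpha>_def \<beta>_def by (simp_all add: cis_60 cis_120)
    with \<open>eis 0 1 \<noteq> 1\<close> eis_120_eq show ?thesis by metis
  qed
  then have power: "\<alpha> = \<beta> ^ e" "\<alpha> \<noteq> 1" by blast+
  show ?thesis
  proof (rule realizes_pq21I, fold A_def B_def)
    fix \<phi> g
    assume \<phi>: "\<phi> \<in> hom (pq21 p q) Nil_Isom" "\<phi> A = a" "\<phi> B = b"
      and g: "g \<in> carrier (pq21 p q)" "\<phi> g = \<one>\<^bsub>Nil_Isom\<^esub>"
    show "g = \<one>\<^bsub>pq21 p q\<^esub>"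
    proof (rule kernel_trivial[of B A e, folded A_def B_def, OF _ hc HOL.refl \<phi>])
      show "\<phi> B = nil_map (cis (2 * pi / q)) ((1 - \<beta>) * x) (t / 2)"
        unfolding \<phi> b_eq \<beta>_def ..
      show "\<phi> A = nil_map (cis (2 * pi / q) ^ e) 0 0"
        unfolding \<phi> a_eq power(1) \<beta>_def ..
      show "base_pt ((\<phi> B ^^ e) origin) \<noteq> base_pt (\<phi> A origin)"
        unfolding \<phi> b_funpow_nil_map a_eq power(1)[symmetric] using power(2) x by simp
    qed (simp_all add: q rels(1,2) g)
  qed
qed

text \<open>The relation \<open>abab\<close> = \<open>baba\<close> is symmetric, so the algebra of
  the case (3, 6) applies with the generators exchanged.\<close>

lemma realizes_pq21_63:
  assumes "x > 0"
  shows "realizes_pq21 6 3 x"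
proof -
  interpret prism_group 6 x 3 using assms by (rule prism_group_63)
  interpret G: group "pq21 6 3" by (rule group_pq21)
  define A B where "A = pq21_class 6 3 [(GenA, True)]" and "B = pq21_class 6 3 [(GenB, True)]"
  have carr [simp]: "A \<in> carrier (pq21 6 3)" "B \<in> carrier (pq21 6 3)" by (simp_all add: A_def B_def)
  note rels = pq21_generator_relations(3-5)[of 6 3, folded A_def B_def]
  have "A [^]\<^bsub>pq21 6 3\<^esub> (2::nat) = A \<otimes>\<^bsub>pq21 6 3\<^esub> A" by (rule G.nat_pow_2) simp
  with G.heisenberg_cyclic_6[OF carr(2,1) rels(2,1) rels(3)[symmetric]]
  obtain Y c where hc:
    "heisenberg_cyclic (pq21 6 3) (B \<otimes>\<^bsub>pq21 6 3\<^esub> inv\<^bsub>pq21 6 3\<^esub> (A [^]\<^bsub>pq21 6 3\<^esub> (2::nat))) Y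
      (B \<otimes>\<^bsub>pq21 6 3\<^esub> A \<otimes>\<^bsub>pq21 6 3\<^esub> B \<otimes>\<^bsub>pq21 6 3\<^esub> A) A c"
    by metis
  have \<beta>: "\<beta> = cis (2 * pi / 6) ^ 2" "\<beta> \<noteq> 1"
    using eis_eq_iff[of 0 1 1 0] by (simp_all add: \<beta>_def cis_60 cis_120 eis_120_eq[symmetric] eis_1)
  show ?thesis
  proof (rule realizes_pq21I, fold A_def B_def)
    fix \<phi> g
    assume \<phi>: "\<phi> \<in> hom (pq21 6 3) Nil_Isom" "\<phi> A = a" "\<phi> B = b"
      and g: "g \<in> carrier (pq21 6 3)" "\<phi> g = \<one>\<^bsub>Nil_Isom\<^esub>"
    show "g = \<one>\<^bsub>pq21 6 3\<^esub>"
    proof (rule kernel_trivial[of A B 2, folded A_def B_def, OF _ hc HOL.refl \<phi>])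
      show "\<phi> A = nil_map (cis (2 * pi / real 6)) 0 0"
        unfolding \<phi> a_eq \<alpha>_def ..
      show "\<phi> B = nil_map (cis (2 * pi / real 6) ^ 2) ((1 - \<beta>) * x) (t / 2)"
        unfolding \<phi> b_eq using \<beta>(1) by simp
      show "base_pt ((\<phi> A ^^ 2) origin) \<noteq> base_pt (\<phi> B origin)"
        unfolding \<phi> a_funpow b_eq using \<beta>(2) x by simp
    qed (simp_all add: rels(1) g)
  qed
qed

lemma (in prism_tiling) pq21_prism_tiling:
  assumes "realizes_pq21 p q x"
  shows "pq21_prism_tiling p q x tiles"
  unfolding pq21_prism_tiling_def Let_def
  by (intro conjI exI[of _ t] assms abab regular_prism_tiling) (simp add: tiles_def tile_def)

lemma pq21_angle_condition:
  assumes "p \<ge> 3" "q \<ge> 3" "pq21_prism_tiling p q x \<T>"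
  shows "(p, q) \<in> {(3, 6), (4, 4), (6, 3)}"
proof -
  define \<alpha> \<beta> where "\<alpha> = cis (2 * pi / p)" and "\<beta> = cis (2 * pi / q)"
  have norm: "cmod \<alpha> = 1" "cmod \<beta> = 1" by (simp_all add: \<alpha>_def \<beta>_def)
  obtain s where "rot_a p \<otimes>\<^bsub>Nil_Isom\<^esub> rot_b p q x \<otimes>\<^bsub>Nil_Isom\<^esub> rot_a p \<otimes>\<^bsub>Nil_Isom\<^esub> rot_b p q x = fibre_translation s"
    using assms(3) unfolding pq21_prism_tiling_def Let_def by blast
  then have "rot_b p q x \<circ> (rot_a p \<circ> (rot_b p q x \<circ> rot_a p)) = nil_map 1 0 s"
    by (simp only: Nil_Isom_mult fibre_translation_eq_nil_map)
  moreover have "\<exists>v u. rot_b p q x \<circ> (rot_a p \<circ> (rot_b p q x \<circ> rot_a p)) = nil_map (\<beta> * (\<alpha> * (\<beta> * \<alpha>))) v u"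
    unfolding rot_a_eq rot_b_eq \<alpha>_def[symmetric] \<beta>_def[symmetric] nil_map_comp[OF norm(1)] nil_map_comp[OF norm(2)]
    by blast
  ultimately have "\<beta> * (\<alpha> * (\<beta> * \<alpha>)) = 1" by (auto simp only: nil_map_eq_iff)
  moreover have "\<beta> * (\<alpha> * (\<beta> * \<alpha>)) = cis (4 * pi / p + 4 * pi / q)"
    unfolding \<alpha>_def \<beta>_def cis_mult by (rule arg_cong[of _ _ cis]) simp
  ultimately have "cos (4 * pi / p + 4 * pi / q) = 1" by (simp add: complex_eq_iff)
  then obtain n :: int where "4 * pi / p + 4 * pi / q = real_of_int n * 2 * pi" unfolding cos_one_2pi_int by blast
  then have "(2 / p + 2 / q) * (2 * pi) = n * (2 * pi)" by (simp add: algebra_simps)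
  then have n: "2 / p + 2 / q = real_of_int n" by (simp only: mult_cancel_right) simp
  \<comment> \<open>The integer lies strictly between 0 and 2, as each summand is at most 2 /
    3.\<close>
  have "2 / real p > 0" "2 / real q > 0" "2 / real p \<le> 2 / 3" "2 / real q \<le> 2 / 3"
    using assms(1,2) by (simp_all add: field_simps)
  with n have "n = 1" by linarith
  with n have "2 * real q + 2 * real p = real p * real q"
    using assms(1,2) by (simp add: field_simps)
  then have "real (2 * q + 2 * p) = real (p * q)" by simp
  then have pq: "2 * q + 2 * p = p * q" by (simp only: of_nat_eq_iff)
  have "p \<le> 6"
  proof -
    \<comment> \<open>The equation reads (p - 2) q = 2 p, and \<open>q\<close> \<ge> 3 bounds
      \<open>p\<close>.\<close>
    have "(p - 2) * 3 \<le> (p - 2) * q" using assms(2) by (intro mult_left_mono) simp_all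
    also have "\<dots> = 2 * p" by (simp add: diff_mult_distrib flip: pq)
    finally show ?thesis by simp
  qed
  then have "p = 3 \<or> p = 4 \<or> p = 5 \<or> p = 6" using assms(1) by linarith
  moreover have "3 * q \<noteq> 10" by presburger
  ultimately show ?thesis using pq by auto
qed

theorem theorem3p4:
  shows "{(p, q). p \<ge> 3 \<and> q \<ge> 3 \<and> (\<exists>x::real. x > 0 \<and> (\<exists>\<T>. pq21_prism_tiling p q x \<T>))}
           = {(3, 6), (4, 4), (6, 3)}
       \<and> (\<forall>(p, q) \<in> {(3, 6), (4, 4), (6, 3)}. \<forall>x::real. x > 0 \<longrightarrow> (\<exists>\<T>. pq21_prism_tiling p q x \<T>))"
proof -
  have exists: "\<exists>\<T>. pq21_prism_tiling p q x \<T>"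
    if "(p, q) \<in> {(3, 6), (4, 4), (6, 3)}" "x > 0" for p q :: nat and x :: real
  proof -
    have "pq21_prism_tiling 3 6 x (prism_tiling.tiles 3 x 6)"
      by (intro prism_tiling.pq21_prism_tiling prism_tiling_36 realizes_pq21_larger_q[where e = 2] prism_group_36 that) simp
    then have 1: "\<exists>\<T>. pq21_prism_tiling 3 6 x \<T>" by (rule exI)
    have "pq21_prism_tiling 4 4 x (prism_tiling.tiles 4 x 4)"
      by (intro prism_tiling.pq21_prism_tiling prism_tiling_44 realizes_pq21_larger_q[where e = 1] prism_group_44 that) simp
    then have 2: "\<exists>\<T>. pq21_prism_tiling 4 4 x \<T>" by (rule exI)
    have "pq21_prism_tiling 6 3 x (prism_tiling.tiles 6 x 3)"
      by (intro prism_tiling.pq21_prism_tiling prism_tiling_63 realizes_pq21_63 that)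
    then have 3: "\<exists>\<T>. pq21_prism_tiling 6 3 x \<T>" by (rule exI)
    have "p = 3 \<and> q = 6 \<or> p = 4 \<and> q = 4 \<or> p = 6 \<and> q = 3" using that(1) by simp
    then show ?thesis using 1 2 3 by (elim disjE conjE) (simp_all only:)
  qed
  have "{(p, q). p \<ge> 3 \<and> q \<ge> 3 \<and> (\<exists>x::real. x > 0 \<and> (\<exists>\<T>. pq21_prism_tiling p q x \<T>))}
      = {(3, 6), (4, 4), (6, 3)}" (is "?L = ?R")
  proof (intro equalityI subsetI)
    fix pq assume L: "pq \<in> ?L"
    obtain p q where pq: "pq = (p, q)" by (cases pq)
    obtain x \<T> where "p \<ge> 3" "q \<ge> 3" "pq21_prism_tiling p q x \<T>"
      using L unfolding pq mem_Collect_eq prod.case by (elim conjE exE) (rule that)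
    then show "pq \<in> ?R" unfolding pq by (rule pq21_angle_condition)
  next
    fix pq assume "pq \<in> ?R"
    then obtain p q where pq: "pq = (p, q)" "(p, q) \<in> ?R" by (cases pq) simp
    then have "p \<ge> 3" "q \<ge> 3" by auto
    moreover have "\<exists>\<T>. pq21_prism_tiling p q 1 \<T>" using exists[OF pq(2)] by simp
    ultimately show "pq \<in> ?L" unfolding pq(1) mem_Collect_eq prod.case
      by (intro conjI exI[of _ "1::real"] zero_less_one)
  qed
  moreover have "\<forall>(p, q) \<in> {(3, 6), (4, 4), (6, 3)}. \<forall>x::real. x > 0 \<longrightarrow> (\<exists>\<T>. pq21_prism_tiling p q x \<T>)"
  proof
    fix pq assume R: "pq \<in> ?R"
    obtain p q where pq: "pq = (p, q)" by (cases pq)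
    show "case pq of (p, q) \<Rightarrow> \<forall>x::real. x > 0 \<longrightarrow> (\<exists>\<T>. pq21_prism_tiling p q x \<T>)"
      using exists R unfolding pq prod.case by (intro allI impI)
  qed
  ultimately show ?thesis by (rule conjI)
qed

end
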